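(* Fix $\kappa>0$, let $\phi\in L^2(\mathbb R)$ and let $\chi$ be a continuous function of compact support on $\mathbb R$. Suppose $T>0$ and $\epsilon>0$ are given. Then there is an $f_{\epsilon,T,\chi,\phi}>0$ such that for all $0\le t\le T$, all $0<f<f_{\epsilon,T,\chi,\phi}$ and all $\eta>0$, $$\big\| e^{-itH_{\kappa,\eta,f}}\chi(H_{\kappa,\eta,f})\phi-e^{-itH_{\kappa,\eta}}\chi(H_{\kappa,\eta})\phi\big\|<\epsilon .$$
   Context: With $p=-i\frac{d}{dx}$ and $\delta_{\pm\kappa}$ the delta functions at $\pm\kappa$, for $\kappa,\eta,f>0$ one considers the self-adjoint realizations in $L^2(\mathbb R)$ of $$H_{\kappa,\eta}=p^2+\tfrac1\eta(\delta_\kappa+\delta_{-\kappa}),\qquad H_{\kappa,\eta,f}=p^2+fx+\tfrac1\eta(\delta_\kappa+\delta_{-\kappa}).$$ ($H_{\kappa,\eta}$ is the operator of the quadratic form $\int|u'|^2dx+\eta^{-1}(|u(\kappa)|^2+|u(-\kappa)|^2)$ on $H^1(\mathbb R)$; for both operators, functions in the domain are continuous with jump condition $u'(\pm\kappa+0)-u'(\pm\kappa-0)=\eta^{-1}u(\pm\kappa)$, and away from $\pm\kappa$ the operators act as $-u''$, respectively $-u''+fxu$, with result in $L^2$.) $\chi(H)$ and $e^{-itH}$ are defined by the functional calculus. *)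

theory Defs
  imports "HOL-Analysis.Analysis"
begin

section \<open>The complex Hilbert space of square-integrable functions on the real line\<close>

definition square_integrable :: "(real \<Rightarrow> complex) \<Rightarrow> bool" where
  "square_integrable u \<longleftrightarrow>
     u \<in> borel_measurable lborel \<and> integrable lborel (\<lambda>x. (cmod (u x))\<^sup>2)"

lemma square_integrable_zero: "square_integrable (\<lambda>_. 0)"
  by (simp add: square_integrable_def)

lemma square_integrable_cmult:
  assumes "square_integrable u" shows "square_integrable (\<lambda>x. c * u x)"
  using assms by (auto simp: square_integrable_def norm_mult power_mult_distrib)

lemma square_integrable_scaleR:
  assumes "square_integrable u" shows "square_integrable (\<lambda>x. r *\<^sub>R u x)"
  using square_integrable_cmult[OF assms, of "of_real r"] by (simp add: scaleR_conv_of_real)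

lemma square_integrable_uminus:
  assumes "square_integrable u" shows "square_integrable (\<lambda>x. - u x)"
  using square_integrable_cmult[OF assms, of "-1"] by simp

lemma square_integrable_add:
  assumes u: "square_integrable u" and v: "square_integrable v"
  shows "square_integrable (\<lambda>x. u x + v x)"
proof -
  have bound: "(cmod (a + b))\<^sup>2 \<le> 2 * (cmod a)\<^sup>2 + 2 * (cmod b)\<^sup>2" for a b
  proof -
    have "(cmod (a + b))\<^sup>2 \<le> (cmod a + cmod b)\<^sup>2"
      by (intro power_mono norm_triangle_ineq norm_ge_zero)
    also have "\<dots> \<le> 2 * (cmod a)\<^sup>2 + 2 * (cmod b)\<^sup>2"
      using sum_squares_bound[of "cmod a" "cmod b"] by (simp add: power2_sum)
    finally show ?thesis .
  qed
  have [measurable]: "u \<in> borel_measurable lborel" "v \<in> borel_measurable lborel"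
    using u v by (auto simp: square_integrable_def)
  have "integrable lborel (\<lambda>x. 2 * (cmod (u x))\<^sup>2 + 2 * (cmod (v x))\<^sup>2)"
    using u v by (auto simp: square_integrable_def)
  then have "integrable lborel (\<lambda>x. (cmod (u x + v x))\<^sup>2)"
    by (rule Bochner_Integration.integrable_bound) (use bound in auto)
  then show ?thesis by (simp add: square_integrable_def)
qed

lemma square_integrable_diff:
  assumes "square_integrable u" and "square_integrable v"
  shows "square_integrable (\<lambda>x. u x - v x)"
  using square_integrable_add[OF assms(1) square_integrable_uminus[OF assms(2)]] by simp

lemma square_integrable_cnj_mult:
  assumes u: "square_integrable u" and v: "square_integrable v"
  shows "integrable lborel (\<lambda>x. cnj (u x) * v x)"
proof -
  have [measurable]: "u \<in> borel_measurable lborel" "v \<in> borel_measurable lborel"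
    using u v by (auto simp: square_integrable_def)
  have [measurable]: "(\<lambda>x. cnj (u x)) \<in> borel_measurable lborel"
    by (rule measurable_compose[of u _ borel])
       (auto intro!: borel_measurable_continuous_onI continuous_intros)
  have bound: "cmod a * cmod b \<le> (cmod a)\<^sup>2 + (cmod b)\<^sup>2" for a b
    using sum_squares_bound[of "cmod a" "cmod b"]
      mult_nonneg_nonneg[OF norm_ge_zero[of a] norm_ge_zero[of b]] by linarith
  have "integrable lborel (\<lambda>x. (cmod (u x))\<^sup>2 + (cmod (v x))\<^sup>2)"
    using u v by (auto simp: square_integrable_def)
  then show ?thesis
    by (rule Bochner_Integration.integrable_bound) (use bound in \<open>auto simp: norm_mult\<close>)
qed

quotient_type L2 = "real \<Rightarrow> complex" / partial:
  "\<lambda>u v. square_integrable u \<and> square_integrable v \<and> (AE x in lborel. u x = v x)"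
proof (rule part_equivpI)
  show "\<exists>u. square_integrable u \<and> square_integrable u \<and> (AE x in lborel. u x = u x)"
    using square_integrable_zero by auto
  show "symp (\<lambda>u v. square_integrable u \<and> square_integrable v \<and> (AE x in lborel. u x = v x))"
    by (rule sympI) (auto elim: eventually_mono)
  show "transp (\<lambda>u v. square_integrable u \<and> square_integrable v \<and> (AE x in lborel. u x = v x))"
    by (rule transpI) auto
qed

lift_definition scaleC :: "complex \<Rightarrow> L2 \<Rightarrow> L2" is "\<lambda>c u x. c * u x"
  by (auto simp: square_integrable_cmult)

lift_definition cinner :: "L2 \<Rightarrow> L2 \<Rightarrow> complex" is
  "\<lambda>u v. LINT x|lborel. cnj (u x) * v x"
proof -
  fix u u' v v' :: "real \<Rightarrow> complex"
  assume u: "square_integrable u \<and> square_integrable u' \<and> (AE x in lborel. u x = u' x)"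
    and v: "square_integrable v \<and> square_integrable v' \<and> (AE x in lborel. v x = v' x)"
  have "AE x in lborel. cnj (u x) * v x = cnj (u' x) * v' x"
    using u v by auto
  then show "(LINT x|lborel. cnj (u x) * v x) = (LINT x|lborel. cnj (u' x) * v' x)"
    using u v by (intro integral_cong_AE borel_measurable_integrable square_integrable_cnj_mult) auto
qed

instantiation L2 :: real_vector
begin

lift_definition zero_L2 :: L2 is "\<lambda>_. 0" by (simp add: square_integrable_zero)
lift_definition plus_L2 :: "L2 \<Rightarrow> L2 \<Rightarrow> L2" is "\<lambda>u v x. u x + v x"
  by (auto simp: square_integrable_add)
lift_definition uminus_L2 :: "L2 \<Rightarrow> L2" is "\<lambda>u x. - u x"
  by (auto simp: square_integrable_uminus)
lift_definition minus_L2 :: "L2 \<Rightarrow> L2 \<Rightarrow> L2" is "\<lambda>u v x. u x - v x"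
  by (auto simp: square_integrable_diff)
lift_definition scaleR_L2 :: "real \<Rightarrow> L2 \<Rightarrow> L2" is "\<lambda>r u x. r *\<^sub>R u x"
  by (auto simp: square_integrable_scaleR)

instance
proof
  fix u v w :: L2 and a b :: real
  note sq = square_integrable_zero square_integrable_add square_integrable_scaleR
    square_integrable_uminus square_integrable_diff
  show "u + v + w = u + (v + w)" by transfer (simp add: sq add.assoc)
  show "u + v = v + u" by transfer (simp add: sq add.commute)
  show "0 + u = u" by transfer (simp add: sq)
  show "- u + u = 0" by transfer (simp add: sq)
  show "u - v = u + - v" by transfer (simp add: sq)
  show "a *\<^sub>R (u + v) = a *\<^sub>R u + a *\<^sub>R v" by transfer (simp add: sq scaleR_add_right)
  show "(a + b) *\<^sub>R u = a *\<^sub>R u + b *\<^sub>R u" by transfer (simp add: sq scaleR_add_left)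
  show "a *\<^sub>R b *\<^sub>R u = (a * b) *\<^sub>R u" by transfer (simp add: sq)
  show "1 *\<^sub>R u = u" by transfer simp
qed

end

instantiation L2 :: real_inner
begin

definition inner_L2 :: "L2 \<Rightarrow> L2 \<Rightarrow> real" where "inner_L2 u v = Re (cinner u v)"
definition norm_L2 :: "L2 \<Rightarrow> real" where "norm_L2 u = sqrt (inner u u)"
definition dist_L2 :: "L2 \<Rightarrow> L2 \<Rightarrow> real" where "dist_L2 u v = norm (u - v)"
definition sgn_L2 :: "L2 \<Rightarrow> L2" where "sgn_L2 u = u /\<^sub>R norm u"
definition uniformity_L2 :: "(L2 \<times> L2) filter" where
  "uniformity_L2 = (INF e\<in>{0<..}. principal {(u, v). dist u v < e})"
definition open_L2 :: "L2 set \<Rightarrow> bool" where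
  "open_L2 U \<longleftrightarrow> (\<forall>u\<in>U. eventually (\<lambda>(u', v). u' = u \<longrightarrow> v \<in> U) uniformity)"

instance
proof
  fix u v w :: L2 and r :: real
  show "inner u v = inner v u"
    unfolding inner_L2_def
  proof transfer
    fix u v :: "real \<Rightarrow> complex"
    have "(LINT x|lborel. cnj (v x) * u x) = (LINT x|lborel. cnj (cnj (u x) * v x))"
      by (simp add: mult.commute)
    also have "\<dots> = cnj (LINT x|lborel. cnj (u x) * v x)"
      by (rule Bochner_Integration.integral_cnj)
    finally show "Re (LINT x|lborel. cnj (u x) * v x) = Re (LINT x|lborel. cnj (v x) * u x)"
      by simp
  qed
  show "inner (u + v) w = inner u w + inner v w"
    unfolding inner_L2_def
  proof transfer
    fix u v w :: "real \<Rightarrow> complex"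
    assume "square_integrable u \<and> square_integrable u \<and> (AE x in lborel. u x = u x)"
      "square_integrable v \<and> square_integrable v \<and> (AE x in lborel. v x = v x)"
      "square_integrable w \<and> square_integrable w \<and> (AE x in lborel. w x = w x)"
    then show "Re (LINT x|lborel. cnj (u x + v x) * w x) =
      Re (LINT x|lborel. cnj (u x) * w x) + Re (LINT x|lborel. cnj (v x) * w x)"
      by (simp add: distrib_right square_integrable_cnj_mult)
  qed
  show "inner (r *\<^sub>R u) v = r * inner u v"
    unfolding inner_L2_def
    by transfer (simp add: scaleR_conv_of_real mult.assoc)
  have eq: "(LINT x|lborel. cnj (u x) * u x) = of_real (LINT x|lborel. (cmod (u x))\<^sup>2)"
    for u :: "real \<Rightarrow> complex"
  proof -
    have "cnj z * z = of_real ((cmod z)\<^sup>2)" for z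
      by (metis complex_norm_square mult.commute)
    then show ?thesis by (simp only: integral_complex_of_real)
  qed
  show "0 \<le> inner u u"
    unfolding inner_L2_def by transfer (simp add: eq)
  show "inner u u = 0 \<longleftrightarrow> u = 0"
    unfolding inner_L2_def
  proof transfer
    fix u :: "real \<Rightarrow> complex"
    assume "square_integrable u \<and> square_integrable u \<and> (AE x in lborel. u x = u x)"
    then have u: "square_integrable u" by simp
    have "(LINT x|lborel. (cmod (u x))\<^sup>2) = 0 \<longleftrightarrow> (AE x in lborel. (cmod (u x))\<^sup>2 = 0)"
      using u by (intro integral_nonneg_eq_0_iff_AE) (auto simp: square_integrable_def)
    then show "(Re (LINT x|lborel. cnj (u x) * u x) = 0) \<longleftrightarrow>
      square_integrable u \<and> square_integrable (\<lambda>_. 0) \<and> (AE x in lborel. u x = 0)"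
      using u by (simp add: eq square_integrable_zero)
  qed
qed (rule dist_L2_def sgn_L2_def uniformity_L2_def open_L2_def norm_L2_def)+

end


section \<open>Spectral measures and the functional calculus\<close>

definition bounded_clinear :: "(L2 \<Rightarrow> L2) \<Rightarrow> bool" where
  "bounded_clinear T \<longleftrightarrow> bounded_linear T \<and> (\<forall>c u. T (scaleC c u) = scaleC c (T u))"

text \<open>Only the values of \<open>E\<close> on Borel sets are constrained. Countable additivity is in the strong
  operator topology and includes \<open>E {} = 0\<close>; it implies \<open>E (A \<inter> B) = E A \<circ> E B\<close>.\<close>

definition projection_valued_measure :: "(real set \<Rightarrow> L2 \<Rightarrow> L2) \<Rightarrow> bool" where
  "projection_valued_measure E \<longleftrightarrow>
     (\<forall>B\<in>sets borel. bounded_clinear (E B) \<and> E B \<circ> E B = E B \<and>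
        (\<forall>u v. cinner (E B u) v = cinner u (E B v))) \<and>
     E UNIV = id \<and>
     (\<forall>B :: nat \<Rightarrow> real set. range B \<subseteq> sets borel \<and> disjoint_family B \<longrightarrow>
        (\<forall>u. (\<lambda>n. E (B n) u) sums E (\<Union>n. B n) u))"

definition spectral_distribution :: "(real set \<Rightarrow> L2 \<Rightarrow> L2) \<Rightarrow> L2 \<Rightarrow> real measure" where
  "spectral_distribution E u = measure_of UNIV (sets borel) (\<lambda>B. ennreal ((norm (E B u))\<^sup>2))"

text \<open>For bounded Borel \<open>g\<close> this is the operator \<open>\<integral> g dE\<close>, determined (by polarization) by its
  quadratic form.\<close>

definition spectral_integral :: "(real set \<Rightarrow> L2 \<Rightarrow> L2) \<Rightarrow> (real \<Rightarrow> complex) \<Rightarrow> L2 \<Rightarrow> L2" where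
  "spectral_integral E g = (THE T. bounded_clinear T \<and>
     (\<forall>u. cinner u (T u) = (LINT s|spectral_distribution E u. g s)))"

text \<open>An unbounded operator is given by its graph. \<open>E\<close> is the spectral measure of \<open>H\<close> if
  \<open>H = \<integral> \<lambda> dE(\<lambda>)\<close>: the domain is \<open>{u. \<integral> \<lambda>\<^sup>2 d\<parallel>E(\<lambda>) u\<parallel>\<^sup>2 < \<infinity>}\<close>, and on it \<open>H u\<close> is the limit of
  the truncated integrals. By the spectral theorem a self-adjoint \<open>H\<close> has exactly one spectral
  measure \<open>E\<close> (on Borel sets); then \<open>g(H)\<close> is \<open>spectral_integral E g\<close>.\<close>

definition spectral_measure_of :: "(L2 \<times> L2) set \<Rightarrow> (real set \<Rightarrow> L2 \<Rightarrow> L2) \<Rightarrow> bool" where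
  "spectral_measure_of H E \<longleftrightarrow> projection_valued_measure E \<and>
     H = {(u, w). integrable (spectral_distribution E u) (\<lambda>s. s\<^sup>2) \<and>
            (\<lambda>n. spectral_integral E (\<lambda>s. of_real (s * indicator {- real n..real n} s)) u)
              \<longlonglongrightarrow> w}"


section \<open>The Hamiltonians\<close>

text \<open>The graph of \<open>p\<^sup>2 + f x + (\<delta>\<^bsub>\<kappa>\<^esub> + \<delta>\<^bsub>-\<kappa>\<^esub>)/\<eta>\<close> on its maximal domain, for \<open>f \<ge> 0\<close>. On intervals
  avoiding \<open>\<plusminus>\<kappa>\<close>, the equation \<open>w = - u'' + f x u\<close>, with \<open>u'\<close> locally absolutely continuous, is
  written in integrated form (the integrand is locally integrable since \<open>u\<close> is continuous and \<open>w\<close>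
  is square-integrable). The operator is self-adjoint, the differential expression being in the
  limit point case at \<open>\<plusminus>\<infinity>\<close>. For \<open>f = 0\<close> one automatically has \<open>u' \<in> L\<^sup>2\<close>, that is \<open>u \<in> H\<^sup>1\<close>.\<close>

definition stark_delta_hamiltonian :: "real \<Rightarrow> real \<Rightarrow> real \<Rightarrow> (L2 \<times> L2) set" where
  "stark_delta_hamiltonian \<kappa> \<eta> f = {(abs_L2 u, abs_L2 w) | u w.
     square_integrable u \<and> square_integrable w \<and> continuous_on UNIV u \<and>
     (\<exists>u'. (\<forall>x. x \<noteq> \<kappa> \<longrightarrow> x \<noteq> - \<kappa> \<longrightarrow> (u has_vector_derivative u' x) (at x)) \<and>
        (\<forall>a b. a \<le> b \<longrightarrow> \<kappa> \<notin> {a..b} \<longrightarrow> - \<kappa> \<notin> {a..b} \<longrightarrow>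
           u' b - u' a = (LINT x:{a..b}|lborel. of_real (f * x) * u x - w x)) \<and>
        (\<forall>p\<in>{\<kappa>, - \<kappa>}. \<exists>l r. (u' \<longlongrightarrow> l) (at_left p) \<and> (u' \<longlongrightarrow> r) (at_right p) \<and>
           r - l = u p / of_real \<eta>))}"

definition delta_hamiltonian :: "real \<Rightarrow> real \<Rightarrow> (L2 \<times> L2) set" where
  "delta_hamiltonian \<kappa> \<eta> = stark_delta_hamiltonian \<kappa> \<eta> 0"

end

theory Submission
  imports Defs
begin

text \<open>Let \<open>u = (H\<^sub>0 - z)\<^sup>-\<^sup>1 \<psi>\<close> with \<open>z = \<plusminus>\<i>\<close>. If \<open>x u \<in> L\<^sup>2\<close>, then \<open>u\<close> also lies in the domain of the Stark
  operator \<open>H\<^sub>f\<close>, and \<open>(H\<^sub>f - z)\<^sup>-\<^sup>1 \<psi> - u = - f (H\<^sub>f - z)\<^sup>-\<^sup>1 (x u)\<close> has norm at most \<open>f \<parallel>x u\<parallel>\<close>. An energy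
  estimate with weight \<open>W \<approx> x\<close> bounds \<open>\<parallel>x u\<parallel>\<close> by \<open>\<parallel>\<psi>\<parallel>\<close> and \<open>\<parallel>x \<psi>\<parallel>\<close> uniformly in \<open>\<eta>\<close>, because the delta
  terms enter with the good sign. Since the bound on the first moment reproduces itself, the
  estimate extends from the resolvents to all polynomials in them (and in \<open>t\<close>). By Stone--Weierstrass
  these approximate \<open>exp(-its) chi(s)\<close> uniformly in \<open>s\<close> and \<open>t \<in> [0,T]\<close>, and the vectors with finite
  first moment are dense.\<close>

section \<open>The Hilbert space\<close>

text \<open>Two perturbations are out of control in norm: \<open>f x\<close> is unbounded, and the
  coupling \<open>1 / \<eta>\<close> is arbitrarily large. The comparison is therefore asymmetric.
  Moments are estimated for \<open>H\<^sub>0\<close> only; the Stark operator enters only through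
  sup bounds on its functional calculus, which depend on neither \<open>f\<close> nor \<eta>. From
  the domains two facts are drawn: the resolvent of \<open>H\<^sub>0\<close> maps into its graph,
  and the resolvent of \<open>H\<^sub>f\<close> is a left inverse of \<open>H\<^sub>f - z\<close>.
  Since \<open>x u \<in> L\<^sup>2\<close> is a conclusion and not a hypothesis, the weight is first
  cut off at a scale \<open>m\<close>, with constants that do not depend on \<open>m\<close>. Both
  signs of \<open>z\<close> are needed because only together do the two resolvent functions generate
  the real functions to which the real form of Stone--Weierstrass applies. The role of
  \<open>chi\<close> is to make the function to be approximated vanish at infinity: for
  \<open>t \<noteq> 0\<close> the exponential alone has no limit there, while every polynomial in
  the resolvents has one.\<close>

lemma square_integrable_measurable [measurable_dest]: "square_integrable u \<Longrightarrow> u \<in> borel_measurable borel"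
  by (simp add: square_integrable_def)

lemma square_integrable_norm_sq: "square_integrable u \<Longrightarrow> integrable lborel (\<lambda>x. (cmod (u x))\<^sup>2)"
  by (simp add: square_integrable_def)

lemma square_integrable_rep: "square_integrable (rep_L2 u)"
  using Quotient3_rep_reflp[OF Quotient3_L2] by auto

lemma abs_rep_L2: "abs_L2 (rep_L2 u) = u"
  by (rule Quotient3_abs_rep[OF Quotient3_L2])

lemma L2_exhaust: obtains h where "square_integrable h" "u = abs_L2 h"
  using square_integrable_rep abs_rep_L2 by metis

lemma abs_L2_eq_iff:
  assumes "square_integrable h" "square_integrable k"
  shows "abs_L2 h = abs_L2 k \<longleftrightarrow> (AE x in lborel. h x = k x)"
  using Quotient3_rel[OF Quotient3_L2, of h k] assms by auto

lemma plus_abs_L2: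
  "square_integrable h \<Longrightarrow> square_integrable k \<Longrightarrow> abs_L2 h + abs_L2 k = abs_L2 (\<lambda>x. h x + k x)"
  by (subst plus_L2.abs_eq) auto

lemma minus_abs_L2:
  "square_integrable h \<Longrightarrow> square_integrable k \<Longrightarrow> abs_L2 h - abs_L2 k = abs_L2 (\<lambda>x. h x - k x)"
  by (subst minus_L2.abs_eq) auto

lemma scaleC_abs_L2: "square_integrable h \<Longrightarrow> scaleC c (abs_L2 h) = abs_L2 (\<lambda>x. c * h x)"
  by (subst scaleC.abs_eq) auto

lemma cinner_abs_L2:
  "square_integrable h \<Longrightarrow> square_integrable k \<Longrightarrow>
    cinner (abs_L2 h) (abs_L2 k) = (LINT x|lborel. cnj (h x) * k x)"
  by (subst cinner.abs_eq) auto

lemma cinner_add_right: "cinner u (v + w) = cinner u v + cinner u w"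
proof -
  obtain a b c where "square_integrable a" "u = abs_L2 a" "square_integrable b" "v = abs_L2 b"
    "square_integrable c" "w = abs_L2 c"
    by (metis L2_exhaust)
  then show ?thesis
    by (simp add: plus_abs_L2 cinner_abs_L2 square_integrable_add distrib_left square_integrable_cnj_mult)
qed

lemma cinner_commute: "cinner u v = cnj (cinner v u)"
proof -
  obtain a b where *: "square_integrable a" "u = abs_L2 a" "square_integrable b" "v = abs_L2 b"
    by (metis L2_exhaust)
  have "cnj (LINT x|lborel. cnj (b x) * a x) = (LINT x|lborel. cnj (cnj (b x) * a x))"
    by (rule Bochner_Integration.integral_cnj[symmetric])
  with * show ?thesis by (simp add: cinner_abs_L2 mult.commute)
qed

lemma cinner_scaleC_right: "cinner u (scaleC c v) = c * cinner u v"
proof -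
  obtain a b where *: "square_integrable a" "u = abs_L2 a" "square_integrable b" "v = abs_L2 b"
    by (metis L2_exhaust)
  have "(LINT x|lborel. cnj (a x) * (c * b x)) = (LINT x|lborel. c * (cnj (a x) * b x))"
    by (simp add: algebra_simps)
  with * show ?thesis by (simp add: scaleC_abs_L2 cinner_abs_L2 square_integrable_cmult)
qed

lemma cinner_add_left: "cinner (u + v) w = cinner u w + cinner v w"
  by (metis cinner_add_right cinner_commute complex_cnj_add)

lemma cinner_scaleC_left: "cinner (scaleC c u) v = cnj c * cinner u v"
  by (metis cinner_scaleC_right cinner_commute complex_cnj_mult)

lemma scaleC_add_left: "scaleC (a + b) u = scaleC a u + scaleC b u"
  by (cases u rule: L2_exhaust)
    (simp add: scaleC_abs_L2 plus_abs_L2 square_integrable_cmult distrib_right)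

lemma scaleC_add_right: "scaleC a (u + v) = scaleC a u + scaleC a v"
  by (cases u rule: L2_exhaust, cases v rule: L2_exhaust)
    (simp add: scaleC_abs_L2 plus_abs_L2 square_integrable_cmult square_integrable_add distrib_left)

lemma scaleC_scaleC: "scaleC a (scaleC b u) = scaleC (a * b) u"
  by (cases u rule: L2_exhaust) (simp add: scaleC_abs_L2 square_integrable_cmult mult.assoc)

lemma scaleR_L2_eq_scaleC: "r *\<^sub>R u = scaleC (of_real r) u"
proof (cases u rule: L2_exhaust)
  case (1 h)
  then show ?thesis
    by (simp add: scaleC_abs_L2 scaleR_L2.abs_eq scaleR_conv_of_real)
qed

lemma scaleC_one: "scaleC 1 u = u"
  using scaleR_L2_eq_scaleC[of 1 u] by simp

lemma scaleC_zero_right: "scaleC a 0 = 0"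
  using scaleC_add_right[of a 0 0] by simp

lemma scaleC_zero_left: "scaleC 0 u = 0"
  using scaleC_add_left[of 0 0 u] by simp

lemma scaleC_minus_left: "scaleC (- a) u = - scaleC a u"
  using scaleC_add_left[of a "- a" u] by (simp add: scaleC_zero_left eq_neg_iff_add_eq_0 add.commute)

lemma cinner_zero_right: "cinner u 0 = 0" and cinner_zero_left: "cinner 0 u = 0"
  using cinner_add_right[of u 0 0] cinner_add_left[of 0 0 u] by simp_all

lemma cinner_sum_right: "cinner u (sum f A) = (\<Sum>a\<in>A. cinner u (f a))"
  by (induction A rule: infinite_finite_induct) (auto simp: cinner_add_right cinner_zero_right)

lemma cinner_sum_left: "cinner (sum f A) u = (\<Sum>a\<in>A. cinner (f a) u)"
  by (induction A rule: infinite_finite_induct) (auto simp: cinner_add_left cinner_zero_left)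

lemma cinner_diff_right: "cinner u (v - w) = cinner u v - cinner u w"
  using cinner_add_right[of u "v - w" w] by simp

lemma cinner_self: "cinner u u = of_real ((norm u)\<^sup>2)"
proof -
  have "Im (cinner u u) = 0"
    using cinner_commute[of u u] by (metis complex_cnj complex.sel(2) equal_neg_zero complex.exhaust_sel)
  moreover have "Re (cinner u u) = (norm u)\<^sup>2"
    by (simp add: power2_norm_eq_inner inner_L2_def)
  ultimately show ?thesis by (simp add: complex_eq_iff)
qed

lemma norm_abs_L2:
  assumes "square_integrable h"
  shows "(norm (abs_L2 h))\<^sup>2 = (LINT x|lborel. (cmod (h x))\<^sup>2)"
proof -
  have "complex_of_real ((norm (abs_L2 h))\<^sup>2) = (LINT x|lborel. cnj (h x) * h x)"
    by (simp only: cinner_self[symmetric] cinner_abs_L2 assms)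
  also have "\<dots> = (LINT x|lborel. complex_of_real ((cmod (h x))\<^sup>2))"
    by (intro arg_cong[where f="integral\<^sup>L lborel"] ext) (metis complex_norm_square mult.commute)
  also have "\<dots> = complex_of_real (LINT x|lborel. (cmod (h x))\<^sup>2)"
    by (rule integral_complex_of_real)
  finally show ?thesis using of_real_eq_iff by blast
qed

lemma norm_abs_L2_nn:
  assumes "square_integrable h"
  shows "ennreal ((norm (abs_L2 h))\<^sup>2) = (\<integral>\<^sup>+x. ennreal ((cmod (h x))\<^sup>2) \<partial>lborel)"
  using assms by (simp add: norm_abs_L2 nn_integral_eq_integral square_integrable_norm_sq)

lemma norm_scaleC: "norm (scaleC c u) = cmod c * norm u"
proof -
  have "complex_of_real ((norm (scaleC c u))\<^sup>2) = cnj c * c * cinner u u"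
    by (simp only: cinner_self[symmetric] cinner_scaleC_left cinner_scaleC_right mult.assoc mult.left_commute)
  also have "\<dots> = complex_of_real ((cmod c * norm u)\<^sup>2)"
    by (metis cinner_self complex_norm_square mult.commute of_real_mult power_mult_distrib)
  finally have "(norm (scaleC c u))\<^sup>2 = (cmod c * norm u)\<^sup>2"
    using of_real_eq_iff by blast
  then show ?thesis by (simp add: power2_eq_iff_nonneg)
qed

text \<open>Multiplying \<open>v\<close> by a phase makes the complex inner product real and
  nonnegative, so that Cauchy--Schwarz for the real inner product applies.\<close>

lemma cmod_cinner_le: "cmod (cinner u v) \<le> norm u * norm v"
proof -
  define c where "c = cnj (sgn (cinner u v))"
  have "c * cinner u v = cmod (cinner u v)"
  proof (cases "cinner u v = 0")
    case False
    have "c * cinner u v = cinner u v * cnj (cinner u v) / cmod (cinner u v)"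
      by (simp add: c_def sgn_eq)
    also have "\<dots> = cmod (cinner u v)"
      using False by (simp add: complex_norm_square[symmetric] power2_eq_square)
    finally show ?thesis .
  qed simp
  then have "cmod (cinner u v) = Re (cinner u (scaleC c v))"
    by (metis Re_complex_of_real cinner_scaleC_right)
  also have "\<dots> \<le> norm u * norm (scaleC c v)"
    using norm_cauchy_schwarz[of u "scaleC c v"] by (simp add: inner_L2_def)
  also have "\<dots> \<le> norm u * (1 * norm v)"
    unfolding norm_scaleC c_def by (intro mult_left_mono mult_right_mono) (auto simp: norm_sgn)
  finally show ?thesis by simp
qed

lemma bounded_linear_cinner_right: "bounded_linear (cinner u)"
proof (rule bounded_linear_intro[where K="norm u"])
  show "cinner u (r *\<^sub>R x) = r *\<^sub>R cinner u x" for r x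
    by (simp add: scaleR_L2_eq_scaleC cinner_scaleC_right scaleR_conv_of_real)
qed (use cmod_cinner_le in \<open>auto simp: cinner_add_right mult.commute[of "norm _" "norm u"]\<close>)

lemma ext_cinner:
  assumes "\<And>u. cinner u v = cinner u w" shows "v = w"
proof -
  have "cinner (v - w) (v - w) = 0" using assms[of "v - w"] by (simp add: cinner_diff_right)
  then show ?thesis by (simp add: cinner_self)
qed

text \<open>By polarization.\<close>

lemma ext_quadratic_form:
  assumes "bounded_clinear S" "bounded_clinear T" and eq: "\<And>u. cinner u (S u) = cinner u (T u)"
  shows "S = T"
proof
  fix v
  have add: "S (x + y) = S x + S y" "T (x + y) = T x + T y" for x y
    using assms by (auto simp: bounded_clinear_def linear_simps)
  have sc: "S (scaleC c x) = scaleC c (S x)" "T (scaleC c x) = scaleC c (T x)" for c x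
    using assms by (auto simp: bounded_clinear_def)
  show "S v = T v"
  proof (rule ext_cinner)
    fix u
    define d where "d x y = cinner x (S y) - cinner x (T y)" for x y
    have diag: "d x x = 0" for x using eq by (simp add: d_def)
    have "d (u + v) (u + v) = d u u + d u v + d v u + d v v"
      by (simp add: d_def add cinner_add_left cinner_add_right)
    then have 1: "d u v + d v u = 0" by (simp add: diag)
    have "d (u + scaleC \<i> v) (u + scaleC \<i> v) = d u u + \<i> * d u v - \<i> * d v u + d v v"
      by (simp add: d_def add sc cinner_add_left cinner_add_right cinner_scaleC_left
          cinner_scaleC_right algebra_simps)
    then have "\<i> * (d u v - d v u) = 0" by (simp add: diag algebra_simps)
    with 1 have "d u v = 0" by simp
    then show "cinner u (S v) = cinner u (T v)" by (simp add: d_def)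
  qed
qed

text \<open>Riesz--Fischer. Along a subsequence with \<open>\<parallel>h (k + 1) - h k\<parallel> \<le> 2\<^sup>-\<^sup>k\<close> the function
  \<open>\<Sum>k. 2\<^sup>k \<bar>h (k + 1) - h k\<bar>\<^sup>2\<close> is integrable, which makes \<open>\<Sum>k. \<bar>h (k + 1) - h k\<bar>\<close> finite almost
  everywhere.\<close>

instance L2 :: complete_space
proof
  fix X :: "nat \<Rightarrow> L2" assume X: "Cauchy X"
  have "\<exists>N. \<forall>m\<ge>N. \<forall>n\<ge>N. norm (X m - X n) < (1/2) ^ k" for k
    using CauchyD[OF X, of "(1/2) ^ k"] by simp
  then obtain N where N: "\<And>k m n. m \<ge> N k \<Longrightarrow> n \<ge> N k \<Longrightarrow> norm (X m - X n) < (1/2) ^ k"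
    by metis
  \<comment> \<open>Summing the thresholds makes \<open>n k\<close> at least \<open>N j\<close> for
    every \<open>j \<le> k\<close>.\<close>
  define n where "n k = sum N {..k}" for k
  have nN: "N j \<le> n k" if "j \<le> k" for j k
    unfolding n_def using that by (intro member_le_sum) auto
  define h where "h k = rep_L2 (X (n k))" for k
  have sq [intro, simp]: "square_integrable (h k)" for k by (simp add: h_def square_integrable_rep)
  have [measurable]: "h k \<in> borel_measurable borel" for k using sq square_integrable_measurable by blast
  have Xh: "X (n k) = abs_L2 (h k)" for k by (simp add: h_def abs_rep_L2)
  have close: "(\<integral>\<^sup>+x. ennreal ((cmod (h j x - h k x))\<^sup>2) \<partial>lborel) \<le> ennreal (((1/2) ^ k)\<^sup>2)"
    if "k \<le> j" for j k
  proof -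
    have "norm (abs_L2 (h j) - abs_L2 (h k)) < (1/2) ^ k"
      unfolding Xh[symmetric] using that by (intro N nN) auto
    then have "(norm (abs_L2 (h j) - abs_L2 (h k)))\<^sup>2 \<le> ((1/2) ^ k)\<^sup>2"
      by (intro power_mono) auto
    then show ?thesis
      by (subst norm_abs_L2_nn[symmetric])
        (auto simp: square_integrable_diff minus_abs_L2[symmetric] intro!: ennreal_leI)
  qed
  define d where "d k x = cmod (h (Suc k) x - h k x)" for k x
  have [measurable]: "d k \<in> borel_measurable borel" for k unfolding d_def by measurable
  have "(\<integral>\<^sup>+x. (\<Sum>k. ennreal (2 ^ k * (d k x)\<^sup>2)) \<partial>lborel)
      = (\<Sum>k. ennreal (2 ^ k) * (\<integral>\<^sup>+x. ennreal ((d k x)\<^sup>2) \<partial>lborel))"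
    by (subst nn_integral_suminf) (auto simp: ennreal_mult nn_integral_cmult)
  also have "\<dots> \<le> (\<Sum>k. ennreal ((1/2) ^ k))"
  proof (intro suminf_le)
    fix k
    have "ennreal (2 ^ k) * (\<integral>\<^sup>+x. ennreal ((d k x)\<^sup>2) \<partial>lborel)
        \<le> ennreal (2 ^ k) * ennreal (((1/2) ^ k)\<^sup>2)"
      unfolding d_def by (intro mult_left_mono close) auto
    also have "\<dots> = ennreal ((1/2) ^ k)"
      by (simp add: ennreal_mult[symmetric] power2_eq_square power_one_over)
    finally show "ennreal (2 ^ k) * (\<integral>\<^sup>+x. ennreal ((d k x)\<^sup>2) \<partial>lborel) \<le> ennreal ((1/2) ^ k)" .
  qed auto
  also have "\<dots> < \<infinity>"
    by (subst suminf_ennreal2) (auto intro: summable_geometric)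
  finally have "AE x in lborel. (\<Sum>k. ennreal (2 ^ k * (d k x)\<^sup>2)) \<noteq> \<infinity>"
    by (intro nn_integral_PInf_AE) auto
  then have conv: "AE x in lborel. convergent (\<lambda>k. h k x)"
  proof (rule eventually_mono)
    fix x assume "(\<Sum>k. ennreal (2 ^ k * (d k x)\<^sup>2)) \<noteq> \<infinity>"
    then have "summable (\<lambda>k. 2 ^ k * (d k x)\<^sup>2)"
      by (intro summable_suminf_not_top) auto
    then have "summable (\<lambda>k. 2 ^ k * (d k x)\<^sup>2 + (1/2) ^ k)"
      by (intro summable_add summable_geometric) auto
    moreover have "norm (h (Suc k) x - h k x) \<le> 2 ^ k * (d k x)\<^sup>2 + (1/2) ^ k" for k
    \<comment> \<open>Either \<open>d k x\<close> is below the geometric term, or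
      \<open>2 ^ k * d k x > 1\<close> and it is below the quadratic term.\<close>
    proof (cases "d k x \<le> (1/2) ^ k")
      case True
      then show ?thesis by (simp add: d_def add_increasing)
    next
      case False
      then have "1 * d k x \<le> (2 ^ k * d k x) * d k x"
        by (intro mult_right_mono) (auto simp: field_simps d_def)
      then show ?thesis using zero_le_power[of "1/2::real" k] unfolding d_def power2_eq_square mult.assoc by linarith
    qed
    ultimately have "summable (\<lambda>k. h (Suc k) x - h k x)"
      by (rule summable_comparison_test'[of _ 0])
    from summable_LIMSEQ[OF this] have "convergent (\<lambda>k. h k x - h 0 x)"
      unfolding sum_lessThan_telescope[of "\<lambda>k. h k x"] by (auto simp: convergent_def)
    from convergent_add[OF this convergent_const[of "h 0 x"]]
    show "convergent (\<lambda>k. h k x)" by simp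
  qed
  define g where "g x = lim (\<lambda>k. h k x)" for x
  have g_meas [measurable]: "g \<in> borel_measurable borel" unfolding g_def by measurable
  \<comment> \<open>Fatou's lemma lets \<open>j\<close> tend to infinity in
    \<open>close\<close>.\<close>
  have bound: "(\<integral>\<^sup>+x. ennreal ((cmod (g x - h k x))\<^sup>2) \<partial>lborel) \<le> ennreal (((1/2) ^ k)\<^sup>2)" for k
  proof -
    have "(\<integral>\<^sup>+x. ennreal ((cmod (g x - h k x))\<^sup>2) \<partial>lborel)
        = (\<integral>\<^sup>+x. liminf (\<lambda>j. ennreal ((cmod (h j x - h k x))\<^sup>2)) \<partial>lborel)"
      using conv
    proof (intro nn_integral_cong_AE, elim eventually_mono)
      fix x assume "convergent (\<lambda>k. h k x)"
      then have "(\<lambda>j. ennreal ((cmod (h j x - h k x))\<^sup>2)) \<longlonglongrightarrow> ennreal ((cmod (g x - h k x))\<^sup>2)"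
        unfolding g_def convergent_LIMSEQ_iff by (intro tendsto_intros tendsto_ennrealI)
      then show "ennreal ((cmod (g x - h k x))\<^sup>2) = liminf (\<lambda>j. ennreal ((cmod (h j x - h k x))\<^sup>2))"
        by (rule lim_imp_Liminf[OF sequentially_bot, symmetric])
    qed
    also have "\<dots> \<le> liminf (\<lambda>j. \<integral>\<^sup>+x. ennreal ((cmod (h j x - h k x))\<^sup>2) \<partial>lborel)"
      by (intro nn_integral_liminf) measurable
    also have "\<dots> \<le> ennreal (((1/2) ^ k)\<^sup>2)"
      by (intro Liminf_le eventually_sequentiallyI[of k] close) auto
    finally show ?thesis .
  qed
  have sqd: "square_integrable (\<lambda>x. g x - h k x)" for k
    unfolding square_integrable_def
    using bound[of k] by (auto intro!: integrableI_bounded simp: top.extremum_strict le_less_trans)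
  have sqg: "square_integrable g"
    using square_integrable_add[OF sqd[of 0] sq[of 0]] by simp
  have near: "norm (abs_L2 g - X (n k)) \<le> (1/2) ^ k" for k
  proof -
    have "ennreal ((norm (abs_L2 g - X (n k)))\<^sup>2) \<le> ennreal (((1/2) ^ k)\<^sup>2)"
      using bound[of k] by (simp add: Xh minus_abs_L2 sqg norm_abs_L2_nn sqd)
    then have "(norm (abs_L2 g - X (n k)))\<^sup>2 \<le> ((1/2) ^ k)\<^sup>2"
      by (subst (asm) ennreal_le_iff) auto
    then show ?thesis by (rule power2_le_imp_le) simp
  qed
  have "X \<longlonglongrightarrow> abs_L2 g"
  proof (rule metric_LIMSEQ_I)
    fix e :: real assume "e > 0"
    then obtain k where k: "(1/2) ^ k < e / 2"
      using real_arch_pow_inv[of "e/2" "1/2"] by auto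
    show "\<exists>M. \<forall>m\<ge>M. dist (X m) (abs_L2 g) < e"
    proof (intro exI allI impI)
      fix m assume "m \<ge> N k"
      then have "norm (X m - X (n k)) < (1/2) ^ k" by (intro N nN) auto
      then show "dist (X m) (abs_L2 g) < e"
        using k near[of k] norm_triangle_ineq[of "X m - X (n k)" "X (n k) - abs_L2 g"]
        by (simp add: dist_norm norm_minus_commute)
    qed
  qed
  then show "convergent X" by (auto simp: convergent_def)
qed

section \<open>The functional calculus of a projection-valued measure\<close>

lemma bounded_clinearD:
  assumes "bounded_clinear T"
  shows "bounded_linear T" "T (scaleC c u) = scaleC c (T u)" "T (u + v) = T u + T v"
    "T (u - v) = T u - T v" "T 0 = 0"
  using assms unfolding bounded_clinear_def by (auto simp: linear_simps)

lemma bounded_linear_scaleC: "bounded_linear (scaleC c)"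
  by (rule bounded_linear_intro[where K="cmod c"])
    (auto simp: scaleC_add_right scaleR_L2_eq_scaleC scaleC_scaleC norm_scaleC mult.commute)

lemma bounded_clinear_add:
  "bounded_clinear S \<Longrightarrow> bounded_clinear T \<Longrightarrow> bounded_clinear (\<lambda>u. S u + T u)"
  by (auto simp: bounded_clinear_def bounded_linear_add scaleC_add_right)

lemma bounded_clinear_scaleC: "bounded_clinear T \<Longrightarrow> bounded_clinear (\<lambda>u. scaleC c (T u))"
  using bounded_linear_compose[OF bounded_linear_scaleC]
  by (auto simp: bounded_clinear_def scaleC_scaleC mult.commute)

lemma bounded_clinear_sum:
  "(\<And>i. i \<in> I \<Longrightarrow> bounded_clinear (T i)) \<Longrightarrow> bounded_clinear (\<lambda>u. \<Sum>i\<in>I. T i u)"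
  by (induction I rule: infinite_finite_induct)
    (auto simp: bounded_clinear_add, auto simp: bounded_clinear_def scaleC_zero_right)

section \<open>Bounded Borel functions and induction over them\<close>

definition bounded_borel :: "(real \<Rightarrow> complex) \<Rightarrow> bool" where
  "bounded_borel g \<longleftrightarrow> g \<in> borel_measurable borel \<and> (\<exists>M. \<forall>s. cmod (g s) \<le> M)"

lemma bounded_borelI: "g \<in> borel_measurable borel \<Longrightarrow> (\<And>s. cmod (g s) \<le> M) \<Longrightarrow> bounded_borel g"
  by (auto simp: bounded_borel_def)

lemma bounded_borel_measurable [measurable_dest]: "bounded_borel g \<Longrightarrow> g \<in> borel_measurable borel"
  by (simp add: bounded_borel_def)

lemma bounded_borel_bound:
  assumes "bounded_borel g" obtains M where "M > 0" "\<And>s. cmod (g s) \<le> M"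
proof -
  obtain M where M: "\<And>s. cmod (g s) \<le> M" using assms by (auto simp: bounded_borel_def)
  show thesis by (rule that[of "max M 1"]) (use M in \<open>auto simp: le_max_iff_disj\<close>)
qed

lemma bounded_borel_const [simp]: "bounded_borel (\<lambda>_. c)"
  by (rule bounded_borelI) auto

lemma bounded_borel_indicator [simp]: "B \<in> sets borel \<Longrightarrow> bounded_borel (indicator B)"
  by (rule bounded_borelI[where M=1]) (auto simp: indicator_def)

lemma bounded_borel_add [simp]:
  assumes g: "bounded_borel g" and h: "bounded_borel h" shows "bounded_borel (\<lambda>s. g s + h s)"
proof -
  obtain M N where "\<And>s. cmod (g s) \<le> M" "\<And>s. cmod (h s) \<le> N"
    using assms bounded_borel_bound by metis
  then show ?thesis
    using g h by (intro bounded_borelI[where M="M + N"]) (auto intro: norm_triangle_le add_mono)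
qed

lemma bounded_borel_mult [simp]:
  assumes g: "bounded_borel g" and h: "bounded_borel h" shows "bounded_borel (\<lambda>s. g s * h s)"
proof -
  obtain M N where "M > 0" "\<And>s. cmod (g s) \<le> M" "\<And>s. cmod (h s) \<le> N"
    using assms bounded_borel_bound by metis
  then have "cmod (g s * h s) \<le> M * N" for s
    unfolding norm_mult by (intro mult_mono) (auto intro: less_imp_le)
  then show ?thesis
    using g h by (intro bounded_borelI[where M="M * N"]) auto
qed

lemma bounded_borel_diff [simp]:
  assumes g: "bounded_borel g" and h: "bounded_borel h" shows "bounded_borel (\<lambda>s. g s - h s)"
  using bounded_borel_add[OF g bounded_borel_mult[OF bounded_borel_const[of "-1"] h]] by simp

lemma simple_borel:
  assumes "simple_function borel (F :: real \<Rightarrow> complex)"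
  shows "finite (range F)" "F -` {y} \<in> sets borel" "bounded_borel F"
proof -
  show fin: "finite (range F)" and "F -` {y} \<in> sets borel"
    using simple_functionD[OF assms] by auto
  show "bounded_borel F"
    using fin by (intro bounded_borelI[where M="Max (cmod ` range F)"])
      (auto intro: borel_measurable_simple_function assms)
qed

text \<open>\<open>G\<close> takes values in any real vector space so that one decomposition serves
  both \<open>F\<close> and its squared modulus.\<close>

lemma simple_function_decomposition:
  assumes F: "simple_function borel (F :: real \<Rightarrow> complex)"
  shows "(G (F s) :: 'b :: real_vector) = (\<Sum>y\<in>range F. indicat_real (F -` {y}) s *\<^sub>R G y)"
proof -
  have "(\<Sum>y\<in>range F. indicat_real (F -` {y}) s *\<^sub>R G y) = (\<Sum>y\<in>{F s}. indicat_real (F -` {y}) s *\<^sub>R G y)"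
    by (intro sum.mono_neutral_right simple_borel(1) F) (auto simp: indicator_def)
  then show ?thesis by simp
qed

text \<open>The limit case keeps a common bound on the approximants: the spectral distributions are
  finite measures, so a constant is then an integrable majorant.\<close>

lemma bounded_borel_induct [consumes 1, case_names indicator add mult limit]:
  assumes g: "bounded_borel g"
    and ind: "\<And>B. B \<in> sets borel \<Longrightarrow> P (indicator B)"
    and add: "\<And>g h. bounded_borel g \<Longrightarrow> bounded_borel h \<Longrightarrow> P g \<Longrightarrow> P h \<Longrightarrow> P (\<lambda>s. g s + h s)"
    and mult: "\<And>c g. bounded_borel g \<Longrightarrow> P g \<Longrightarrow> P (\<lambda>s. c * g s)"
    and lim: "\<And>F g M. (\<And>n. bounded_borel (F n)) \<Longrightarrow> (\<And>n s. cmod (F n s) \<le> M) \<Longrightarrow>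
      (\<And>s. (\<lambda>n. F n s) \<longlonglongrightarrow> g s) \<Longrightarrow> bounded_borel g \<Longrightarrow> (\<And>n. P (F n)) \<Longrightarrow> P g"
  shows "P g"
proof -
  have simple: "P F" if F: "simple_function borel F" for F
  proof -
    have "bounded_borel (\<lambda>s. \<Sum>y\<in>A. y * indicator (F -` {y}) s) \<and> P (\<lambda>s. \<Sum>y\<in>A. y * indicator (F -` {y}) s)"
      if "finite A" for A
      using that
    proof induction
      case empty
      have "indicator {} = (\<lambda>s::real. 0 :: complex)" by auto
      then show ?case using ind[of "{}"] by simp
    next
      case (insert y A)
      have b: "bounded_borel (indicator (F -` {y}))"
        by (rule bounded_borel_indicator[OF simple_borel(2)[OF F]])
      have b': "bounded_borel (\<lambda>s. y * indicator (F -` {y}) s)"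
        by (rule bounded_borel_mult[OF bounded_borel_const b])
      have "P (\<lambda>s. y * indicator (F -` {y}) s)"
        by (rule mult[OF b ind[OF simple_borel(2)[OF F]]])
      then show ?case
        unfolding sum.insert[OF insert(1,2)] using insert(3) b' add bounded_borel_add by blast
    qed
    then have "P (\<lambda>s. \<Sum>y\<in>range F. y * indicator (F -` {y}) s)"
      using simple_borel(1)[OF F] by blast
    also have "(\<lambda>s. \<Sum>y\<in>range F. y * indicator (F -` {y}) s) = F"
    proof
      fix s
      have "F s = (\<Sum>y\<in>range F. indicat_real (F -` {y}) s *\<^sub>R y)"
        by (rule simple_function_decomposition[OF F, of "\<lambda>y. y" s])
      also have "\<dots> = (\<Sum>y\<in>range F. y * indicator (F -` {y}) s)"
        by (intro sum.cong) (auto simp: indicator_def)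
      finally show "(\<Sum>y\<in>range F. y * indicator (F -` {y}) s) = F s" by (rule sym)
    qed
    finally show ?thesis .
  qed
  obtain M where M: "\<And>s. cmod (g s) \<le> M" using g bounded_borel_bound by metis
  \<comment> \<open>The approximants satisfy \<open>cmod (F n s) \<le> 2 * cmod (g s)\<close>, which
    is the origin of the bound \<open>2 * M\<close>.\<close>
  obtain F where F: "\<And>n. simple_function borel (F n)" "\<And>s. (\<lambda>n. F n s) \<longlonglongrightarrow> g s"
    "\<And>n s. dist (F n s) 0 \<le> 2 * dist (g s) 0"
    using borel_measurable_implies_sequence_metric[of g borel 0] bounded_borel_measurable[OF g] by auto
  show ?thesis
  proof (rule lim[of F "2 * M" g])
    show "cmod (F n s) \<le> 2 * M" for n s using F(3)[of n s] M[of s] by (simp add: dist_norm)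
  qed (use F simple g in \<open>auto simp: simple_borel\<close>)
qed

section \<open>Projection-valued measures and their scalar spectral distributions\<close>

locale pvm =
  fixes E :: "real set \<Rightarrow> L2 \<Rightarrow> L2"
  assumes pvm: "projection_valued_measure E"
begin

lemma bounded_clinear_E: "B \<in> sets borel \<Longrightarrow> bounded_clinear (E B)"
  using pvm by (simp add: projection_valued_measure_def)

lemma E_idem: "B \<in> sets borel \<Longrightarrow> E B (E B u) = E B u"
  using pvm by (metis comp_apply projection_valued_measure_def)

lemma E_selfadjoint: "B \<in> sets borel \<Longrightarrow> cinner (E B u) v = cinner u (E B v)"
  using pvm by (simp add: projection_valued_measure_def)

lemma E_UNIV: "E UNIV u = u"
  using pvm by (simp add: projection_valued_measure_def)

lemma E_sums:
  "range B \<subseteq> sets borel \<Longrightarrow> disjoint_family B \<Longrightarrow> (\<lambda>n. E (B n) u) sums E (\<Union>n. B n) u"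
  for B :: "nat \<Rightarrow> real set"
  using pvm by (simp add: projection_valued_measure_def)

lemma cinner_E: "B \<in> sets borel \<Longrightarrow> cinner u (E B u) = of_real ((norm (E B u))\<^sup>2)"
  by (metis E_idem E_selfadjoint cinner_self)

text \<open>A constant sequence is summable only if its value is zero.\<close>

lemma E_empty: "E {} u = 0"
proof -
  have "summable (\<lambda>n::nat. E {} u)"
    using E_sums[of "\<lambda>_. {}" u] by (auto simp: disjoint_family_on_def sums_iff)
  then show ?thesis using summable_LIMSEQ_zero LIMSEQ_const_iff by metis
qed

abbreviation "\<mu> u \<equiv> spectral_distribution E u"

lemma sets_\<mu> [simp, measurable_cong]: "sets (\<mu> u) = sets borel"
  and space_\<mu> [simp]: "space (\<mu> u) = UNIV"
  by (simp_all add: spectral_distribution_def sets.sigma_sets_eq[of borel, simplified])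

text \<open>Pairing with \<open>u\<close> turns strong countable additivity into additivity of
  numbers, because \<open>cinner u (E B u)\<close> is the squared norm of
  \<open>E B u\<close>.\<close>

lemma emeasure_\<mu>:
  assumes "B \<in> sets borel" shows "emeasure (\<mu> u) B = ennreal ((norm (E B u))\<^sup>2)"
proof (rule emeasure_measure_of[OF spectral_distribution_def])
  show "positive (sets (\<mu> u)) (\<lambda>B. ennreal ((norm (E B u))\<^sup>2))"
    by (simp add: positive_def E_empty)
  show "countably_additive (sets (\<mu> u)) (\<lambda>B. ennreal ((norm (E B u))\<^sup>2))"
  proof (rule countably_additiveI)
    fix A :: "nat \<Rightarrow> real set"
    assume A: "range A \<subseteq> sets (\<mu> u)" "disjoint_family A" "\<Union> (range A) \<in> sets (\<mu> u)"
    have "(\<lambda>n. Re (cinner u (E (A n) u))) sums Re (cinner u (E (\<Union>n. A n) u))"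
      using A by (intro bounded_linear.sums[OF bounded_linear_Re]
          bounded_linear.sums[OF bounded_linear_cinner_right] E_sums) auto
    moreover have "Re (cinner u (E (A n) u)) = (norm (E (A n) u))\<^sup>2" for n
      using A by (subst cinner_E) auto
    moreover have "Re (cinner u (E (\<Union>n. A n) u)) = (norm (E (\<Union>n. A n) u))\<^sup>2"
      using A by (subst cinner_E) auto
    ultimately show "(\<Sum>i. ennreal ((norm (E (A i) u))\<^sup>2)) = ennreal ((norm (E (\<Union> (range A)) u))\<^sup>2)"
      by (intro suminf_ennreal_eq) auto
  qed
qed (use assms in auto)

sublocale \<mu>: finite_measure "\<mu> u" for u
  by (rule finite_measureI) (simp add: emeasure_\<mu>)

lemma measure_\<mu>: "B \<in> sets borel \<Longrightarrow> measure (\<mu> u) B = (norm (E B u))\<^sup>2"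
  by (simp add: measure_def emeasure_\<mu>)

text \<open>Additivity of the scalar measures passes to the operators by polarization.\<close>

lemma E_Un:
  assumes [measurable]: "A \<in> sets borel" "B \<in> sets borel" and "A \<inter> B = {}"
  shows "E (A \<union> B) u = E A u + E B u"
proof -
  have "E (A \<union> B) = (\<lambda>u. E A u + E B u)"
  proof (rule ext_quadratic_form)
    fix u
    have "measure (\<mu> u) (A \<union> B) = measure (\<mu> u) A + measure (\<mu> u) B"
      using assms by (intro \<mu>.finite_measure_Union) auto
    then show "cinner u (E (A \<union> B) u) = cinner u (E A u + E B u)"
      by (simp add: measure_\<mu> cinner_add_right cinner_E flip: of_real_add of_real_power)
  qed (auto intro!: bounded_clinear_E bounded_clinear_add)
  then show ?thesis by simp
qed

text \<open>The vector \<open>E B u\<close> carries its entire mass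
  \<open>(norm (E B u))\<^sup>2\<close> on \<open>B\<close>, which leaves none for a set disjoint
  from \<open>B\<close>.\<close>

lemma E_disjoint:
  assumes [measurable]: "A \<in> sets borel" "B \<in> sets borel" and "A \<inter> B = {}"
  shows "E A (E B u) = 0"
proof -
  let ?w = "E B u"
  have "measure (\<mu> ?w) A + measure (\<mu> ?w) B = measure (\<mu> ?w) (A \<union> B)"
    using assms by (intro \<mu>.finite_measure_Union[symmetric]) auto
  also have "\<dots> \<le> measure (\<mu> ?w) UNIV"
    by (intro \<mu>.finite_measure_mono) auto
  finally have "(norm (E A ?w))\<^sup>2 \<le> 0" by (simp add: measure_\<mu> E_UNIV E_idem)
  then show ?thesis by simp
qed

text \<open>The definition demands only that each projection be idempotent; the cross terms vanish
  by disjointness.\<close>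

lemma E_Int:
  assumes [measurable]: "A \<in> sets borel" "B \<in> sets borel"
  shows "E A (E B u) = E (A \<inter> B) u"
proof -
  have "E B u = E (A \<inter> B) u + E (B - A) u"
    by (subst E_Un[symmetric]) (auto intro!: arg_cong[where f="\<lambda>B. E B u"])
  then have "E A (E B u) = E A (E (A \<inter> B) u) + E A (E (B - A) u)"
    by (simp add: bounded_clinearD[OF bounded_clinear_E])
  also have "E A (E (B - A) u) = 0" by (rule E_disjoint) auto
  also have "E A (E (A \<inter> B) u) = E (A \<inter> B) (E (A \<inter> B) u) + E (A - B) (E (A \<inter> B) u)"
    by (subst E_Un[symmetric]) (auto intro!: arg_cong[where f="\<lambda>B. E B _"])
  also have "E (A - B) (E (A \<inter> B) u) = 0" by (rule E_disjoint) auto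
  finally show ?thesis by (simp add: E_idem)
qed

section \<open>Spectral integrals of bounded Borel functions\<close>

definition represents :: "(real \<Rightarrow> complex) \<Rightarrow> (L2 \<Rightarrow> L2) \<Rightarrow> bool" where
  "represents g T \<longleftrightarrow> bounded_clinear T \<and> (\<forall>u. cinner u (T u) = (LINT s|\<mu> u. g s))"

lemma represents_unique: "represents g S \<Longrightarrow> represents g T \<Longrightarrow> S = T"
  by (rule ext_quadratic_form) (auto simp: represents_def)

text \<open>Any operator with the right quadratic form may thus replace the definite
  description.\<close>

lemma spectral_integral_eq: "represents g T \<Longrightarrow> spectral_integral E g = T"
  unfolding spectral_integral_def
  by (rule the_equality) (use represents_unique in \<open>auto simp: represents_def\<close>)

lemma integrable_\<mu>: "bounded_borel g \<Longrightarrow> integrable (\<mu> u) g"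
proof -
  assume g: "bounded_borel g"
  then obtain M where "\<And>s. cmod (g s) \<le> M" using bounded_borel_bound by metis
  with g show ?thesis
    by (intro \<mu>.integrable_const_bound[where B=M]) auto
qed

lemma integrable_\<mu>_norm_sq: "bounded_borel g \<Longrightarrow> integrable (\<mu> u) (\<lambda>s. (cmod (g s))\<^sup>2)"
proof -
  assume g: "bounded_borel g"
  then obtain M where "\<And>s. cmod (g s) \<le> M" using bounded_borel_bound by metis
  with g show ?thesis
    by (intro \<mu>.integrable_const_bound[where B="M\<^sup>2"]) (auto intro!: power_mono)
qed

lemma represents_add:
  "represents g S \<Longrightarrow> represents h T \<Longrightarrow> bounded_borel g \<Longrightarrow> bounded_borel h \<Longrightarrow>
    represents (\<lambda>s. g s + h s) (\<lambda>u. S u + T u)"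
  by (auto simp: represents_def bounded_clinear_add cinner_add_right integrable_\<mu>)

lemma represents_mult:
  "represents g T \<Longrightarrow> represents (\<lambda>s. c * g s) (\<lambda>u. scaleC c (T u))"
  by (auto simp: represents_def bounded_clinear_scaleC cinner_scaleC_right)

lemma represents_diff:
  assumes "represents g S" "represents h T" "bounded_borel g" "bounded_borel h"
  shows "represents (\<lambda>s. g s - h s) (\<lambda>u. S u - T u)"
  using represents_add[OF assms(1) represents_mult[OF assms(2), of "-1"] assms(3)
      bounded_borel_mult[OF bounded_borel_const assms(4)]]
  by (simp add: scaleC_minus_left scaleC_one)

lemma integral_\<mu>_simple:
  fixes G :: "complex \<Rightarrow> 'b :: {banach, second_countable_topology}"
  assumes F: "simple_function borel F"
  shows "(LINT s|\<mu> u. G (F s)) = (\<Sum>y\<in>range F. (norm (E (F -` {y}) u))\<^sup>2 *\<^sub>R G y)"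
proof -
  have [measurable]: "F -` {y} \<in> sets borel" for y by (rule simple_borel[OF F])
  have "(LINT s|\<mu> u. G (F s)) = (LINT s|\<mu> u. (\<Sum>y\<in>range F. indicat_real (F -` {y}) s *\<^sub>R G y))"
    by (subst simple_function_decomposition[OF F]) simp
  also have "\<dots> = (\<Sum>y\<in>range F. (norm (E (F -` {y}) u))\<^sup>2 *\<^sub>R G y)"
    by (subst Bochner_Integration.integral_sum) (auto simp: measure_\<mu> \<mu>.emeasure_eq_measure)
  finally show ?thesis .
qed

text \<open>Spectral projections onto distinct values have orthogonal ranges, so the double sum for
  the norm collapses to its diagonal. The norm identity is recorded because it makes the limit in
  \<open>represents_exists\<close> converge.\<close>

lemma represents_simple:
  assumes F: "simple_function borel F"
  obtains T where "represents F T" "\<And>u. (norm (T u))\<^sup>2 = (LINT s|\<mu> u. (cmod (F s))\<^sup>2)"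
proof
  let ?T = "\<lambda>u. \<Sum>y\<in>range F. scaleC y (E (F -` {y}) u)"
  have [measurable]: "F -` {y} \<in> sets borel" for y by (rule simple_borel[OF F])
  show "represents F ?T"
    unfolding represents_def
  proof safe
    show "bounded_clinear ?T"
      by (intro bounded_clinear_sum bounded_clinear_scaleC bounded_clinear_E) simp
    show "cinner u (?T u) = (LINT s|\<mu> u. F s)" for u
      using integral_\<mu>_simple[OF F, of u "\<lambda>y. y"]
      by (simp add: cinner_sum_right cinner_scaleC_right cinner_E scaleR_conv_of_real mult.commute)
  qed
  fix u
  have "complex_of_real ((norm (?T u))\<^sup>2) =
      (\<Sum>y\<in>range F. \<Sum>z\<in>range F. cnj y * z * cinner (E (F -` {y}) u) (E (F -` {z}) u))"
    unfolding cinner_self[symmetric]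
    by (simp only: cinner_sum_left cinner_scaleC_left)
      (simp only: cinner_sum_right cinner_scaleC_right sum_distrib_left mult.assoc)
  also have "\<dots> = (\<Sum>y\<in>range F. \<Sum>z\<in>range F.
      if z = y then complex_of_real ((cmod y)\<^sup>2 * (norm (E (F -` {y}) u))\<^sup>2) else 0)"
  proof (intro sum.cong refl)
    fix y z
    show "cnj y * z * cinner (E (F -` {y}) u) (E (F -` {z}) u) =
      (if z = y then complex_of_real ((cmod y)\<^sup>2 * (norm (E (F -` {y}) u))\<^sup>2) else 0)"
    proof (cases "z = y")
      case True
      then show ?thesis by (simp add: cinner_self complex_norm_square[symmetric] mult.commute)
    next
      case False
      then have "E (F -` {y}) (E (F -` {z}) u) = 0" by (intro E_disjoint) auto
      then show ?thesis using False by (simp add: E_selfadjoint cinner_zero_right)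
    qed
  qed
  also have "\<dots> = complex_of_real (\<Sum>y\<in>range F. (norm (E (F -` {y}) u))\<^sup>2 *\<^sub>R (cmod y)\<^sup>2)"
    using simple_borel(1)[OF F] by (simp add: sum.delta mult.commute)
  also have "\<dots> = complex_of_real (LINT s|\<mu> u. (cmod (F s))\<^sup>2)"
    by (simp only: integral_\<mu>_simple[OF F, of u "\<lambda>y. (cmod y)\<^sup>2"])
  finally show "(norm (?T u))\<^sup>2 = (LINT s|\<mu> u. (cmod (F s))\<^sup>2)"
    using of_real_eq_iff by blast
qed

lemma integral_norm_sq_le:
  assumes g: "bounded_borel g" and M: "\<And>s. cmod (g s) \<le> M"
  shows "(LINT s|\<mu> u. (cmod (g s))\<^sup>2) \<le> (M * norm u)\<^sup>2"
proof -
  have "(LINT s|\<mu> u. (cmod (g s))\<^sup>2) \<le> (LINT s|\<mu> u. M\<^sup>2)"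
    using integrable_\<mu>_norm_sq[OF g] M by (intro integral_mono) (auto intro!: power_mono)
  also have "\<dots> = (M * norm u)\<^sup>2"
    by (simp add: measure_\<mu> E_UNIV power_mult_distrib)
  finally show ?thesis .
qed

lemma integral_norm_sq_tendsto_0:
  assumes F: "\<And>n. bounded_borel (F n)" and M: "\<And>n s. cmod (F n s) \<le> M"
    and lim: "\<And>s. (\<lambda>n. F n s) \<longlonglongrightarrow> g s" and g: "bounded_borel g"
  shows "(\<lambda>n. LINT s|\<mu> u. (cmod (F n s - g s))\<^sup>2) \<longlonglongrightarrow> 0"
proof -
  obtain N where N: "\<And>s. cmod (g s) \<le> N" using g bounded_borel_bound by metis
  have "(\<lambda>n. LINT s|\<mu> u. (cmod (F n s - g s))\<^sup>2) \<longlonglongrightarrow> (LINT s|\<mu> u. 0)"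
  proof (rule integral_dominated_convergence[where w="\<lambda>_. (M + N)\<^sup>2"])
    show "AE s in \<mu> u. (\<lambda>n. (cmod (F n s - g s))\<^sup>2) \<longlonglongrightarrow> 0"
    proof (rule AE_I2)
      fix s
      have "(\<lambda>n. (cmod (F n s - g s))\<^sup>2) \<longlonglongrightarrow> (cmod (g s - g s))\<^sup>2"
        by (intro tendsto_intros lim)
      then show "(\<lambda>n. (cmod (F n s - g s))\<^sup>2) \<longlonglongrightarrow> 0" by simp
    qed
    have "cmod (F n s - g s) \<le> M + N" for n s
      by (rule order_trans[OF norm_triangle_ineq4 add_mono[OF M N]])
    then show "AE s in \<mu> u. norm ((cmod (F n s - g s))\<^sup>2) \<le> (M + N)\<^sup>2" for n
      by (auto intro!: power_mono)
    show "(\<lambda>s. (cmod (F n s - g s))\<^sup>2) \<in> borel_measurable (\<mu> u)" for n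
      using integrable_\<mu>_norm_sq[OF bounded_borel_diff[OF F g]] by (rule borel_measurable_integrable)
  qed auto
  then show ?thesis by simp
qed

text \<open>The isometry for simple functions turns mean-square convergence with respect to each
  spectral distribution into strong convergence of the operators.\<close>

lemma represents_exists:
  assumes g: "bounded_borel g"
  obtains T where "represents g T" "\<And>u. (norm (T u))\<^sup>2 = (LINT s|\<mu> u. (cmod (g s))\<^sup>2)"
proof -
  obtain M where M0: "M > 0" and M: "\<And>s. cmod (g s) \<le> M" using g bounded_borel_bound by metis
  obtain F where F: "\<And>n. simple_function borel (F n)" "\<And>s. (\<lambda>n. F n s) \<longlonglongrightarrow> g s"
    "\<And>n s. dist (F n s) 0 \<le> 2 * dist (g s) 0"
    using borel_measurable_implies_sequence_metric[of g borel 0] bounded_borel_measurable[OF g] by auto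
  have F_bound: "cmod (F n s) \<le> 2 * M" for n s
    using F(3)[of n s] M[of s] by (simp add: dist_norm)
  have bF: "bounded_borel (F n)" for n by (rule simple_borel[OF F(1)])
  have "\<exists>T. represents (F n) T \<and> (\<forall>u. (norm (T u))\<^sup>2 = (LINT s|\<mu> u. (cmod (F n s))\<^sup>2))" for n
    using represents_simple[OF F(1)] by metis
  then obtain T where T: "\<And>n. represents (F n) (T n)"
    and T_norm: "\<And>n u. (norm (T n u))\<^sup>2 = (LINT s|\<mu> u. (cmod (F n s))\<^sup>2)" by metis
  \<comment> \<open>The difference of two simple functions is simple, and uniqueness identifies its
    operator with the difference of \<open>T m\<close> and \<open>T n\<close>.\<close>
  have T_diff: "(norm (T m u - T n u))\<^sup>2 = (LINT s|\<mu> u. (cmod (F m s - F n s))\<^sup>2)" for m n u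
  proof -
    obtain S where "represents (\<lambda>s. F m s - F n s) S"
      "\<And>u. (norm (S u))\<^sup>2 = (LINT s|\<mu> u. (cmod (F m s - F n s))\<^sup>2)"
      using represents_simple[OF simple_function_diff[OF F(1)[of m] F(1)[of n]]] by metis
    moreover from this have "S = (\<lambda>u. T m u - T n u)"
      using represents_unique represents_diff[OF T T bF bF] by blast
    ultimately show ?thesis by simp
  qed
  define a where "a u n = (LINT s|\<mu> u. (cmod (F n s - g s))\<^sup>2)" for u n
  have a: "a u \<longlonglongrightarrow> 0" for u
    unfolding a_def by (rule integral_norm_sq_tendsto_0[OF bF F_bound F(2) g])
  have T_le: "(norm (T m u - T n u))\<^sup>2 \<le> 2 * a u m + 2 * a u n" for m n u
  proof -
    have "(norm (T m u - T n u))\<^sup>2 \<le> (LINT s|\<mu> u. 2 * (cmod (F m s - g s))\<^sup>2 + 2 * (cmod (F n s - g s))\<^sup>2)"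
      unfolding T_diff
    proof (rule integral_mono)
      fix s
      have "cmod (F m s - F n s) \<le> cmod (F m s - g s) + cmod (F n s - g s)"
        by (metis dist_norm dist_triangle2)
      then have "(cmod (F m s - F n s))\<^sup>2 \<le> (cmod (F m s - g s) + cmod (F n s - g s))\<^sup>2"
        by (intro power_mono) auto
      also have "\<dots> \<le> 2 * (cmod (F m s - g s))\<^sup>2 + 2 * (cmod (F n s - g s))\<^sup>2"
        using sum_squares_bound[of "cmod (F m s - g s)" "cmod (F n s - g s)"] by (simp add: power2_sum)
      finally show "(cmod (F m s - F n s))\<^sup>2 \<le> 2 * (cmod (F m s - g s))\<^sup>2 + 2 * (cmod (F n s - g s))\<^sup>2" .
    qed (intro Bochner_Integration.integrable_add integrable_mult_right integrable_\<mu>_norm_sq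
        bounded_borel_diff bF g)+
    also have "\<dots> = 2 * a u m + 2 * a u n"
      unfolding a_def using integrable_\<mu>_norm_sq[OF bounded_borel_diff[OF bF g]]
      by (subst Bochner_Integration.integral_add) auto
    finally show ?thesis .
  qed
  have "Cauchy (\<lambda>n. T n u)" for u
  proof (rule CauchyI)
    fix e :: real assume "e > 0"
    then have "\<forall>\<^sub>F n in sequentially. a u n < e\<^sup>2 / 4"
      by (intro order_tendstoD(2)[OF a]) auto
    then obtain N where N: "\<And>n. n \<ge> N \<Longrightarrow> a u n < e\<^sup>2 / 4"
      by (auto simp: eventually_sequentially)
    have "norm (T m u - T n u) < e" if "m \<ge> N" "n \<ge> N" for m n
    proof -
      have "(norm (T m u - T n u))\<^sup>2 < e\<^sup>2" using T_le[of m u n] N[of m] N[of n] that by linarith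
      then show ?thesis using \<open>e > 0\<close> by (simp add: power2_less_imp_less)
    qed
    then show "\<exists>N. \<forall>m\<ge>N. \<forall>n\<ge>N. norm (T m u - T n u) < e" by blast
  qed
  then have "\<exists>v. (\<lambda>n. T n u) \<longlonglongrightarrow> v" for u
    using Cauchy_convergent_iff convergent_def by metis
  then obtain S where S: "\<And>u. (\<lambda>n. T n u) \<longlonglongrightarrow> S u" by metis
  note TD = bounded_clinearD[OF T[unfolded represents_def, THEN conjunct1]]
  \<comment> \<open>The strong limit is a bounded operator because this bound is uniform in
    \<open>n\<close>.\<close>
  have S_norm: "norm (S u) \<le> norm u * (2 * M)" for u
  proof (rule LIMSEQ_le_const2[OF tendsto_norm[OF S]])
    have "norm (T n u) \<le> norm u * (2 * M)" for n
    proof (rule power2_le_imp_le)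
      show "(norm (T n u))\<^sup>2 \<le> (norm u * (2 * M))\<^sup>2"
        unfolding T_norm using integral_norm_sq_le[OF bF F_bound] by (simp add: mult.commute)
    qed (use M0 in auto)
    then show "\<exists>N. \<forall>n\<ge>N. norm (T n u) \<le> norm u * (2 * M)" by blast
  qed
  have S_add: "S (u + v) = S u + S v" for u v
    using LIMSEQ_unique[OF S[of "u + v"]] tendsto_add[OF S S] by (simp add: TD)
  have S_scale: "S (scaleC c u) = scaleC c (S u)" for c u
    using LIMSEQ_unique[OF S[of "scaleC c u"]] bounded_linear.tendsto[OF bounded_linear_scaleC S]
    by (simp add: TD)
  have bS: "bounded_clinear S"
    unfolding bounded_clinear_def
    using S_add S_scale S_norm
    by (auto intro!: bounded_linear_intro[where K="2 * M"] simp: scaleR_L2_eq_scaleC)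
  have int_lim: "(\<lambda>n. LINT s|\<mu> u. F n s) \<longlonglongrightarrow> (LINT s|\<mu> u. g s)" for u
  proof (rule integral_dominated_convergence[where w="\<lambda>_. 2 * M"])
    show "F n \<in> borel_measurable (\<mu> u)" "g \<in> borel_measurable (\<mu> u)" for n
      using integrable_\<mu> bF g by (auto intro: borel_measurable_integrable)
  qed (use F F_bound in auto)
  have int_lim2: "(\<lambda>n. LINT s|\<mu> u. (cmod (F n s))\<^sup>2) \<longlonglongrightarrow> (LINT s|\<mu> u. (cmod (g s))\<^sup>2)" for u
  proof (rule integral_dominated_convergence[where w="\<lambda>_. (2 * M)\<^sup>2"])
    show "(\<lambda>s. (cmod (F n s))\<^sup>2) \<in> borel_measurable (\<mu> u)"
      "(\<lambda>s. (cmod (g s))\<^sup>2) \<in> borel_measurable (\<mu> u)" for n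
      using integrable_\<mu>_norm_sq bF g by (auto intro: borel_measurable_integrable)
    show "AE s in \<mu> u. norm ((cmod (F n s))\<^sup>2) \<le> (2 * M)\<^sup>2" for n
      using power_mono[OF F_bound norm_ge_zero, of _ _ 2] by auto
    show "AE s in \<mu> u. (\<lambda>n. (cmod (F n s))\<^sup>2) \<longlonglongrightarrow> (cmod (g s))\<^sup>2"
      by (intro AE_I2 tendsto_intros F(2))
  qed auto
  show thesis
  proof
    show "represents g S"
      unfolding represents_def
    proof (intro conjI allI bS)
      fix u
      have "(\<lambda>n. cinner u (T n u)) \<longlonglongrightarrow> cinner u (S u)"
        by (rule bounded_linear.tendsto[OF bounded_linear_cinner_right S])
      moreover have "cinner u (T n u) = (LINT s|\<mu> u. F n s)" for n
        using T by (simp add: represents_def)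
      ultimately show "cinner u (S u) = (LINT s|\<mu> u. g s)"
        using int_lim by (simp add: LIMSEQ_unique)
    qed
    show "(norm (S u))\<^sup>2 = (LINT s|\<mu> u. (cmod (g s))\<^sup>2)" for u
    proof (rule LIMSEQ_unique)
      show "(\<lambda>n. (norm (T n u))\<^sup>2) \<longlonglongrightarrow> (norm (S u))\<^sup>2" by (intro tendsto_intros S)
      show "(\<lambda>n. (norm (T n u))\<^sup>2) \<longlonglongrightarrow> (LINT s|\<mu> u. (cmod (g s))\<^sup>2)"
        unfolding T_norm by (rule int_lim2)
    qed
  qed
qed

abbreviation "\<Phi> \<equiv> spectral_integral E"

lemma represents_\<Phi>: "bounded_borel g \<Longrightarrow> represents g (\<Phi> g)"
  by (metis represents_exists spectral_integral_eq)

lemma norm_\<Phi>_sq: "bounded_borel g \<Longrightarrow> (norm (\<Phi> g u))\<^sup>2 = (LINT s|\<mu> u. (cmod (g s))\<^sup>2)"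
  by (metis represents_exists spectral_integral_eq)

lemma bounded_clinear_\<Phi>: "bounded_borel g \<Longrightarrow> bounded_clinear (\<Phi> g)"
  using represents_\<Phi> by (simp add: represents_def)

lemma \<Phi>_add: "bounded_borel g \<Longrightarrow> bounded_borel h \<Longrightarrow> \<Phi> (\<lambda>s. g s + h s) u = \<Phi> g u + \<Phi> h u"
  by (simp add: spectral_integral_eq[OF represents_add[OF represents_\<Phi> represents_\<Phi>]])

lemma \<Phi>_diff: "bounded_borel g \<Longrightarrow> bounded_borel h \<Longrightarrow> \<Phi> (\<lambda>s. g s - h s) u = \<Phi> g u - \<Phi> h u"
  by (simp add: spectral_integral_eq[OF represents_diff[OF represents_\<Phi> represents_\<Phi>]])

lemma \<Phi>_cmult: "bounded_borel g \<Longrightarrow> \<Phi> (\<lambda>s. c * g s) u = scaleC c (\<Phi> g u)"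
  by (simp add: spectral_integral_eq[OF represents_mult[OF represents_\<Phi>]])

lemma \<Phi>_indicator: "B \<in> sets borel \<Longrightarrow> \<Phi> (indicator B) u = E B u"
proof -
  assume B [measurable]: "B \<in> sets borel"
  have "(LINT s|\<mu> u. (indicator B s :: complex)) = cinner u (E B u)" for u
  proof -
    have "(LINT s|\<mu> u. (indicator B s :: complex)) = (LINT s|\<mu> u. of_real (indicator B s))"
      by (intro Bochner_Integration.integral_cong) (auto simp: indicator_def)
    also have "\<dots> = of_real (LINT s|\<mu> u. indicator B s)" by (rule integral_complex_of_real)
    finally show ?thesis by (simp add: cinner_E measure_\<mu>)
  qed
  then have "represents (indicator B) (E B)"
    by (simp add: represents_def bounded_clinear_E B)
  then show ?thesis by (simp add: spectral_integral_eq)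
qed

lemma \<Phi>_const: "\<Phi> (\<lambda>_. c) u = scaleC c u"
  using \<Phi>_cmult[of "indicator UNIV" c u] \<Phi>_indicator[of UNIV u] by (simp add: E_UNIV)

lemma norm_\<Phi>_le:
  assumes g: "bounded_borel g" and M: "\<And>s. cmod (g s) \<le> M"
  shows "norm (\<Phi> g u) \<le> M * norm u"
proof (rule power2_le_imp_le)
  show "(norm (\<Phi> g u))\<^sup>2 \<le> (M * norm u)\<^sup>2"
    unfolding norm_\<Phi>_sq[OF g] by (rule integral_norm_sq_le[OF g M])
  show "0 \<le> M * norm u" using order_trans[OF norm_ge_zero M[of 0]] by simp
qed

text \<open>Pointwise convergence with a common bound gives strong convergence. Truncations, which
  do not converge uniformly, are handled this way.\<close>

lemma \<Phi>_tendsto: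
  assumes F: "\<And>n. bounded_borel (F n)" and M: "\<And>n s. cmod (F n s) \<le> M"
    and lim: "\<And>s. (\<lambda>n. F n s) \<longlonglongrightarrow> g s" and g: "bounded_borel g"
  shows "(\<lambda>n. \<Phi> (F n) u) \<longlonglongrightarrow> \<Phi> g u"
proof -
  have "(\<lambda>n. (norm (\<Phi> (F n) u - \<Phi> g u))\<^sup>2) \<longlonglongrightarrow> 0"
    using integral_norm_sq_tendsto_0[OF assms, of u]
    by (simp add: \<Phi>_diff[symmetric] norm_\<Phi>_sq F g)
  then have "(\<lambda>n. sqrt ((norm (\<Phi> (F n) u - \<Phi> g u))\<^sup>2)) \<longlonglongrightarrow> sqrt 0"
    by (rule tendsto_real_sqrt)
  then show ?thesis by (simp add: tendsto_norm_zero_iff LIM_zero_iff)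
qed

text \<open>Induction on \<open>h\<close> and, when \<open>h\<close> is an indicator, on
  \<open>g\<close> reduces multiplicativity to \<open>E_Int\<close>.\<close>

lemma \<Phi>_mult:
  assumes g: "bounded_borel g" and h: "bounded_borel h"
  shows "\<Phi> g (\<Phi> h u) = \<Phi> (\<lambda>s. g s * h s) u"
  using h
proof (induction arbitrary: u rule: bounded_borel_induct)
  case (indicator B)
  then have B: "B \<in> sets borel" .
  show ?case
    using g
  proof (induction rule: bounded_borel_induct)
    case (indicator A)
    then show ?case using B by (simp add: \<Phi>_indicator E_Int flip: indicator_inter_arith)
  next
    case (add g h)
    then show ?case using B by (simp add: \<Phi>_add distrib_right)
  next
    case (mult c g)
    then show ?case using B by (simp add: \<Phi>_cmult mult.assoc)
  next
    case (limit F g M)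
    have "(\<lambda>n. \<Phi> (F n) (\<Phi> (indicator B) u)) \<longlonglongrightarrow> \<Phi> g (\<Phi> (indicator B) u)"
      by (rule \<Phi>_tendsto) (use limit in auto)
    moreover have "(\<lambda>n. \<Phi> (\<lambda>s. F n s * indicator B s) u) \<longlonglongrightarrow> \<Phi> (\<lambda>s. g s * indicator B s) u"
    proof (rule \<Phi>_tendsto[where M=M])
      show "cmod (F n s * indicator B s) \<le> M" for n s
        using limit(2)[of n s] order_trans[OF norm_ge_zero limit(2)[of n s]]
        by (auto simp: indicator_def)
      show "(\<lambda>n. F n s * indicator B s) \<longlonglongrightarrow> g s * indicator B s" for s
        by (intro tendsto_intros limit)
    qed (use limit B in auto)
    ultimately show ?case using limit(5) LIMSEQ_unique by simp
  qed
next
  case (add h k)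
  then show ?case using g by (simp add: \<Phi>_add distrib_left bounded_clinearD[OF bounded_clinear_\<Phi>])
next
  case (mult c h)
  then show ?case using g \<Phi>_cmult[of "\<lambda>s. g s * h s" c u]
    by (simp add: \<Phi>_cmult bounded_clinearD[OF bounded_clinear_\<Phi>] mult.left_commute)
next
  case (limit F h M)
  obtain N where N: "N > 0" "\<And>s. cmod (g s) \<le> N" using g bounded_borel_bound by metis
  have "(\<lambda>n. \<Phi> g (\<Phi> (F n) u)) \<longlonglongrightarrow> \<Phi> g (\<Phi> h u)"
    by (intro bounded_linear.tendsto[OF bounded_clinearD(1)[OF bounded_clinear_\<Phi>[OF g]]] \<Phi>_tendsto)
      (use limit in auto)
  moreover have "(\<lambda>n. \<Phi> (\<lambda>s. g s * F n s) u) \<longlonglongrightarrow> \<Phi> (\<lambda>s. g s * h s) u"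
  proof (rule \<Phi>_tendsto[where M="N * M"])
    show "cmod (g s * F n s) \<le> N * M" for n s
      using limit(2)[of n s] N by (auto simp: norm_mult intro!: mult_mono)
    show "(\<lambda>n. g s * F n s) \<longlonglongrightarrow> g s * h s" for s
      by (intro tendsto_intros limit)
  qed (use limit g in auto)
  ultimately show ?case using limit(5) LIMSEQ_unique by simp
qed

text \<open>This serves to verify the domain condition for \<open>\<Phi> g u\<close>: its second
  moment becomes an integral against the spectral distribution of \<open>u\<close>.\<close>

lemma \<mu>_\<Phi>:
  assumes g: "bounded_borel g"
  shows "\<mu> (\<Phi> g u) = density (\<mu> u) (\<lambda>s. ennreal ((cmod (g s))\<^sup>2))"
proof (rule measure_eqI)
  fix B assume "B \<in> sets (\<mu> (\<Phi> g u))"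
  then have B [measurable]: "B \<in> sets borel" by simp
  have [measurable]: "g \<in> borel_measurable borel" using g by measurable
  have "E B (\<Phi> g u) = \<Phi> (\<lambda>s. indicator B s * g s) u"
    by (simp add: \<Phi>_mult[symmetric] g \<Phi>_indicator)
  then have "emeasure (\<mu> (\<Phi> g u)) B = ennreal (LINT s|\<mu> u. (cmod (indicator B s * g s))\<^sup>2)"
    by (simp add: emeasure_\<mu> norm_\<Phi>_sq g)
  also have "\<dots> = (\<integral>\<^sup>+s. ennreal ((cmod (indicator B s * g s))\<^sup>2) \<partial>\<mu> u)"
    using g by (subst nn_integral_eq_integral) (auto intro!: integrable_\<mu>_norm_sq)
  also have "\<dots> = (\<integral>\<^sup>+s. ennreal ((cmod (g s))\<^sup>2) * indicator B s \<partial>\<mu> u)"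
    by (intro nn_integral_cong) (auto simp: indicator_def)
  also have "\<dots> = emeasure (density (\<mu> u) (\<lambda>s. ennreal ((cmod (g s))\<^sup>2))) B"
    by (subst emeasure_density) auto
  finally show "emeasure (\<mu> (\<Phi> g u)) B = \<dots>" .
qed simp

end

section \<open>The weighted energy estimate\<close>

lemma indefinite_integral_eq:
  fixes g :: "real \<Rightarrow> complex"
  assumes "set_integrable lborel {a..b} g" "x \<in> {a..b}"
  shows "(LINT t:{a..x}|lborel. g t) = integral {a..x} g"
  using assms
  by (auto intro!: set_borel_integral_eq_integral set_integrable_subset[OF assms(1)])

lemma set_integral_FTC_interior:
  fixes v :: "real \<Rightarrow> complex"
  assumes "a \<le> b" "continuous_on {a..b} v" "continuous_on {a..b} v'"
    "\<And>x. x \<in> {a<..<b} \<Longrightarrow> (v has_vector_derivative v' x) (at x)"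
  shows "(LINT x:{a..b}|lborel. v' x) = v b - v a"
  using fundamental_theorem_of_calculus_interior[OF assms(1,2,4)] borel_integrable_atLeastAtMost'[OF assms(3)]
  by (metis integral_unique set_borel_integral_eq_integral(2))

lemma set_integrable_continuous_mult:
  fixes v g :: "real \<Rightarrow> complex"
  assumes v: "continuous_on {a..b} v" and g: "set_integrable lborel {a..b} g"
  shows "set_integrable lborel {a..b} (\<lambda>x. v x * g x)"
proof -
  obtain M where M: "\<And>x. x \<in> {a..b} \<Longrightarrow> norm (v x) \<le> M"
    using compact_imp_bounded[OF compact_continuous_image[OF v compact_Icc]]
    by (metis bounded_iff image_eqI)
  have [measurable]: "(\<lambda>x. indicat_real {a..b} x *\<^sub>R v x) \<in> borel_measurable lborel"
    "(\<lambda>x. indicat_real {a..b} x *\<^sub>R g x) \<in> borel_measurable lborel"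
    using borel_integrable_atLeastAtMost'[OF v] g
    unfolding set_integrable_def by (auto intro: borel_measurable_integrable)
  have eq: "indicat_real {a..b} x *\<^sub>R (v x * g x) = (indicat_real {a..b} x *\<^sub>R v x) * (indicat_real {a..b} x *\<^sub>R g x)" for x
    by (auto simp: indicator_def)
  have "integrable lborel (\<lambda>x. M *\<^sub>R (indicat_real {a..b} x *\<^sub>R g x))"
    using g unfolding set_integrable_def by (rule integrable_scaleR_right)
  then show ?thesis
    unfolding set_integrable_def
  proof (rule Bochner_Integration.integrable_bound)
    show "(\<lambda>x. indicat_real {a..b} x *\<^sub>R (v x * g x)) \<in> borel_measurable lborel"
      unfolding eq by measurable
    have "norm (indicat_real {a..b} x *\<^sub>R (v x * g x)) \<le> norm (M *\<^sub>R (indicat_real {a..b} x *\<^sub>R g x))" for x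
      using mult_right_mono[OF order_trans[OF M abs_ge_self] norm_ge_zero[of "g x"], of x]
      by (auto simp: indicator_def norm_mult)
    then show "AE x in lborel. norm (indicat_real {a..b} x *\<^sub>R (v x * g x)) \<le> norm (M *\<^sub>R (indicat_real {a..b} x *\<^sub>R g x))"
      by simp
  qed
qed

text \<open>Fubini on the triangle \<open>a \<le> x \<le> y \<le> b\<close> replaces the product rule, since \<open>U\<close> is only
  absolutely continuous.\<close>

lemma integral_by_parts_AC:
  fixes v v' U g :: "real \<Rightarrow> complex"
  assumes ab: "a \<le> b" and v: "continuous_on {a..b} v" and v': "continuous_on {a..b} v'"
    and dv: "\<And>x. x \<in> {a<..<b} \<Longrightarrow> (v has_vector_derivative v' x) (at x)"
    and g: "set_integrable lborel {a..b} g"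
    and U: "\<And>x. x \<in> {a..b} \<Longrightarrow> U x = U a + (LINT t:{a..x}|lborel. g t)"
  shows "(LINT x:{a..b}|lborel. v x * g x) + (LINT x:{a..b}|lborel. v' x * U x) = v b * U b - v a * U a"
proof -
  have v'_int: "set_integrable lborel {a..b} v'" by (rule borel_integrable_atLeastAtMost'[OF v'])
  have cU: "continuous_on {a..b} U"
  proof -
    have "continuous_on {a..b} (\<lambda>x. U a + integral {a..x} g)"
      by (intro continuous_intros indefinite_integral_continuous_1 set_borel_integral_eq_integral(1) g)
    then show ?thesis
      by (rule continuous_on_eq) (simp add: U[symmetric] indefinite_integral_eq[OF g, symmetric])
  qed
  define G where "G x = indicat_real {a..b} x *\<^sub>R g x" for x
  define V where "V x = indicat_real {a..b} x *\<^sub>R v' x" for x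
  have G: "integrable lborel G" and V: "integrable lborel V"
    using g v'_int by (auto simp: G_def[abs_def] V_def[abs_def] set_integrable_def)
  have [measurable]: "G \<in> borel_measurable borel" "V \<in> borel_measurable borel"
    using G V borel_measurable_integrable by auto
  define K where "K x y = (if x \<le> y then G x * V y else 0)" for x y
  have "integrable (lborel \<Otimes>\<^sub>M lborel) (\<lambda>(x, y). G x * V y)"
    by (rule lborel_pair.Fubini_integrable) (auto simp: norm_mult G V)
  then have K: "integrable (lborel \<Otimes>\<^sub>M lborel) (\<lambda>(x, y). K x y)"
    by (rule Bochner_Integration.integrable_bound) (auto simp: K_def)
  have v_tail: "(LINT y:{x..b}|lborel. v' y) = v b - v x" if "x \<in> {a..b}" for x
    using that by (intro set_integral_FTC_interior continuous_on_subset[OF v]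
        continuous_on_subset[OF v'] dv) auto
  have inner_y: "(LINT y|lborel. K x y) = indicat_real {a..b} x *\<^sub>R (v b * g x - v x * g x)" for x
  proof (cases "x \<in> {a..b}")
    case True
    have "(LINT y|lborel. K x y) = (LINT y|lborel. g x * (indicat_real {x..b} y *\<^sub>R v' y))"
      using True by (intro Bochner_Integration.integral_cong) (auto simp: K_def G_def V_def indicator_def)
    also have "\<dots> = g x * (LINT y:{x..b}|lborel. v' y)"
      by (simp only: set_lebesgue_integral_def integral_mult_right_zero)
    finally show ?thesis using True by (simp add: v_tail algebra_simps)
  qed (simp add: K_def G_def cong: if_cong)
  have inner_x: "(LINT x|lborel. K x y) = indicat_real {a..b} y *\<^sub>R (v' y * U y - U a * v' y)" for y
  proof (cases "y \<in> {a..b}")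
    case True
    have "(LINT x|lborel. K x y) = (LINT x|lborel. v' y * (indicat_real {a..y} x *\<^sub>R g x))"
      using True by (intro Bochner_Integration.integral_cong) (auto simp: K_def G_def V_def indicator_def)
    also have "\<dots> = v' y * (LINT x:{a..y}|lborel. g x)"
      by (simp only: set_lebesgue_integral_def integral_mult_right_zero)
    also have "(LINT x:{a..y}|lborel. g x) = U y - U a" using U[OF True] by simp
    finally show ?thesis using True by (simp add: algebra_simps)
  qed (simp add: K_def V_def cong: if_cong)
  have "(LINT y:{a..b}|lborel. v' y * U y - U a * v' y) = (LINT x:{a..b}|lborel. v b * g x - v x * g x)"
    using lborel_pair.Fubini_integral[OF K] by (simp add: inner_x inner_y set_lebesgue_integral_def)
  moreover have "(LINT y:{a..b}|lborel. v' y * U y - U a * v' y)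
      = (LINT y:{a..b}|lborel. v' y * U y) - U a * (v b - v a)"
    using set_integral_diff(2)[OF set_integrable_continuous_mult[OF v' borel_integrable_atLeastAtMost'[OF cU]]
        set_integrable_mult_right[OF v'_int, of "U a"]] v_tail[of a] ab
    by simp
  moreover have "(LINT x:{a..b}|lborel. v b * g x - v x * g x)
      = v b * (U b - U a) - (LINT x:{a..b}|lborel. v x * g x)"
    using set_integral_diff(2)[OF set_integrable_mult_right[OF g, of "v b"] set_integrable_continuous_mult[OF v g]]
      U[of b] ab by simp
  ultimately have "(LINT y:{a..b}|lborel. v' y * U y) - U a * (v b - v a)
      = v b * (U b - U a) - (LINT x:{a..b}|lborel. v x * g x)" by simp
  then show ?thesis by (simp add: algebra_simps)
qed

text \<open>The values of \<open>u'\<close> at the endpoints are arbitrary, since a delta may sit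
  there. The continuous extension \<open>U\<close> supplies the one-sided limits and permits
  integration by parts up to the endpoints.\<close>

lemma derivative_extends:
  fixes u' g :: "real \<Rightarrow> complex"
  assumes ab: "a < b" and g: "set_integrable lborel {a..b} g"
    and du': "\<And>x y. a < x \<Longrightarrow> x \<le> y \<Longrightarrow> y < b \<Longrightarrow> u' y - u' x = (LINT t:{x..y}|lborel. g t)"
  obtains U where "continuous_on {a..b} U"
    "\<And>x. x \<in> {a..b} \<Longrightarrow> U x = U a + (LINT t:{a..x}|lborel. g t)"
    "\<And>x. x \<in> {a<..<b} \<Longrightarrow> U x = u' x"
proof
  \<comment> \<open>The integral is anchored at an interior point, where \<open>u'\<close> is
    meaningful.\<close>
  define m where "m = (a + b) / 2"
  have m: "a < m" "m < b" using ab by (auto simp: m_def)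
  define U where "U x = u' m - integral {a..m} g + integral {a..x} g" for x
  note gi = set_borel_integral_eq_integral(1)[OF g]
  show "continuous_on {a..b} U"
    unfolding U_def by (intro continuous_intros indefinite_integral_continuous_1 gi)
  show "U x = U a + (LINT t:{a..x}|lborel. g t)" if "x \<in> {a..b}" for x
    by (simp add: U_def indefinite_integral_eq[OF g that])
  show "U x = u' x" if x: "x \<in> {a<..<b}" for x
  proof -
    have incr: "integral {a..q} g = integral {a..p} g + (u' q - u' p)" if "a < p" "p \<le> q" "q < b" for p q
    proof -
      have "set_integrable lborel {p..q} g" using g by (rule set_integrable_subset) (use that in auto)
      then have "u' q - u' p = integral {p..q} g"
        using du'[of p q] that by (simp add: set_borel_integral_eq_integral(2))
      moreover have "integral {a..p} g + integral {p..q} g = integral {a..q} g"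
        using that by (intro Henstock_Kurzweil_Integration.integral_combine integrable_subinterval_real[OF gi]) auto
      ultimately show ?thesis by simp
    qed
    show ?thesis
      using incr[of m x] incr[of x m] x m by (cases "m \<le> x") (auto simp: U_def)
  qed
qed

text \<open>On a bounded interval constants are integrable, and
  \<open>cmod (u x) \<le> 1 + (cmod (u x))\<^sup>2\<close>.\<close>

lemma square_integrable_set_integrable:
  assumes u: "square_integrable u"
  shows "set_integrable lborel {a..b} u" "set_integrable lborel {a..b} (\<lambda>x. (cmod (u x))\<^sup>2)"
proof -
  show i: "set_integrable lborel {a..b} (\<lambda>x. (cmod (u x))\<^sup>2)"
    unfolding set_integrable_def
    using square_integrable_norm_sq[OF u] by (intro integrable_mult_indicator[of "{a..b}" lborel, simplified]) auto
  have [measurable]: "u \<in> borel_measurable borel" using u by (rule square_integrable_measurable)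
  have "set_integrable lborel {a..b} (\<lambda>x. 1 + (cmod (u x))\<^sup>2)"
    by (intro set_integral_add i borel_integrable_atLeastAtMost') auto
  then show "set_integrable lborel {a..b} u"
    unfolding set_integrable_def
  proof (rule Bochner_Integration.integrable_bound)
    have "cmod (u x) \<le> 1 + (cmod (u x))\<^sup>2" for x
      using sum_squares_bound[of 1 "cmod (u x)"] norm_ge_zero[of "u x"]
      unfolding power_one mult_1_right by linarith
    then show "AE x in lborel. norm (indicat_real {a..b} x *\<^sub>R u x)
        \<le> norm (indicat_real {a..b} x *\<^sub>R (1 + (cmod (u x))\<^sup>2))"
      by (auto simp: indicator_def add_nonneg_nonneg)
  qed measurable
qed

text \<open>\<open>Re \<zeta> - \<sigma> Im \<zeta>\<close> with \<open>\<sigma> = \<plusminus>1\<close>: combines the real and the imaginary part of the energy identity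
  for \<open>(H - \<sigma>\<i>) u = h\<close> so that both \<open>\<bar>u'\<bar>\<^sup>2\<close> and \<open>\<bar>u\<bar>\<^sup>2\<close> enter with a positive sign.\<close>

definition energy_part :: "real \<Rightarrow> complex \<Rightarrow> real" where
  "energy_part \<sigma> \<zeta> = Re \<zeta> - \<sigma> * Im \<zeta>"

lemma bounded_linear_energy_part: "bounded_linear (energy_part \<sigma>)"
  unfolding energy_part_def
  by (intro bounded_linear_sub bounded_linear_Re bounded_linear_const_mult bounded_linear_Im)

lemma energy_part_simps:
  "energy_part \<sigma> (x + y) = energy_part \<sigma> x + energy_part \<sigma> y"
  "energy_part \<sigma> (x - y) = energy_part \<sigma> x - energy_part \<sigma> y"
  "energy_part \<sigma> (complex_of_real c) = c"
  "energy_part \<sigma> (\<i> * complex_of_real c) = - \<sigma> * c"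
  by (auto simp: energy_part_def algebra_simps)

lemma abs_energy_part_le: "\<sigma> = 1 \<or> \<sigma> = -1 \<Longrightarrow> \<bar>energy_part \<sigma> x\<bar> \<le> 2 * cmod x"
  using abs_Re_le_cmod[of x] abs_Im_le_cmod[of x] by (auto simp: energy_part_def)

text \<open>Here \<open>q\<close> stands for the derivative of \<open>u\<close>: the argument of
  \<open>energy_part\<close> is the derivative of \<open>W\<^sup>2 * cnj u * u'\<close> when
  \<open>u'' = - (h + \<sigma> * \<i> * u)\<close>. The term with \<sigma> supplies the square of
  \<open>W * cmod u\<close>, and \<open>q\<close> is eliminated by completing squares.\<close>

lemma energy_pointwise:
  fixes u q h :: complex and W W' :: real
  assumes \<sigma>: "\<sigma> = 1 \<or> \<sigma> = -1"
  shows "(W * cmod u)\<^sup>2 / 2 - 8 * (W' * cmod u)\<^sup>2 - 2 * (W * cmod h)\<^sup>2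
    \<le> energy_part \<sigma> ((of_real (2 * W * W') * cnj u + of_real (W\<^sup>2) * cnj q) * q
        - of_real (W\<^sup>2) * cnj u * (h + \<sigma> * \<i> * u))"
proof -
  define A where "A = \<bar>W\<bar> * cmod u"
  define B where "B = \<bar>W'\<bar> * cmod u"
  define Q where "Q = \<bar>W\<bar> * cmod q"
  define H where "H = \<bar>W\<bar> * cmod h"
  define X where "X = of_real (2 * W * W') * cnj u * q"
  define Y where "Y = of_real (W\<^sup>2) * cnj u * h"
  have n: "q * cnj q = of_real ((cmod q)\<^sup>2)" "u * cnj u = of_real ((cmod u)\<^sup>2)"
    by (rule complex_norm_square[symmetric])+
  have "(of_real (2 * W * W') * cnj u + of_real (W\<^sup>2) * cnj q) * q
        - of_real (W\<^sup>2) * cnj u * (h + \<sigma> * \<i> * u)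
      = X + of_real (W\<^sup>2) * (q * cnj q) - Y - \<i> * of_real (\<sigma> * W\<^sup>2) * (u * cnj u)"
    by (simp add: X_def Y_def algebra_simps)
  also have "\<dots> = X + of_real (Q\<^sup>2) - Y - \<i> * of_real (\<sigma> * A\<^sup>2)"
    unfolding n by (simp add: Q_def A_def power_mult_distrib)
  finally have *: "energy_part \<sigma> ((of_real (2 * W * W') * cnj u + of_real (W\<^sup>2) * cnj q) * q
        - of_real (W\<^sup>2) * cnj u * (h + \<sigma> * \<i> * u)) = energy_part \<sigma> X + Q\<^sup>2 - energy_part \<sigma> Y + A\<^sup>2"
    using \<sigma> by (auto simp: energy_part_simps simp del: of_real_mult of_real_power)
  have "cmod X = 2 * (B * Q)" "cmod Y = A * H"
    by (simp_all add: X_def Y_def B_def Q_def A_def H_def norm_mult abs_mult power2_eq_square)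
  then have "energy_part \<sigma> X \<ge> - (4 * (B * Q))" "energy_part \<sigma> Y \<le> 2 * (A * H)"
    using abs_energy_part_le[OF \<sigma>, of X] abs_energy_part_le[OF \<sigma>, of Y] by linarith+
  \<comment> \<open>The two squares are chosen so that the cross terms consume half of
    \<open>Q\<^sup>2\<close> and half of \<open>A\<^sup>2\<close>; this produces the coefficients 8
    and 2 of the statement.\<close>
  moreover have "0 \<le> (4 * B - Q)\<^sup>2" "0 \<le> (A - 2 * H)\<^sup>2" by simp_all
  then have "4 * (B * Q) \<le> 8 * B\<^sup>2 + Q\<^sup>2 / 2" "2 * (A * H) \<le> A\<^sup>2 / 2 + 2 * H\<^sup>2"
    by (simp_all add: power2_eq_square algebra_simps)
  moreover have "(W * cmod u)\<^sup>2 = A\<^sup>2" "(W' * cmod u)\<^sup>2 = B\<^sup>2" "(W * cmod h)\<^sup>2 = H\<^sup>2"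
    by (simp_all add: A_def B_def H_def power_mult_distrib)
  ultimately show ?thesis unfolding * using zero_le_power2[of Q] by linarith
qed

text \<open>This lower bound contains no derivative of \<open>u\<close>, so on bounded intervals it
  is integrable for square-integrable \<open>u\<close> and \<open>h\<close> and continuous weights.
  The term in \<open>W'\<close> is the price of a weight that is not constant.\<close>

definition energy_density :: "(real \<Rightarrow> real) \<Rightarrow> (real \<Rightarrow> real) \<Rightarrow> (real \<Rightarrow> complex) \<Rightarrow> (real \<Rightarrow> complex) \<Rightarrow> real \<Rightarrow> real" where
  "energy_density W W' u h x = (W x * cmod (u x))\<^sup>2 / 2 - 8 * (W' x * cmod (u x))\<^sup>2 - 2 * (W x * cmod (h x))\<^sup>2"

section \<open>The energy inequality integrated over intervals\<close>

lemma set_integrable_weight: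
  fixes W :: "real \<Rightarrow> real"
  assumes W: "continuous_on UNIV W" and u: "square_integrable u"
  shows "set_integrable lborel {a..b} (\<lambda>x. (W x * cmod (u x))\<^sup>2)"
proof -
  have "set_integrable lborel {a..b} (\<lambda>x. complex_of_real ((W x)\<^sup>2) * complex_of_real ((cmod (u x))\<^sup>2))"
    using continuous_on_subset[OF W subset_UNIV] square_integrable_set_integrable(2)[OF u]
    by (intro set_integrable_continuous_mult continuous_intros) (simp_all add: set_integrable_def scaleR_conv_of_real flip: of_real_mult of_real_power)
  also have "(\<lambda>x. complex_of_real ((W x)\<^sup>2) * complex_of_real ((cmod (u x))\<^sup>2))
      = (\<lambda>x. complex_of_real ((W x * cmod (u x))\<^sup>2))"
    by (simp add: power_mult_distrib)
  finally show ?thesis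
    unfolding set_integrable_def scaleR_conv_of_real of_real_mult[symmetric] complex_of_real_integrable_eq
    by simp
qed

lemma set_integrable_energy_density:
  assumes "continuous_on UNIV W" "continuous_on UNIV W'" "square_integrable u" "square_integrable h"
  shows "set_integrable lborel {a..b} (energy_density W W' u h)"
  unfolding energy_density_def
  by (intro set_integral_diff set_integrable_mult_right set_integrable_divide set_integrable_weight assms)

text \<open>The equation is tested against \<open>W\<^sup>2 * cnj u\<close>. The one-sided limits
  \<open>l\<close> and \<open>r\<close> stay in the conclusion so that adjacent intervals can be
  joined through the jump condition.\<close>

lemma energy_interval:
  fixes u u' w h :: "real \<Rightarrow> complex" and W W' :: "real \<Rightarrow> real"
  assumes ab: "a < b" and \<sigma>: "\<sigma> = 1 \<or> \<sigma> = -1"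
    and u: "square_integrable u" and w: "square_integrable w" and h: "square_integrable h"
    and cu: "continuous_on {a..b} u"
    and du: "\<And>x. x \<in> {a<..<b} \<Longrightarrow> (u has_vector_derivative u' x) (at x)"
    and du': "\<And>x y. a < x \<Longrightarrow> x \<le> y \<Longrightarrow> y < b \<Longrightarrow> u' y - u' x = (LINT t:{x..y}|lborel. - w t)"
    and AEw: "AE x in lborel. w x = h x + \<sigma> * \<i> * u x"
    and dW: "\<And>x. (W has_real_derivative W' x) (at x)" and cW': "continuous_on UNIV W'"
  obtains l r where "(u' \<longlongrightarrow> l) (at_right a)" "(u' \<longlongrightarrow> r) (at_left b)"
    "(LINT x:{a..b}|lborel. energy_density W W' u h x)
      \<le> energy_part \<sigma> (of_real ((W b)\<^sup>2) * cnj (u b) * r) - energy_part \<sigma> (of_real ((W a)\<^sup>2) * cnj (u a) * l)"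
proof -
  have w_int: "set_integrable lborel {a..b} (\<lambda>t. - w t)"
    using square_integrable_set_integrable(1)[OF square_integrable_uminus[OF w]] .
  obtain U where cU: "continuous_on {a..b} U"
    and U: "\<And>x. x \<in> {a..b} \<Longrightarrow> U x = U a + (LINT t:{a..x}|lborel. - w t)"
    and Uu': "\<And>x. x \<in> {a<..<b} \<Longrightarrow> U x = u' x"
    using derivative_extends[OF ab w_int du'] by blast
  have cW: "continuous_on UNIV W"
    using dW by (meson DERIV_isCont continuous_at_imp_continuous_on)
  note cW_ab = continuous_on_subset[OF cW subset_UNIV] continuous_on_subset[OF cW' subset_UNIV]
  define v where "v x = of_real ((W x)\<^sup>2) * cnj (u x)" for x
  define v' where "v' x = of_real (2 * W x * W' x) * cnj (u x) + of_real ((W x)\<^sup>2) * cnj (U x)" for x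
  have cv: "continuous_on {a..b} v" and cv': "continuous_on {a..b} v'"
    unfolding v_def v'_def by (intro continuous_intros cu cU cW_ab)+
  have dv: "(v has_vector_derivative v' x) (at x)" if x: "x \<in> {a<..<b}" for x
  proof -
    have "((\<lambda>x. (W x)\<^sup>2) has_real_derivative 2 * W x * W' x) (at x)"
      by (auto intro!: derivative_eq_intros dW)
    then have "((\<lambda>x. complex_of_real ((W x)\<^sup>2)) has_vector_derivative of_real (2 * W x * W' x)) (at x)"
      by (intro has_vector_derivative_of_real) (simp add: has_real_derivative_iff_has_vector_derivative)
    moreover have "((\<lambda>x. cnj (u x)) has_vector_derivative cnj (U x)) (at x)"
      using du[OF x] Uu'[OF x] by (simp add: has_vector_derivative_cnj)
    ultimately show ?thesis
      unfolding v_def v'_def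
      by (rule has_vector_derivative_eq_rhs[OF has_vector_derivative_mult]) simp
  qed
  have parts: "(LINT x:{a..b}|lborel. v x * - w x) + (LINT x:{a..b}|lborel. v' x * U x) = v b * U b - v a * U a"
    by (rule integral_by_parts_AC[OF less_imp_le[OF ab] cv cv' dv w_int U])
  have i1: "set_integrable lborel {a..b} (\<lambda>x. v x * - w x)"
    by (rule set_integrable_continuous_mult[OF cv w_int])
  have i2: "set_integrable lborel {a..b} (\<lambda>x. v' x * U x)"
    by (rule set_integrable_continuous_mult[OF cv' borel_integrable_atLeastAtMost'[OF cU]])
  \<comment> \<open>Almost everywhere \<open>e\<close> is the derivative of \<open>v * U\<close>,
    because that of \<open>U\<close> is \<open>- w\<close>.\<close>
  define e where "e x = v x * - w x + v' x * U x" for x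
  have e_int: "set_integrable lborel {a..b} e"
    unfolding e_def by (rule set_integral_add(1)[OF i1 i2])
  have e_eq: "(LINT x:{a..b}|lborel. e x) = v b * U b - v a * U a"
    unfolding e_def using set_integral_add(2)[OF i1 i2] parts by simp
  have "(LINT x:{a..b}|lborel. energy_density W W' u h x) \<le> (LINT x:{a..b}|lborel. energy_part \<sigma> (e x))"
    unfolding set_lebesgue_integral_def
  proof (rule integral_mono_AE)
    show "integrable lborel (\<lambda>x. indicat_real {a..b} x *\<^sub>R energy_density W W' u h x)"
      using set_integrable_energy_density[OF cW cW' u h] by (simp add: set_integrable_def)
    show "integrable lborel (\<lambda>x. indicat_real {a..b} x *\<^sub>R energy_part \<sigma> (e x))"
      using integrable_bounded_linear[OF bounded_linear_energy_part e_int[unfolded set_integrable_def], of \<sigma>]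
      by (simp add: linear_simps[OF bounded_linear_energy_part])
    show "AE x in lborel. indicat_real {a..b} x *\<^sub>R energy_density W W' u h x
        \<le> indicat_real {a..b} x *\<^sub>R energy_part \<sigma> (e x)"
      using AEw
    proof (rule eventually_mono)
      fix x assume wx: "w x = h x + \<sigma> * \<i> * u x"
      have "e x = (of_real (2 * W x * W' x) * cnj (u x) + of_real ((W x)\<^sup>2) * cnj (U x)) * U x
          - of_real ((W x)\<^sup>2) * cnj (u x) * (h x + \<sigma> * \<i> * u x)"
        by (simp add: e_def v_def v'_def wx algebra_simps)
      then have "energy_density W W' u h x \<le> energy_part \<sigma> (e x)"
        unfolding energy_density_def by (simp only: energy_pointwise[OF \<sigma>])
      then show "indicat_real {a..b} x *\<^sub>R energy_density W W' u h x
        \<le> indicat_real {a..b} x *\<^sub>R energy_part \<sigma> (e x)"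
        by (simp add: mult_left_mono)
    qed
  qed
  also have "\<dots> = energy_part \<sigma> (LINT x:{a..b}|lborel. e x)"
    unfolding set_lebesgue_integral_def
    using integral_bounded_linear[OF bounded_linear_energy_part e_int[unfolded set_integrable_def], of \<sigma>]
    by (simp add: linear_simps[OF bounded_linear_energy_part])
  also have "\<dots> = energy_part \<sigma> (v b * U b) - energy_part \<sigma> (v a * U a)"
    by (simp only: e_eq energy_part_simps)
  finally have main: "(LINT x:{a..b}|lborel. energy_density W W' u h x)
      \<le> energy_part \<sigma> (of_real ((W b)\<^sup>2) * cnj (u b) * U b) - energy_part \<sigma> (of_real ((W a)\<^sup>2) * cnj (u a) * U a)"
    by (simp only: v_def)
  have "(u' \<longlongrightarrow> U a) (at_right a)"
    using continuous_on_Icc_at_rightD[OF cU ab]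
    by (rule Lim_transform_eventually)
      (use eventually_at_right_real[OF ab] Uu' in \<open>auto elim: eventually_mono\<close>)
  moreover have "(u' \<longlongrightarrow> U b) (at_left b)"
    using continuous_on_Icc_at_leftD[OF cU ab]
    by (rule Lim_transform_eventually)
      (use eventually_at_left_real[OF ab] Uu' in \<open>auto elim: eventually_mono\<close>)
  ultimately show thesis using main that by blast
qed

text \<open>When three intervals are added, the endpoint terms at each delta \<open>p\<close>
  combine to minus \<open>(W p)\<^sup>2 * (cmod (u p))\<^sup>2 / \<eta>\<close>, which can be
  discarded whatever the size of \<eta>. Those at the outer ends vanish with
  \<open>W\<close>.\<close>

lemma delta_energy:
  fixes W W' :: "real \<Rightarrow> real" and \<kappa> \<eta> \<sigma> n :: real
  assumes \<kappa>: "0 < \<kappa>" "\<kappa> < n" and \<eta>: "\<eta> > 0" and \<sigma>: "\<sigma> = 1 \<or> \<sigma> = -1"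
    and u: "square_integrable u" and w: "square_integrable w" and h: "square_integrable h"
    and cu: "continuous_on UNIV u"
    and du: "\<And>x. x \<noteq> \<kappa> \<Longrightarrow> x \<noteq> - \<kappa> \<Longrightarrow> (u has_vector_derivative u' x) (at x)"
    and du': "\<And>a b. a \<le> b \<Longrightarrow> \<kappa> \<notin> {a..b} \<Longrightarrow> - \<kappa> \<notin> {a..b} \<Longrightarrow> u' b - u' a = (LINT x:{a..b}|lborel. - w x)"
    and jump: "\<And>p. p \<in> {\<kappa>, - \<kappa>} \<Longrightarrow> \<exists>l r. (u' \<longlongrightarrow> l) (at_left p) \<and> (u' \<longlongrightarrow> r) (at_right p) \<and>
           r - l = u p / of_real \<eta>"
    and AEw: "AE x in lborel. w x = h x + \<sigma> * \<i> * u x"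
    and dW: "\<And>x. (W has_real_derivative W' x) (at x)" and cW': "continuous_on UNIV W'"
    and Wn: "W n = 0" "W (- n) = 0"
  shows "(LINT x:{-n..n}|lborel. energy_density W W' u h x) \<le> 0"
proof -
  let ?d = "energy_density W W' u h"
  let ?e = "\<lambda>x z. energy_part \<sigma> (of_real ((W x)\<^sup>2) * cnj (u x) * z)"
  have cW: "continuous_on UNIV W"
    using dW by (meson DERIV_isCont continuous_at_imp_continuous_on)
  \<comment> \<open>Only the open interval has to avoid the deltas, so they may be its
    endpoints.\<close>
  have local: "\<exists>l r. (u' \<longlongrightarrow> l) (at_right a) \<and> (u' \<longlongrightarrow> r) (at_left b) \<and>
      (LINT x:{a..b}|lborel. ?d x) \<le> ?e b r - ?e a l"
    if "a < b" "\<kappa> \<notin> {a<..<b}" "- \<kappa> \<notin> {a<..<b}" for a b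
  proof -
    have du_ab: "(u has_vector_derivative u' x) (at x)" if "x \<in> {a<..<b}" for x
      by (rule du) (use that \<open>\<kappa> \<notin> _\<close> \<open>- \<kappa> \<notin> _\<close> in blast)+
    have du'_ab: "u' y - u' x = (LINT t:{x..y}|lborel. - w t)" if xy: "a < x" "x \<le> y" "y < b" for x y
    proof (rule du'[OF xy(2)])
      have "{x..y} \<subseteq> {a<..<b}" using xy by auto
      then show "\<kappa> \<notin> {x..y}" "- \<kappa> \<notin> {x..y}" using \<open>\<kappa> \<notin> _\<close> \<open>- \<kappa> \<notin> _\<close> by blast+
    qed
    show ?thesis
      by (rule energy_interval[OF \<open>a < b\<close> \<sigma> u w h continuous_on_subset[OF cu subset_UNIV]
            du_ab du'_ab AEw dW cW']) (assumption | blast)+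
  qed
  have "- n < - \<kappa>" "\<kappa> \<notin> {- n<..<- \<kappa>}" "- \<kappa> \<notin> {- n<..<- \<kappa>}" using \<kappa> by auto
  from local[OF this] obtain l1 r1 where 1: "(u' \<longlongrightarrow> l1) (at_right (- n))" "(u' \<longlongrightarrow> r1) (at_left (- \<kappa>))"
    "(LINT x:{-n..-\<kappa>}|lborel. ?d x) \<le> ?e (- \<kappa>) r1 - ?e (- n) l1"
    by (elim exE conjE) (rule that)
  have "- \<kappa> < \<kappa>" "\<kappa> \<notin> {- \<kappa><..<\<kappa>}" "- \<kappa> \<notin> {- \<kappa><..<\<kappa>}" using \<kappa> by auto
  from local[OF this] obtain l2 r2 where 2: "(u' \<longlongrightarrow> l2) (at_right (- \<kappa>))" "(u' \<longlongrightarrow> r2) (at_left \<kappa>)"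
    "(LINT x:{-\<kappa>..\<kappa>}|lborel. ?d x) \<le> ?e \<kappa> r2 - ?e (- \<kappa>) l2"
    by (elim exE conjE) (rule that)
  have "\<kappa> < n" "\<kappa> \<notin> {\<kappa><..<n}" "- \<kappa> \<notin> {\<kappa><..<n}" using \<kappa> by auto
  from local[OF this] obtain l3 r3 where 3: "(u' \<longlongrightarrow> l3) (at_right \<kappa>)" "(u' \<longlongrightarrow> r3) (at_left n)"
    "(LINT x:{\<kappa>..n}|lborel. ?d x) \<le> ?e n r3 - ?e \<kappa> l3"
    by (elim exE conjE) (rule that)
  \<comment> \<open>The limits in the jump condition and those found on the intervals are separate
    witnesses; uniqueness of one-sided limits identifies them.\<close>
  have jump_unique: "r - l = u p / of_real \<eta>"
    if p: "p \<in> {\<kappa>, - \<kappa>}" "(u' \<longlongrightarrow> l) (at_left p)" "(u' \<longlongrightarrow> r) (at_right p)" for p l r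
  proof -
    obtain l' r' where lr: "(u' \<longlongrightarrow> l') (at_left p)" "(u' \<longlongrightarrow> r') (at_right p)" "r' - l' = u p / of_real \<eta>"
      using jump[OF p(1)] by (elim exE conjE) (rule that)
    have "l' = l" by (rule tendsto_unique[OF trivial_limit_at_left_real lr(1) p(2)])
    moreover have "r' = r" by (rule tendsto_unique[OF trivial_limit_at_right_real lr(2) p(3)])
    ultimately show ?thesis using lr(3) by simp
  qed
  have jump_energy: "?e p r - ?e p l = (W p)\<^sup>2 * (cmod (u p))\<^sup>2 / \<eta>"
    if "r - l = u p / of_real \<eta>" for p l r
  proof -
    have "?e p r - ?e p l = energy_part \<sigma> (of_real ((W p)\<^sup>2) * cnj (u p) * (r - l))"
      by (simp only: energy_part_simps(2)[symmetric] right_diff_distrib)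
    also have "of_real ((W p)\<^sup>2) * cnj (u p) * (r - l) = of_real ((W p)\<^sup>2) * (u p * cnj (u p)) / of_real \<eta>"
      by (simp add: that)
    also have "\<dots> = of_real ((W p)\<^sup>2 * (cmod (u p))\<^sup>2 / \<eta>)"
      by (simp only: complex_norm_square[symmetric] of_real_mult of_real_divide)
    finally show ?thesis by (simp only: energy_part_simps)
  qed
  have int: "?d integrable_on {a..b}" "(LINT x:{a..b}|lborel. ?d x) = integral {a..b} ?d" for a b
    using set_borel_integral_eq_integral[OF set_integrable_energy_density[OF cW cW' u h]] by auto
  have "(LINT x:{-n..n}|lborel. ?d x)
      = (LINT x:{-n..-\<kappa>}|lborel. ?d x) + (LINT x:{-\<kappa>..\<kappa>}|lborel. ?d x) + (LINT x:{\<kappa>..n}|lborel. ?d x)"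
    unfolding int(2)
    using Henstock_Kurzweil_Integration.integral_combine[of "-n" "-\<kappa>" \<kappa> ?d]
      Henstock_Kurzweil_Integration.integral_combine[of "-n" \<kappa> n ?d] \<kappa> int(1) by simp
  \<comment> \<open>The endpoint terms are regrouped by point instead of by interval.\<close>
  also have "\<dots> \<le> - (?e (- \<kappa>) l2 - ?e (- \<kappa>) r1) - (?e \<kappa> l3 - ?e \<kappa> r2) + (?e n r3 - ?e (- n) l1)"
    using 1(3) 2(3) 3(3) by linarith
  also have "?e n r3 - ?e (- n) l1 = 0" by (simp add: Wn energy_part_def)
  also have "?e (- \<kappa>) l2 - ?e (- \<kappa>) r1 = (W (- \<kappa>))\<^sup>2 * (cmod (u (- \<kappa>)))\<^sup>2 / \<eta>"
    using jump_unique[of "- \<kappa>"] 1(2) 2(1) by (intro jump_energy) blast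
  also have "?e \<kappa> l3 - ?e \<kappa> r2 = (W \<kappa>)\<^sup>2 * (cmod (u \<kappa>))\<^sup>2 / \<eta>"
    using jump_unique[of "\<kappa>"] 2(2) 3(1) by (intro jump_energy) blast
  finally show ?thesis
    using \<eta> by (smt (verit) divide_nonneg_pos mult_nonneg_nonneg zero_le_power2)
qed

text \<open>The cubic \<open>W\<close> agrees with \<open>x\<close> to first order at the origin,
  vanishes at \<open>2 * m\<close> and \<open>- 2 * m\<close>, and has the derivative
  \<open>W'\<close>, bounded independently of \<open>m\<close>. With
  \<open>y = (x / (2 * m))\<^sup>2\<close>, the range \<open>0 \<le> y \<le> 1\<close> puts
  \<open>W'\<close> between -2 and 1, and \<open>y \<le> 1/4\<close> gives
  \<open>1 - y \<ge> 3/4\<close>.\<close>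

lemma cutoff_weight_bounds:
  fixes x m :: real
  assumes m: "m > 0"
  defines "W \<equiv> x * (1 - (x / (2 * m))\<^sup>2)" and "W' \<equiv> 1 - 3 * (x / (2 * m))\<^sup>2"
  shows "\<bar>x\<bar> \<le> 2 * m \<Longrightarrow> W\<^sup>2 \<le> x\<^sup>2" "\<bar>x\<bar> \<le> 2 * m \<Longrightarrow> W'\<^sup>2 \<le> 4" "\<bar>x\<bar> \<le> m \<Longrightarrow> (9/16) * x\<^sup>2 \<le> W\<^sup>2"
proof -
  define y where "y = (x / (2 * m))\<^sup>2"
  have y0: "0 \<le> y" by (simp add: y_def)
  have W: "W\<^sup>2 = x\<^sup>2 * (1 - y)\<^sup>2" "W' = 1 - 3 * y" by (simp_all add: W_def W'_def y_def power_mult_distrib)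
  {
    assume "\<bar>x\<bar> \<le> 2 * m"
    then have "\<bar>x / (2 * m)\<bar> \<le> 1" using m by simp
    then have y1: "y \<le> 1" unfolding y_def by (simp add: abs_square_le_1)
    have "(1 - y)\<^sup>2 \<le> 1" using y0 y1 by (simp add: abs_square_le_1)
    then show "W\<^sup>2 \<le> x\<^sup>2" unfolding W using mult_left_mono[of "(1 - y)\<^sup>2" 1 "x\<^sup>2"] by simp
    have "\<bar>W'\<bar> \<le> 2" unfolding W using y0 y1 by auto
    then have "\<bar>W'\<bar>\<^sup>2 \<le> 2\<^sup>2" by (intro power_mono) auto
    then show "W'\<^sup>2 \<le> 4" by simp
  }
  assume "\<bar>x\<bar> \<le> m"
  then have "\<bar>x / (2 * m)\<bar> \<le> 1/2" using m by (simp add: field_simps)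
  then have "\<bar>x / (2 * m)\<bar>\<^sup>2 \<le> (1/2)\<^sup>2" by (intro power_mono) auto
  then have "y \<le> 1/4" by (simp add: y_def power2_eq_square)
  then have "(3/4)\<^sup>2 \<le> (1 - y)\<^sup>2" by (intro power_mono) auto
  then show "(9/16) * x\<^sup>2 \<le> W\<^sup>2"
    unfolding W using mult_left_mono[of "9/16" "(1 - y)\<^sup>2" "x\<^sup>2"] by (simp add: power2_eq_square)
qed

section \<open>First moments of solutions and passage to the Stark operator\<close>

lemma delta_hamiltonianE:
  assumes "(\<psi>u, \<psi>w) \<in> delta_hamiltonian \<kappa> \<eta>"
  obtains u w u' where "\<psi>u = abs_L2 u" "\<psi>w = abs_L2 w"
    "square_integrable u" "square_integrable w" "continuous_on UNIV u"
    "\<forall>x. x \<noteq> \<kappa> \<longrightarrow> x \<noteq> - \<kappa> \<longrightarrow> (u has_vector_derivative u' x) (at x)"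
    "\<forall>a b. a \<le> b \<longrightarrow> \<kappa> \<notin> {a..b} \<longrightarrow> - \<kappa> \<notin> {a..b} \<longrightarrow> u' b - u' a = (LINT x:{a..b}|lborel. - w x)"
    "\<forall>p\<in>{\<kappa>, - \<kappa>}. \<exists>l r. (u' \<longlongrightarrow> l) (at_left p) \<and> (u' \<longlongrightarrow> r) (at_right p) \<and>
           r - l = u p / of_real \<eta>"
  using assms unfolding delta_hamiltonian_def stark_delta_hamiltonian_def
  by (simp only: mem_Collect_eq prod.inject mult_zero_left of_real_0 diff_0) blast

text \<open>Integrability of \<open>x u\<close> results from letting the cutoff scale
  \<open>m\<close> tend to infinity in a bound that does not depend on \<open>m\<close>.\<close>

lemma delta_moment:
  fixes \<kappa> \<eta> \<sigma> :: real
  assumes \<kappa>: "\<kappa> > 0" and \<eta>: "\<eta> > 0" and \<sigma>: "\<sigma> = 1 \<or> \<sigma> = -1"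
    and graph: "(\<psi>u, \<psi>w) \<in> delta_hamiltonian \<kappa> \<eta>"
    and eq: "\<psi>w - scaleC (\<sigma> * \<i>) \<psi>u = abs_L2 h"
    and h: "square_integrable h" and xh: "square_integrable (\<lambda>x. of_real x * h x)"
  obtains u where "square_integrable u" "square_integrable (\<lambda>x. of_real x * u x)" "\<psi>u = abs_L2 u"
    "(norm (abs_L2 (\<lambda>x. of_real x * u x)))\<^sup>2
      \<le> 32 / 9 * (32 * (norm \<psi>u)\<^sup>2 + 2 * (norm (abs_L2 (\<lambda>x. of_real x * h x)))\<^sup>2)"
proof -
  obtain u w u' where uw: "\<psi>u = abs_L2 u" "\<psi>w = abs_L2 w"
    and u: "square_integrable u" and w: "square_integrable w" and cu: "continuous_on UNIV u"
    and d: "\<forall>x. x \<noteq> \<kappa> \<longrightarrow> x \<noteq> - \<kappa> \<longrightarrow> (u has_vector_derivative u' x) (at x)"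
      "\<forall>a b. a \<le> b \<longrightarrow> \<kappa> \<notin> {a..b} \<longrightarrow> - \<kappa> \<notin> {a..b} \<longrightarrow> u' b - u' a = (LINT x:{a..b}|lborel. - w x)"
      "\<forall>p\<in>{\<kappa>, - \<kappa>}. \<exists>l r. (u' \<longlongrightarrow> l) (at_left p) \<and> (u' \<longlongrightarrow> r) (at_right p) \<and>
           r - l = u p / of_real \<eta>"
    by (rule delta_hamiltonianE[OF graph])
  have [measurable]: "u \<in> borel_measurable borel" using u by (rule square_integrable_measurable)
  have "abs_L2 (\<lambda>x. w x - \<sigma> * \<i> * u x) = abs_L2 h"
    using eq by (simp add: uw scaleC_abs_L2 minus_abs_L2 u w square_integrable_cmult)
  then have AEw: "AE x in lborel. w x = h x + \<sigma> * \<i> * u x"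
    by (subst (asm) abs_L2_eq_iff)
      (auto simp: u w h square_integrable_cmult square_integrable_diff algebra_simps elim: eventually_mono)
  \<comment> \<open>The factor \<open>32 / 9\<close> is the reciprocal of \<open>1/2 * 9/16\<close>:
    the half comes from \<open>energy_density\<close>, and \<open>9/16\<close> from the lower bound
    on the cutoff weight. The inner 32 is \<open>8 * 4\<close>, where 4 bounds the square of
    \<open>W'\<close>.\<close>
  define K where "K = 32 / 9 * (32 * (norm \<psi>u)\<^sup>2 + 2 * (norm (abs_L2 (\<lambda>x. of_real x * h x)))\<^sup>2)"
  have K0: "0 \<le> K" by (simp add: K_def)
  define q where "q x = (cmod (of_real x * u x))\<^sup>2" for x :: real
  have [measurable]: "q \<in> borel_measurable borel" unfolding q_def by measurable
  \<comment> \<open>The condition \<open>m > \<kappa>\<close> places both deltas inside the interval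
    from \<open>- 2 * m\<close> to \<open>2 * m\<close>.\<close>
  have local: "(\<integral>\<^sup>+x. ennreal (indicator {-m..m} x * q x) \<partial>lborel) \<le> ennreal K" if m: "m > \<kappa>" for m
  proof -
    have m0: "m > 0" using m \<kappa> by simp
    define W where "W x = x * (1 - (x / (2 * m))\<^sup>2)" for x
    define W' where "W' x = 1 - 3 * (x / (2 * m))\<^sup>2" for x
    have dW: "(W has_real_derivative W' x) (at x)" for x
      unfolding W_def W'_def using m0
      by (auto intro!: derivative_eq_intros simp: field_simps power2_eq_square)
    have cW': "continuous_on UNIV W'" unfolding W'_def using m0 by (intro continuous_intros) auto
    have cW: "continuous_on UNIV W" unfolding W_def using m0 by (intro continuous_intros) auto
    let ?d = "\<lambda>x. indicat_real {-(2*m)..2*m} x *\<^sub>R energy_density W W' u h x"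
    have d_int: "integrable lborel ?d"
      using set_integrable_energy_density[OF cW cW' u h] unfolding set_integrable_def .
    have d_neg: "(LINT x|lborel. ?d x) \<le> 0"
      unfolding set_lebesgue_integral_def[symmetric]
      by (rule delta_energy[OF \<kappa> _ \<eta> \<sigma> u w h cu d(1)[rule_format] d(2)[rule_format]
            d(3)[rule_format] AEw dW cW']) (use \<kappa> m m0 in \<open>simp_all add: W_def\<close>)
    \<comment> \<open>\<open>?R\<close> compensates the two negative terms of the density, which
      makes it a pointwise majorant of the truncated \<open>q\<close>; the integral of
      \<open>?d\<close> is then dropped by its sign.\<close>
    let ?R = "\<lambda>x. 32 / 9 * (?d x + 32 * (cmod (u x))\<^sup>2 + 2 * (cmod (of_real x * h x))\<^sup>2)"
    have R_int: "integrable lborel ?R"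
      by (intro Bochner_Integration.integrable_add integrable_mult_right d_int square_integrable_norm_sq u xh)
    have "(LINT x|lborel. ?R x) = 32 / 9 * ((LINT x|lborel. ?d x) + 32 * (LINT x|lborel. (cmod (u x))\<^sup>2)
        + 2 * (LINT x|lborel. (cmod (of_real x * h x))\<^sup>2))"
      using d_int square_integrable_norm_sq[OF u] square_integrable_norm_sq[OF xh]
      by (simp only: integral_mult_right_zero Bochner_Integration.integral_add
          Bochner_Integration.integrable_add integrable_mult_right)
    also have "\<dots> \<le> K"
      unfolding K_def uw norm_abs_L2[OF u] norm_abs_L2[OF xh] using d_neg by simp
    finally have R_le: "(LINT x|lborel. ?R x) \<le> K" .
    have pointwise: "indicator {-m..m} x * q x \<le> ?R x" for x
    proof (cases "\<bar>x\<bar> \<le> 2 * m")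
      case False
      then show ?thesis using m0 by (auto simp: indicator_def)
    next
      case True
      then have d: "?d x = (W x)\<^sup>2 * (cmod (u x))\<^sup>2 / 2 - 8 * ((W' x)\<^sup>2 * (cmod (u x))\<^sup>2) - 2 * ((W x)\<^sup>2 * (cmod (h x))\<^sup>2)"
        by (auto simp: indicator_def energy_density_def power_mult_distrib)
      have a: "(W x)\<^sup>2 * (cmod (h x))\<^sup>2 \<le> (cmod (of_real x * h x))\<^sup>2"
        using cutoff_weight_bounds(1)[OF m0 True]
        by (simp add: W_def norm_mult power_mult_distrib mult_right_mono)
      have b: "(W' x)\<^sup>2 * (cmod (u x))\<^sup>2 \<le> 4 * (cmod (u x))\<^sup>2"
        using cutoff_weight_bounds(2)[OF m0 True] by (simp add: W'_def mult_right_mono)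
      have c: "9/16 * (indicator {-m..m} x * q x) \<le> (W x)\<^sup>2 * (cmod (u x))\<^sup>2"
      proof (cases "\<bar>x\<bar> \<le> m")
        case True
        then show ?thesis
          using mult_right_mono[OF cutoff_weight_bounds(3)[OF m0 True], of "(cmod (u x))\<^sup>2"]
          by (auto simp: indicator_def q_def W_def norm_mult power_mult_distrib)
      qed (auto simp: indicator_def)
      show ?thesis unfolding d using a b c by simp
    qed
    have "(\<integral>\<^sup>+x. ennreal (indicator {-m..m} x * q x) \<partial>lborel) \<le> (\<integral>\<^sup>+x. ennreal (?R x) \<partial>lborel)"
      by (intro nn_integral_mono ennreal_leI pointwise)
    also have "\<dots> = ennreal (LINT x|lborel. ?R x)"
    proof (rule nn_integral_eq_integral[OF R_int])
      have "0 \<le> indicator {-m..m} x * q x" for x by (simp add: q_def)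
      then show "AE x in lborel. 0 \<le> ?R x" using pointwise order_trans by blast
    qed
    also have "\<dots> \<le> ennreal K"
      by (rule ennreal_leI[OF R_le])
    finally show ?thesis .
  qed
  \<comment> \<open>Fatou's lemma along integer cutoffs removes the indicator.\<close>
  have "(\<integral>\<^sup>+x. ennreal (q x) \<partial>lborel) = (\<integral>\<^sup>+x. liminf (\<lambda>k. ennreal (indicator {-real k..real k} x * q x)) \<partial>lborel)"
  proof (intro nn_integral_cong)
    fix x
    obtain N where N: "\<bar>x\<bar> \<le> real N" using real_arch_simple by blast
    have "\<forall>\<^sub>F k in sequentially. ennreal (q x) = ennreal (indicator {-real k..real k} x * q x)"
      by (rule eventually_sequentiallyI[of N]) (use N in \<open>auto simp: indicator_def\<close>)
    then have "(\<lambda>k. ennreal (indicator {-real k..real k} x * q x)) \<longlonglongrightarrow> ennreal (q x)"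
      by (rule Lim_transform_eventually[OF tendsto_const])
    then show "ennreal (q x) = liminf (\<lambda>k. ennreal (indicator {-real k..real k} x * q x))"
      by (rule lim_imp_Liminf[OF sequentially_bot, symmetric])
  qed
  also have "\<dots> \<le> liminf (\<lambda>k. \<integral>\<^sup>+x. ennreal (indicator {-real k..real k} x * q x) \<partial>lborel)"
    by (intro nn_integral_liminf) measurable
  also have "\<dots> \<le> ennreal K"
  proof -
    obtain N where N: "\<kappa> < real N" using reals_Archimedean2 by blast
    show ?thesis
      by (intro Liminf_le eventually_sequentiallyI[of N] local) (use N in auto)
  qed
  finally have bound: "(\<integral>\<^sup>+x. ennreal (q x) \<partial>lborel) \<le> ennreal K" .
  have xu: "square_integrable (\<lambda>x. of_real x * u x)"
    unfolding square_integrable_def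
  proof
    show "integrable lborel (\<lambda>x. (cmod (of_real x * u x))\<^sup>2)"
      by (rule integrableI_bounded)
        (use bound in \<open>auto simp: q_def top.extremum_strict le_less_trans\<close>)
  qed measurable
  have "ennreal ((norm (abs_L2 (\<lambda>x. of_real x * u x)))\<^sup>2) \<le> ennreal K"
    using bound by (simp add: norm_abs_L2_nn[OF xu] q_def)
  then have "(norm (abs_L2 (\<lambda>x. of_real x * u x)))\<^sup>2 \<le> K"
    using K0 by (subst (asm) ennreal_le_iff) auto
  then show thesis using that[OF u xu uw(1)] by (simp add: K_def)
qed

text \<open>Adding \<open>f x u\<close> to \<open>w\<close> cancels the field term in the integrated
  equation, so the same \<open>u'\<close> with the same jumps serves both operators.\<close>

lemma delta_to_stark:
  assumes graph: "(\<psi>u, \<psi>w) \<in> delta_hamiltonian \<kappa> \<eta>"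
    and k: "square_integrable k" "square_integrable (\<lambda>x. of_real x * k x)" "\<psi>u = abs_L2 k"
  shows "(\<psi>u, \<psi>w + scaleC (of_real f) (abs_L2 (\<lambda>x. of_real x * k x))) \<in> stark_delta_hamiltonian \<kappa> \<eta> f"
proof -
  obtain u w u' where uw: "\<psi>u = abs_L2 u" "\<psi>w = abs_L2 w"
    and u: "square_integrable u" and w: "square_integrable w" and cu: "continuous_on UNIV u"
    and du: "\<forall>x. x \<noteq> \<kappa> \<longrightarrow> x \<noteq> - \<kappa> \<longrightarrow> (u has_vector_derivative u' x) (at x)"
    and du': "\<forall>a b. a \<le> b \<longrightarrow> \<kappa> \<notin> {a..b} \<longrightarrow> - \<kappa> \<notin> {a..b} \<longrightarrow> u' b - u' a = (LINT x:{a..b}|lborel. - w x)"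
    and jump: "\<forall>p\<in>{\<kappa>, - \<kappa>}. \<exists>l r. (u' \<longlongrightarrow> l) (at_left p) \<and> (u' \<longlongrightarrow> r) (at_right p) \<and>
           r - l = u p / of_real \<eta>"
    by (rule delta_hamiltonianE[OF graph])
  have [measurable]: "u \<in> borel_measurable borel" using u by (rule square_integrable_measurable)
  \<comment> \<open>The moment condition concerns some representative \<open>k\<close>, the
    differential equation the continuous one; they agree almost everywhere.\<close>
  have AE: "AE x in lborel. k x = u x"
    using k(3) uw(1) abs_L2_eq_iff[OF k(1) u] by simp
  have "integrable lborel (\<lambda>x. (cmod (of_real x * u x))\<^sup>2)"
    by (rule integrable_cong_AE_imp[OF square_integrable_norm_sq[OF k(2)]]) (use AE in \<open>auto elim: eventually_mono\<close>)
  then have xu: "square_integrable (\<lambda>x. of_real x * u x)"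
    by (simp add: square_integrable_def)
  have "abs_L2 (\<lambda>x. of_real x * k x) = abs_L2 (\<lambda>x. of_real x * u x)"
    by (subst abs_L2_eq_iff[OF k(2) xu]) (use AE in \<open>auto elim: eventually_mono\<close>)
  then have "\<psi>w + scaleC (of_real f) (abs_L2 (\<lambda>x. of_real x * k x))
      = abs_L2 (\<lambda>x. w x + of_real f * (of_real x * u x))"
    by (simp add: uw scaleC_abs_L2 plus_abs_L2 w xu square_integrable_cmult)
  moreover have "square_integrable (\<lambda>x. w x + of_real f * (of_real x * u x))"
    by (intro square_integrable_add square_integrable_cmult w xu)
  moreover have "of_real (f * x) * u x - (w x + of_real f * (of_real x * u x)) = - w x" for x
    by simp
  then have "\<forall>a b. a \<le> b \<longrightarrow> \<kappa> \<notin> {a..b} \<longrightarrow> - \<kappa> \<notin> {a..b} \<longrightarrow> u' b - u' a =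
      (LINT x:{a..b}|lborel. of_real (f * x) * u x - (w x + of_real f * (of_real x * u x)))"
    using du' by (simp only:)
  ultimately show ?thesis
    unfolding stark_delta_hamiltonian_def mem_Collect_eq prod.inject
    using u cu du jump uw(1)
    by (intro exI[of _ u] exI[of _ "\<lambda>x. w x + of_real f * (of_real x * u x)"] conjI exI[of _ u'])
qed

section \<open>Resolvents\<close>

definition resolvent_fun :: "complex \<Rightarrow> real \<Rightarrow> complex" where
  "resolvent_fun z s = 1 / (of_real s - z)"

lemma of_real_neq_nonreal: "Im z \<noteq> 0 \<Longrightarrow> complex_of_real s - z \<noteq> 0"
  by (metis Im_complex_of_real eq_iff_diff_eq_0)

lemma resolvent_fun_bound:
  assumes "Im z \<noteq> 0" shows "cmod (resolvent_fun z s) \<le> 1 / \<bar>Im z\<bar>"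
proof -
  have "\<bar>Im z\<bar> \<le> cmod (of_real s - z)"
    using abs_Im_le_cmod[of "of_real s - z"] by simp
  then show ?thesis using assms by (simp add: resolvent_fun_def norm_divide frac_le)
qed

lemma bounded_borel_resolvent_fun: "Im z \<noteq> 0 \<Longrightarrow> bounded_borel (resolvent_fun z)"
  by (rule bounded_borelI[where M="1 / \<bar>Im z\<bar>"])
    (auto simp: resolvent_fun_def[abs_def] intro: resolvent_fun_bound[unfolded resolvent_fun_def])

text \<open>The factor \<open>s\<close> is unbounded, but its product with the resolvent function is
  thereby expressed through bounded functions.\<close>

lemma mult_resolvent_fun: "Im z \<noteq> 0 \<Longrightarrow> of_real s * resolvent_fun z s = 1 + z * resolvent_fun z s"
  using of_real_neq_nonreal[of z s] by (simp add: resolvent_fun_def field_simps)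

lemma spectral_measure_of_pvm: "spectral_measure_of H E \<Longrightarrow> pvm E"
  by (simp add: spectral_measure_of_def pvm_def)

context pvm
begin

text \<open>The truncations have no common bound, but their products with the resolvent function do,
  and these converge pointwise to \<open>1 + z * resolvent_fun z s\<close>. One order of the factors
  serves membership in the graph, the other the left inverse.\<close>

lemma \<Phi>_truncated_tendsto:
  assumes z: "Im z \<noteq> 0"
  shows "(\<lambda>n. \<Phi> (\<lambda>s. of_real (s * indicator {- real n..real n} s)) (\<Phi> (resolvent_fun z) u))
      \<longlonglongrightarrow> u + scaleC z (\<Phi> (resolvent_fun z) u)" (is ?A)
    and "(\<lambda>n. \<Phi> (resolvent_fun z) (\<Phi> (\<lambda>s. of_real (s * indicator {- real n..real n} s)) u))
      \<longlonglongrightarrow> u + scaleC z (\<Phi> (resolvent_fun z) u)" (is ?B)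
proof -
  let ?r = "resolvent_fun z"
  let ?T = "\<lambda>n s. complex_of_real (s * indicator {- real n..real n} s)"
  note r = bounded_borel_resolvent_fun[OF z]
  have T: "bounded_borel (?T n)" for n
    by (rule bounded_borelI[where M="real n"]) (auto simp: indicator_def)
  have "(\<lambda>n. \<Phi> (\<lambda>s. ?T n s * ?r s) u) \<longlonglongrightarrow> \<Phi> (\<lambda>s. 1 + z * ?r s) u"
  proof (rule \<Phi>_tendsto[where M="1 + cmod z * (1 / \<bar>Im z\<bar>)"])
    fix n s
    have "cmod (?T n s * ?r s) \<le> cmod (of_real s * ?r s)"
      by (auto simp: indicator_def norm_mult)
    also have "\<dots> \<le> 1 + cmod z * cmod (?r s)"
      unfolding mult_resolvent_fun[OF z] using norm_triangle_ineq[of 1 "z * ?r s"] by (simp add: norm_mult)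
    also have "\<dots> \<le> 1 + cmod z * (1 / \<bar>Im z\<bar>)"
      by (intro add_left_mono mult_left_mono resolvent_fun_bound z) simp
    finally show "cmod (?T n s * ?r s) \<le> 1 + cmod z * (1 / \<bar>Im z\<bar>)" .
  next
    fix s
    obtain N where N: "\<bar>s\<bar> \<le> real N" using real_arch_simple by blast
    have "\<forall>\<^sub>F n in sequentially. 1 + z * ?r s = ?T n s * ?r s"
      by (rule eventually_sequentiallyI[of N])
        (use N in \<open>auto simp: indicator_def mult_resolvent_fun[OF z]\<close>)
    then show "(\<lambda>n. ?T n s * ?r s) \<longlonglongrightarrow> 1 + z * ?r s"
      by (rule Lim_transform_eventually[OF tendsto_const])
  qed (intro bounded_borel_mult bounded_borel_add bounded_borel_const T r)+
  moreover have "\<Phi> (\<lambda>s. 1 + z * ?r s) u = u + scaleC z (\<Phi> ?r u)"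
    by (simp add: \<Phi>_add \<Phi>_cmult \<Phi>_const scaleC_one r)
  moreover have "(\<lambda>s. ?r s * ?T n s) = (\<lambda>s. ?T n s * ?r s)" for n
    by (simp add: mult.commute)
  ultimately show ?A ?B
    by (simp_all only: \<Phi>_mult[OF T r] \<Phi>_mult[OF r T])
qed

text \<open>The factor \<open>(cmod (resolvent_fun z s))\<^sup>2\<close> in the spectral
  distribution of the new vector compensates \<open>s\<^sup>2\<close>, which puts the vector in the
  domain.\<close>

lemma resolvent_in_graph:
  assumes H: "spectral_measure_of H E" and z: "Im z \<noteq> 0"
  shows "(\<Phi> (resolvent_fun z) u, u + scaleC z (\<Phi> (resolvent_fun z) u)) \<in> H"
proof -
  let ?r = "resolvent_fun z"
  note r = bounded_borel_resolvent_fun[OF z]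
  have [measurable]: "?r \<in> borel_measurable borel" using r by (rule bounded_borel_measurable)
  have bb: "bounded_borel (\<lambda>s. of_real s * ?r s)"
    unfolding mult_resolvent_fun[OF z]
    by (intro bounded_borel_mult bounded_borel_add bounded_borel_const r)
  have "integrable (\<mu> u) (\<lambda>s. (cmod (of_real s * ?r s))\<^sup>2)"
    by (rule integrable_\<mu>_norm_sq[OF bb])
  then have "integrable (\<mu> u) (\<lambda>s. (cmod (?r s))\<^sup>2 *\<^sub>R s\<^sup>2)"
    by (simp add: norm_mult power_mult_distrib mult.commute)
  then have "integrable (\<mu> (\<Phi> ?r u)) (\<lambda>s. s\<^sup>2)"
    unfolding \<mu>_\<Phi>[OF r] by (subst integrable_density) auto
  then show ?thesis
    using H \<Phi>_truncated_tendsto(1)[OF z, of u] by (simp add: spectral_measure_of_def)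
qed

text \<open>The bounded operator is pulled through the limit that defines \<open>w\<close>.\<close>

lemma resolvent_left_inverse:
  assumes H: "spectral_measure_of H E" and z: "Im z \<noteq> 0" and uw: "(u, w) \<in> H"
  shows "\<Phi> (resolvent_fun z) (w - scaleC z u) = u"
proof -
  note r = bounded_borel_resolvent_fun[OF z]
  have "(\<lambda>n. \<Phi> (\<lambda>s. of_real (s * indicator {- real n..real n} s)) u) \<longlonglongrightarrow> w"
    using H uw by (simp add: spectral_measure_of_def)
  then have "(\<lambda>n. \<Phi> (resolvent_fun z) (\<Phi> (\<lambda>s. of_real (s * indicator {- real n..real n} s)) u))
      \<longlonglongrightarrow> \<Phi> (resolvent_fun z) w"
    by (rule bounded_linear.tendsto[OF bounded_clinearD(1)[OF bounded_clinear_\<Phi>[OF r]]])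
  from LIMSEQ_unique[OF this \<Phi>_truncated_tendsto(2)[OF z]]
  show ?thesis
    by (simp add: bounded_clinearD[OF bounded_clinear_\<Phi>[OF r]])
qed

end

section \<open>Comparison of the two functional calculi\<close>

text \<open>A single constant bounds both norms, so that only one number has to be tracked from
  factor to factor. The representative is quantified because multiplication by \<open>x\<close> is
  carried out on functions, not on classes.\<close>

definition moment_le :: "L2 \<Rightarrow> real \<Rightarrow> bool" where
  "moment_le \<psi> c \<longleftrightarrow> (\<exists>h. square_integrable h \<and> square_integrable (\<lambda>x. of_real x * h x) \<and>
     \<psi> = abs_L2 h \<and> norm \<psi> \<le> c \<and> norm (abs_L2 (\<lambda>x. of_real x * h x)) \<le> c)"

lemma moment_leE:
  assumes "moment_le \<psi> c"
  obtains h where "square_integrable h" "square_integrable (\<lambda>x. of_real x * h x)"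
     "\<psi> = abs_L2 h" "norm (abs_L2 (\<lambda>x. of_real x * h x)) \<le> c"
  using assms by (auto simp: moment_le_def)

lemma moment_le_norm: "moment_le \<psi> c \<Longrightarrow> norm \<psi> \<le> c"
  by (auto simp: moment_le_def)

lemma moment_le_nonneg: "moment_le \<psi> c \<Longrightarrow> 0 \<le> c"
  using moment_le_norm norm_ge_zero order_trans by blast

lemma moment_le_mono: "moment_le \<psi> c \<Longrightarrow> c \<le> d \<Longrightarrow> moment_le \<psi> d"
  unfolding moment_le_def by (blast intro: order_trans)

lemma moment_le_add:
  assumes "moment_le \<psi> c" "moment_le \<xi> d" shows "moment_le (\<psi> + \<xi>) (c + d)"
proof -
  from assms(1) obtain h where h: "square_integrable h" "square_integrable (\<lambda>x. of_real x * h x)"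
     "\<psi> = abs_L2 h" "norm (abs_L2 (\<lambda>x. of_real x * h x)) \<le> c" by (rule moment_leE)
  from assms(2) obtain k where k: "square_integrable k" "square_integrable (\<lambda>x. of_real x * k x)"
     "\<xi> = abs_L2 k" "norm (abs_L2 (\<lambda>x. of_real x * k x)) \<le> d" by (rule moment_leE)
  have "(\<lambda>x. of_real x * (h x + k x)) = (\<lambda>x. of_real x * h x + of_real x * k x)"
    by (simp add: distrib_left)
  moreover have "norm (abs_L2 (\<lambda>x. of_real x * h x + of_real x * k x)) \<le> c + d"
    using norm_triangle_mono[OF h(4) k(4)] by (simp add: plus_abs_L2 h k)
  moreover have "norm (\<psi> + \<xi>) \<le> c + d"
    using assms by (intro norm_triangle_mono moment_le_norm)
  ultimately show ?thesis
    unfolding moment_le_def using h k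
    by (intro exI[of _ "\<lambda>x. h x + k x"]) (simp add: plus_abs_L2 square_integrable_add)
qed

lemma moment_le_scaleC:
  assumes "moment_le \<psi> c" shows "moment_le (scaleC a \<psi>) (cmod a * c)"
proof -
  from assms obtain h where h: "square_integrable h" "square_integrable (\<lambda>x. of_real x * h x)"
     "\<psi> = abs_L2 h" "norm (abs_L2 (\<lambda>x. of_real x * h x)) \<le> c" by (rule moment_leE)
  have "(\<lambda>x. of_real x * (a * h x)) = (\<lambda>x. a * (of_real x * h x))"
    by (simp add: mult.left_commute)
  moreover have "norm (abs_L2 (\<lambda>x. a * (of_real x * h x))) \<le> cmod a * c"
    using h(4) by (simp add: scaleC_abs_L2[symmetric] h norm_scaleC mult_left_mono)
  moreover have "norm (scaleC a \<psi>) \<le> cmod a * c"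
    using moment_le_norm[OF assms] by (simp add: norm_scaleC mult_left_mono)
  ultimately show ?thesis
    unfolding moment_le_def using h
    by (intro exI[of _ "\<lambda>x. a * h x"]) (simp add: scaleC_abs_L2 square_integrable_cmult)
qed

lemma resolvent_comparison:
  fixes \<kappa> \<eta> f \<sigma> c :: real
  assumes \<kappa>: "\<kappa> > 0" and \<eta>: "\<eta> > 0" and f: "f > 0" and \<sigma>: "\<sigma> = 1 \<or> \<sigma> = -1"
    and E: "spectral_measure_of (stark_delta_hamiltonian \<kappa> \<eta> f) E"
    and E0: "spectral_measure_of (delta_hamiltonian \<kappa> \<eta>) E0"
    and \<psi>: "moment_le \<psi> c"
  defines "r \<equiv> resolvent_fun (\<sigma> * \<i>)"
  shows "moment_le (spectral_integral E0 r \<psi>) (11 * c)"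
    and "norm (spectral_integral E r \<psi> - spectral_integral E0 r \<psi>) \<le> f * (11 * c)"
proof -
  interpret E: pvm E by (rule spectral_measure_of_pvm[OF E])
  interpret E0: pvm E0 by (rule spectral_measure_of_pvm[OF E0])
  define z where "z = \<sigma> * \<i>"
  have z: "Im z \<noteq> 0" "\<bar>Im z\<bar> = 1" using \<sigma> by (auto simp: z_def)
  have rb: "bounded_borel r" and r1: "cmod (r s) \<le> 1" for s
    using bounded_borel_resolvent_fun[OF z(1)] resolvent_fun_bound[OF z(1)] z(2) by (auto simp: r_def z_def)
  define u where "u = spectral_integral E0 r \<psi>"
  have graph: "(u, \<psi> + scaleC z u) \<in> delta_hamiltonian \<kappa> \<eta>"
    unfolding u_def r_def z_def[symmetric] by (rule E0.resolvent_in_graph[OF E0 z(1)])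
  have c: "0 \<le> c" "norm \<psi> \<le> c" using moment_le_nonneg[OF \<psi>] moment_le_norm[OF \<psi>] .
  have u_norm: "norm u \<le> c"
    unfolding u_def using E0.norm_\<Phi>_le[OF rb r1, of \<psi>] c by simp
  from \<psi> obtain h where h: "square_integrable h" "square_integrable (\<lambda>x. of_real x * h x)"
     "\<psi> = abs_L2 h" and h_norm: "norm (abs_L2 (\<lambda>x. of_real x * h x)) \<le> c" by (rule moment_leE)
  have "(\<psi> + scaleC z u) - scaleC (\<sigma> * \<i>) u = abs_L2 h" by (simp add: z_def h(3))
  from delta_moment[OF \<kappa> \<eta> \<sigma> graph this h(1,2)] obtain k where
    k: "square_integrable k" "square_integrable (\<lambda>x. of_real x * k x)" "u = abs_L2 k"
    and k_norm: "(norm (abs_L2 (\<lambda>x. of_real x * k x)))\<^sup>2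
      \<le> 32 / 9 * (32 * (norm u)\<^sup>2 + 2 * (norm (abs_L2 (\<lambda>x. of_real x * h x)))\<^sup>2)" by blast
  define X where "X = abs_L2 (\<lambda>x. of_real x * k x)"
  have "(norm u)\<^sup>2 \<le> c\<^sup>2" "(norm (abs_L2 (\<lambda>x. of_real x * h x)))\<^sup>2 \<le> c\<^sup>2"
    using u_norm h_norm by (auto intro: power_mono)
  then have "32 / 9 * (32 * (norm u)\<^sup>2 + 2 * (norm (abs_L2 (\<lambda>x. of_real x * h x)))\<^sup>2)
      \<le> 32 / 9 * (32 * c\<^sup>2 + 2 * c\<^sup>2)"
    by (intro mult_left_mono add_mono) auto
  with k_norm have "(norm X)\<^sup>2 \<le> 32 / 9 * (32 * c\<^sup>2 + 2 * c\<^sup>2)"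
    unfolding X_def by (rule order_trans)
  \<comment> \<open>The constant 11 originates here: \<open>32 / 9 * 34 = 1088 / 9\<close> is just
    below 121.\<close>
  also have "\<dots> \<le> (11 * c)\<^sup>2" by (simp add: power_mult_distrib)
  finally have X: "norm X \<le> 11 * c" by (rule power2_le_imp_le) (use c(1) in simp)
  have "norm u \<le> 11 * c" using u_norm c(1) by linarith
  with X k show "moment_le (spectral_integral E0 r \<psi>) (11 * c)"
    unfolding u_def[symmetric] X_def moment_le_def by blast
  \<comment> \<open>The Stark operator minus \<open>z\<close> maps \<open>u\<close> to
    \<open>\<psi> + f X\<close>, so its left inverse sends that vector back to
    \<open>u\<close>.\<close>
  have "spectral_integral E r ((\<psi> + scaleC z u + scaleC (of_real f) X) - scaleC z u) = u"
    unfolding r_def z_def[symmetric] X_def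
    by (rule E.resolvent_left_inverse[OF E z(1) delta_to_stark[OF graph k]])
  then have "spectral_integral E r \<psi> + scaleC (of_real f) (spectral_integral E r X) = u"
    by (simp add: bounded_clinearD[OF E.bounded_clinear_\<Phi>[OF rb]])
  then have "spectral_integral E r \<psi> - u = - scaleC (of_real f) (spectral_integral E r X)"
    by (simp add: algebra_simps)
  then have "norm (spectral_integral E r \<psi> - u) = f * norm (spectral_integral E r X)"
    using f by (simp add: norm_scaleC)
  also have "\<dots> \<le> f * (11 * c)"
    using E.norm_\<Phi>_le[OF rb r1, of X] X f by (intro mult_left_mono) auto
  finally show "norm (spectral_integral E r \<psi> - spectral_integral E0 r \<psi>) \<le> f * (11 * c)"
    by (simp add: u_def)
qed

text \<open>The estimates survive products only because the moment bound for \<open>g(H\<^sub>0)\<close> is part of the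
  property: \<open>g(H\<^sub>0) \<psi>\<close> depends on \<open>\<eta>\<close>, but stays in a set on which the next factor is controlled
  uniformly in \<open>\<eta>\<close>.\<close>

definition stable_bound :: "real \<Rightarrow> real \<Rightarrow> (real \<Rightarrow> complex) \<Rightarrow> bool" where
  "stable_bound \<kappa> C g \<longleftrightarrow> bounded_borel g \<and> (\<forall>s. cmod (g s) \<le> C) \<and>
     (\<forall>f \<eta> E E0 \<psi> c. 0 < f \<longrightarrow> 0 < \<eta> \<longrightarrow> spectral_measure_of (stark_delta_hamiltonian \<kappa> \<eta> f) E \<longrightarrow>
        spectral_measure_of (delta_hamiltonian \<kappa> \<eta>) E0 \<longrightarrow> moment_le \<psi> c \<longrightarrow>
        moment_le (spectral_integral E0 g \<psi>) (C * c) \<and>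
        norm (spectral_integral E g \<psi> - spectral_integral E0 g \<psi>) \<le> f * (C * c))"

lemma stable_boundD:
  assumes "stable_bound \<kappa> C g"
  shows "bounded_borel g" "cmod (g s) \<le> C" "0 \<le> C"
    and "0 < f \<Longrightarrow> 0 < \<eta> \<Longrightarrow> spectral_measure_of (stark_delta_hamiltonian \<kappa> \<eta> f) E \<Longrightarrow>
        spectral_measure_of (delta_hamiltonian \<kappa> \<eta>) E0 \<Longrightarrow> moment_le \<psi> c \<Longrightarrow>
        moment_le (spectral_integral E0 g \<psi>) (C * c)"
    and "0 < f \<Longrightarrow> 0 < \<eta> \<Longrightarrow> spectral_measure_of (stark_delta_hamiltonian \<kappa> \<eta> f) E \<Longrightarrow>
        spectral_measure_of (delta_hamiltonian \<kappa> \<eta>) E0 \<Longrightarrow> moment_le \<psi> c \<Longrightarrow>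
        norm (spectral_integral E g \<psi> - spectral_integral E0 g \<psi>) \<le> f * (C * c)"
proof -
  show C: "cmod (g s) \<le> C" for s using assms by (simp add: stable_bound_def)
  show "0 \<le> C" using order_trans[OF norm_ge_zero C] .
qed (use assms in \<open>auto simp: stable_bound_def\<close>)

lemma stable_bound_mono:
  assumes g: "stable_bound \<kappa> C g" and CD: "C \<le> D" shows "stable_bound \<kappa> D g"
  unfolding stable_bound_def
proof (intro conjI allI impI)
  fix f \<eta> E E0 \<psi> c
  assume *: "0 < f" "0 < \<eta>" "spectral_measure_of (stark_delta_hamiltonian \<kappa> \<eta> f) E"
    "spectral_measure_of (delta_hamiltonian \<kappa> \<eta>) E0" "moment_le \<psi> c"
  have le: "C * c \<le> D * c" using CD moment_le_nonneg[OF *(5)] by (rule mult_right_mono)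
  show "moment_le (spectral_integral E0 g \<psi>) (D * c)"
    using stable_boundD(4)[OF g *] le by (rule moment_le_mono)
  show "norm (spectral_integral E g \<psi> - spectral_integral E0 g \<psi>) \<le> f * (D * c)"
    using stable_boundD(5)[OF g *] mult_left_mono[OF le, of f] *(1) by linarith
qed (use stable_boundD(1,2)[OF g] CD order_trans in blast)+

lemma stable_bound_const: "stable_bound \<kappa> (cmod a) (\<lambda>_. a)"
  unfolding stable_bound_def
proof (intro conjI allI impI)
  fix f \<eta> E E0 \<psi> c
  assume *: "0 < (f::real)" "0 < \<eta>" "spectral_measure_of (stark_delta_hamiltonian \<kappa> \<eta> f) E"
    "spectral_measure_of (delta_hamiltonian \<kappa> \<eta>) E0" "moment_le \<psi> c"
  interpret E: pvm E by (rule spectral_measure_of_pvm[OF *(3)])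
  interpret E0: pvm E0 by (rule spectral_measure_of_pvm[OF *(4)])
  show "moment_le (spectral_integral E0 (\<lambda>_. a) \<psi>) (cmod a * c)"
    using moment_le_scaleC[OF *(5)] by (simp add: E0.\<Phi>_const)
  show "norm (spectral_integral E (\<lambda>_. a) \<psi> - spectral_integral E0 (\<lambda>_. a) \<psi>) \<le> f * (cmod a * c)"
    using moment_le_nonneg[OF *(5)] *(1) by (simp add: E0.\<Phi>_const E.\<Phi>_const)
qed auto

lemma stable_bound_add:
  assumes g: "stable_bound \<kappa> C g" and h: "stable_bound \<kappa> D h"
  shows "stable_bound \<kappa> (C + D) (\<lambda>s. g s + h s)"
  unfolding stable_bound_def
proof (intro conjI allI impI)
  note bb = stable_boundD(1)[OF g] stable_boundD(1)[OF h]
  show "bounded_borel (\<lambda>s. g s + h s)" using bb by (rule bounded_borel_add)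
  show "cmod (g s + h s) \<le> C + D" for s
    using stable_boundD(2)[OF g] stable_boundD(2)[OF h] by (rule norm_triangle_mono)
  fix f \<eta> E E0 \<psi> c
  assume *: "0 < (f::real)" "0 < \<eta>" "spectral_measure_of (stark_delta_hamiltonian \<kappa> \<eta> f) E"
    "spectral_measure_of (delta_hamiltonian \<kappa> \<eta>) E0" "moment_le \<psi> c"
  interpret E: pvm E by (rule spectral_measure_of_pvm[OF *(3)])
  interpret E0: pvm E0 by (rule spectral_measure_of_pvm[OF *(4)])
  show "moment_le (spectral_integral E0 (\<lambda>s. g s + h s) \<psi>) ((C + D) * c)"
    unfolding E0.\<Phi>_add[OF bb] distrib_right
    by (rule moment_le_add[OF stable_boundD(4)[OF g *] stable_boundD(4)[OF h *]])
  have eq: "spectral_integral E (\<lambda>s. g s + h s) \<psi> - spectral_integral E0 (\<lambda>s. g s + h s) \<psi>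
      = (spectral_integral E g \<psi> - spectral_integral E0 g \<psi>) + (spectral_integral E h \<psi> - spectral_integral E0 h \<psi>)"
    unfolding E0.\<Phi>_add[OF bb] E.\<Phi>_add[OF bb] by simp
  show "norm (spectral_integral E (\<lambda>s. g s + h s) \<psi> - spectral_integral E0 (\<lambda>s. g s + h s) \<psi>) \<le> f * ((C + D) * c)"
    unfolding eq distrib_right distrib_left
    by (rule norm_triangle_mono[OF stable_boundD(5)[OF g *] stable_boundD(5)[OF h *]])
qed

text \<open>The difference telescopes as
  \<open>g(H\<^sub>f) (v - v0) + (g(H\<^sub>f) - g(H\<^sub>0)) v0\<close>. The first term uses the
  sup bound of \<open>g\<close>, the second the moment bound of \<open>v0\<close>; each contributes
  \<open>C * D\<close>, whence the factor 2.\<close>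

lemma stable_bound_mult:
  assumes g: "stable_bound \<kappa> C g" and h: "stable_bound \<kappa> D h"
  shows "stable_bound \<kappa> (2 * C * D) (\<lambda>s. g s * h s)"
  unfolding stable_bound_def
proof (intro conjI allI impI)
  note bb = stable_boundD(1)[OF g] stable_boundD(1)[OF h]
  note nn = stable_boundD(3)[OF g] stable_boundD(3)[OF h]
  show "bounded_borel (\<lambda>s. g s * h s)" using bb by (rule bounded_borel_mult)
  have CD: "C * D \<le> 2 * C * D" using nn by simp
  have "cmod (g s * h s) \<le> C * D" for s
    unfolding norm_mult by (intro mult_mono stable_boundD(2)[OF g] stable_boundD(2)[OF h] nn norm_ge_zero)
  then show "cmod (g s * h s) \<le> 2 * C * D" for s using CD order_trans by blast
  fix f \<eta> E E0 \<psi> c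
  assume *: "0 < (f::real)" "0 < \<eta>" "spectral_measure_of (stark_delta_hamiltonian \<kappa> \<eta> f) E"
    "spectral_measure_of (delta_hamiltonian \<kappa> \<eta>) E0" "moment_le \<psi> c"
  interpret E: pvm E by (rule spectral_measure_of_pvm[OF *(3)])
  interpret E0: pvm E0 by (rule spectral_measure_of_pvm[OF *(4)])
  define v v0 where "v = spectral_integral E h \<psi>" and "v0 = spectral_integral E0 h \<psi>"
  have v0: "moment_le v0 (D * c)" unfolding v0_def by (rule stable_boundD(4)[OF h *])
  have diff: "norm (v - v0) \<le> f * (D * c)" unfolding v_def v0_def by (rule stable_boundD(5)[OF h *])
  have "moment_le (spectral_integral E0 g v0) (C * (D * c))"
    by (rule stable_boundD(4)[OF g *(1-4) v0])
  moreover have "C * (D * c) \<le> 2 * C * D * c"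
    using mult_right_mono[OF CD moment_le_nonneg[OF *(5)]] by (simp add: mult.assoc)
  ultimately show "moment_le (spectral_integral E0 (\<lambda>s. g s * h s) \<psi>) (2 * C * D * c)"
    unfolding E0.\<Phi>_mult[OF bb, symmetric] v0_def by (rule moment_le_mono)
  have "spectral_integral E (\<lambda>s. g s * h s) \<psi> - spectral_integral E0 (\<lambda>s. g s * h s) \<psi>
      = spectral_integral E g (v - v0) + (spectral_integral E g v0 - spectral_integral E0 g v0)"
    by (simp add: E0.\<Phi>_mult[OF bb, symmetric] E.\<Phi>_mult[OF bb, symmetric] v_def v0_def
        bounded_clinearD[OF E.bounded_clinear_\<Phi>[OF bb(1)]])
  also have "norm \<dots> \<le> C * norm (v - v0) + f * (C * (D * c))"
    by (intro norm_triangle_mono E.norm_\<Phi>_le stable_boundD(1,2)[OF g] stable_boundD(5)[OF g *(1-4) v0])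
  also have "\<dots> \<le> C * (f * (D * c)) + f * (C * (D * c))"
    by (intro add_right_mono mult_left_mono diff nn)
  finally show "norm (spectral_integral E (\<lambda>s. g s * h s) \<psi> - spectral_integral E0 (\<lambda>s. g s * h s) \<psi>)
      \<le> f * (2 * C * D * c)"
    by (simp add: algebra_simps)
qed

lemma stable_bound_resolvent_fun:
  fixes \<sigma> :: real
  assumes \<kappa>: "\<kappa> > 0" and \<sigma>: "\<sigma> = 1 \<or> \<sigma> = -1"
  shows "stable_bound \<kappa> 11 (resolvent_fun (\<sigma> * \<i>))"
  unfolding stable_bound_def
proof (intro conjI allI impI)
  have z: "Im (\<sigma> * \<i>) \<noteq> 0" "\<bar>Im (\<sigma> * \<i>)\<bar> = 1" using \<sigma> by auto
  show "bounded_borel (resolvent_fun (\<sigma> * \<i>))" by (rule bounded_borel_resolvent_fun[OF z(1)])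
  show "cmod (resolvent_fun (\<sigma> * \<i>) s) \<le> 11" for s
    using resolvent_fun_bound[OF z(1), of s] unfolding z(2) by linarith
qed (use resolvent_comparison[OF \<kappa> _ _ \<sigma>] in blast)+

section \<open>Time-dependent families and polynomial approximation\<close>

definition stable_family :: "real \<Rightarrow> real \<Rightarrow> (real \<Rightarrow> real \<Rightarrow> complex) \<Rightarrow> bool" where
  "stable_family \<kappa> T G \<longleftrightarrow> (\<exists>C. \<forall>t\<in>{0..T}. stable_bound \<kappa> C (G t))"

lemma stable_family_const: "stable_family \<kappa> T (\<lambda>t s. a)"
  unfolding stable_family_def using stable_bound_const by blast

text \<open>Time acts as a multiple of the identity, so one polynomial can serve all times up to
  \<open>T\<close> with one constant.\<close>

lemma stable_family_time: "stable_family \<kappa> T (\<lambda>t s. of_real t)"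
  unfolding stable_family_def
proof (intro exI ballI)
  fix t assume "t \<in> {0..T}"
  then show "stable_bound \<kappa> T (\<lambda>s. of_real t)"
    using stable_bound_const[of \<kappa> "of_real t"] by (auto intro: stable_bound_mono)
qed

lemma stable_family_add:
  assumes "stable_family \<kappa> T G" "stable_family \<kappa> T H"
  shows "stable_family \<kappa> T (\<lambda>t s. G t s + H t s)"
proof -
  obtain C D where "\<And>t. t \<in> {0..T} \<Longrightarrow> stable_bound \<kappa> C (G t)" "\<And>t. t \<in> {0..T} \<Longrightarrow> stable_bound \<kappa> D (H t)"
    using assms unfolding stable_family_def by blast
  then have "\<forall>t\<in>{0..T}. stable_bound \<kappa> (C + D) (\<lambda>s. G t s + H t s)"
    by (intro ballI stable_bound_add)
  then show ?thesis unfolding stable_family_def by blast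
qed

lemma stable_family_mult:
  assumes "stable_family \<kappa> T G" "stable_family \<kappa> T H"
  shows "stable_family \<kappa> T (\<lambda>t s. G t s * H t s)"
proof -
  obtain C D where "\<And>t. t \<in> {0..T} \<Longrightarrow> stable_bound \<kappa> C (G t)" "\<And>t. t \<in> {0..T} \<Longrightarrow> stable_bound \<kappa> D (H t)"
    using assms unfolding stable_family_def by blast
  then have "\<forall>t\<in>{0..T}. stable_bound \<kappa> (2 * C * D) (\<lambda>s. G t s * H t s)"
    by (intro ballI stable_bound_mult)
  then show ?thesis unfolding stable_family_def by blast
qed

text \<open>\<open>s \<mapsto> (s / (1 + s\<^sup>2), 1 / (1 + s\<^sup>2))\<close> parametrizes the circle \<open>p\<^sup>2 + q\<^sup>2 = q\<close> without the origin,
  which corresponds to \<open>s = \<infinity>\<close>. Both coordinates are combinations of \<open>1 / (s \<plusminus> \<i>)\<close>.\<close>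

lemma stable_family_circle_coordinates:
  assumes \<kappa>: "\<kappa> > 0"
  shows "stable_family \<kappa> T (\<lambda>t s. of_real (s / (1 + s\<^sup>2)))" and "stable_family \<kappa> T (\<lambda>t s. of_real (1 / (1 + s\<^sup>2)))"
proof -
  have r: "stable_family \<kappa> T (\<lambda>t. resolvent_fun \<i>)" "stable_family \<kappa> T (\<lambda>t. resolvent_fun (- \<i>))"
    using stable_bound_resolvent_fun[OF \<kappa>, of 1] stable_bound_resolvent_fun[OF \<kappa>, of "-1"]
    unfolding stable_family_def by auto
  have nz: "complex_of_real s - \<i> \<noteq> 0" "complex_of_real s + \<i> \<noteq> 0" "1 + (complex_of_real s)\<^sup>2 \<noteq> 0"
    "(complex_of_real s - \<i>) * (complex_of_real s + \<i>) = 1 + (complex_of_real s)\<^sup>2" for s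
  proof -
    show "complex_of_real s - \<i> \<noteq> 0" "complex_of_real s + \<i> \<noteq> 0"
      by (auto simp: complex_eq_iff)
    moreover show "(complex_of_real s - \<i>) * (complex_of_real s + \<i>) = 1 + (complex_of_real s)\<^sup>2"
      by (simp add: algebra_simps power2_eq_square)
    ultimately show "1 + (complex_of_real s)\<^sup>2 \<noteq> 0" by (metis mult_eq_0_iff)
  qed
  have sum: "resolvent_fun \<i> s + resolvent_fun (- \<i>) s = 2 * s / (1 + (complex_of_real s)\<^sup>2)"
    "resolvent_fun \<i> s + - 1 * resolvent_fun (- \<i>) s = 2 * \<i> / (1 + (complex_of_real s)\<^sup>2)" for s
    using nz[of s] by (simp_all add: resolvent_fun_def add_frac_eq diff_frac_eq algebra_simps)
  have "stable_family \<kappa> T (\<lambda>t s. (1/2) * (resolvent_fun \<i> s + resolvent_fun (- \<i>) s))"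
    by (intro stable_family_mult stable_family_add stable_family_const r)
  moreover have "(\<lambda>t s. (1/2) * (resolvent_fun \<i> s + resolvent_fun (- \<i>) s)) = (\<lambda>(t::real) s. of_real (s / (1 + s\<^sup>2)))"
    unfolding sum by simp
  ultimately show "stable_family \<kappa> T (\<lambda>t s. of_real (s / (1 + s\<^sup>2)))"
    by (rule back_subst[of "stable_family \<kappa> T"])
  have "stable_family \<kappa> T (\<lambda>t s. (1 / (2 * \<i>)) * (resolvent_fun \<i> s + - 1 * resolvent_fun (- \<i>) s))"
    by (intro stable_family_mult stable_family_add stable_family_const r)
  moreover have "(\<lambda>t s. (1 / (2 * \<i>)) * (resolvent_fun \<i> s + - 1 * resolvent_fun (- \<i>) s))
      = (\<lambda>(t::real) s. of_real (1 / (1 + s\<^sup>2)))"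
    unfolding sum by simp
  ultimately show "stable_family \<kappa> T (\<lambda>t s. of_real (1 / (1 + s\<^sup>2)))"
    by (rule back_subst[of "stable_family \<kappa> T"])
qed

lemma stable_family_polynomial:
  fixes p :: "real \<times> real \<times> real \<Rightarrow> real"
  assumes \<kappa>: "\<kappa> > 0" and p: "real_polynomial_function p"
  shows "stable_family \<kappa> T (\<lambda>t s. of_real (p (t, s / (1 + s\<^sup>2), 1 / (1 + s\<^sup>2))))"
  using p
proof induction
  case (linear p)
  then interpret bounded_linear p .
  \<comment> \<open>By linearity \<open>p\<close> is a combination of the three coordinates, each of
    which is a stable family.\<close>
  define c1 c2 c3 where "c1 = p (1, 0, 0)" and "c2 = p (0, 1, 0)" and "c3 = p (0, 0, 1)"
  have eq: "p (t, a, b) = t * c1 + (a * c2 + b * c3)" for t a b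
  proof -
    have "(t, a, b) = t *\<^sub>R (1, 0, 0) + (a *\<^sub>R (0, 1, 0) + b *\<^sub>R (0, 0, 1))" by simp
    then have "p (t, a, b) = p (t *\<^sub>R (1, 0, 0) + (a *\<^sub>R (0, 1, 0) + b *\<^sub>R (0, 0, 1)))" by (simp only:)
    then show ?thesis by (simp only: add scale real_scaleR_def c1_def c2_def c3_def)
  qed
  then show ?case
    unfolding eq of_real_add of_real_mult
    by (intro stable_family_add stable_family_mult stable_family_const stable_family_time stable_family_circle_coordinates[OF \<kappa>])
next
  case (const a)
  then show ?case by (rule stable_family_const)
next
  case (add p q)
  then show ?case by (simp only: of_real_add) (rule stable_family_add)
next
  case (mult p q)
  then show ?case by (simp only: of_real_mult) (rule stable_family_mult)
qed

text \<open>Transported to the compact set \<open>K\<close> of times and circle points, the function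
  extends continuously by zero to the origin of the circle, because \<open>chi\<close> vanishes for
  large \<open>s\<close>.\<close>

lemma stable_family_dense:
  fixes chi :: "real \<Rightarrow> complex"
  assumes \<kappa>: "\<kappa> > 0" and chi: "continuous_on UNIV chi" and M: "\<And>s. \<bar>s\<bar> > M \<Longrightarrow> chi s = 0" and M0: "M \<ge> 0"
    and e: "e > 0"
  obtains G where "stable_family \<kappa> T G"
    "\<And>t s. t \<in> {0..T} \<Longrightarrow> cmod (exp (- \<i> * of_real (t * s)) * chi s - G t s) \<le> e"
proof -
  \<comment> \<open>If \<open>1 / (1 + s\<^sup>2) \<le> \<delta>\<close> then
    \<open>s\<^sup>2 \<ge> 1 + 2 * M\<^sup>2\<close>, so \<open>chi\<close> is already zero at
    height \<open>q = \<delta>\<close> and the two branches of \<open>F\<close> agree there.\<close>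
  define \<delta> where "\<delta> = 1 / (2 * (1 + M\<^sup>2))"
  have \<delta>: "\<delta> > 0" unfolding \<delta>_def by (auto simp: add_pos_nonneg)
  define K where "K = {(t, p, q). t \<in> {0..T} \<and> p\<^sup>2 + q\<^sup>2 = (q::real)}"
  \<comment> \<open>Away from the origin of the circle, \<open>p / q\<close> recovers
    \<open>s\<close>.\<close>
  define F where "F x = (case x of (t, p, q) \<Rightarrow>
      if \<delta> \<le> q then exp (- \<i> * of_real (t * (p / q))) * chi (p / q) else 0)" for x :: "real \<times> real \<times> real"
  have far: "chi s = 0" if "1 / (1 + s\<^sup>2) \<le> \<delta>" for s
  proof (rule M)
    have pos: "0 < 1 + s\<^sup>2" "0 < 1 + M\<^sup>2" by (auto simp: add_pos_nonneg)
    have "2 * (1 + M\<^sup>2) \<le> 1 + s\<^sup>2" using that pos unfolding \<delta>_def by (simp add: field_simps)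
    then have "1 + 2 * M\<^sup>2 \<le> s\<^sup>2" by simp
    then have "M\<^sup>2 < s\<^sup>2" using zero_le_power2[of M] by linarith
    then show "M < \<bar>s\<bar>" using M0 by (metis abs_ge_zero power2_abs power2_less_imp_less)
  qed
  have F_circle: "F (t, s / (1 + s\<^sup>2), 1 / (1 + s\<^sup>2)) = exp (- \<i> * of_real (t * s)) * chi s" for t s
  proof -
    have "1 + s\<^sup>2 \<noteq> 0" by (metis add_pos_nonneg less_irrefl zero_le_power2 zero_less_one)
    then have "s / (1 + s\<^sup>2) / (1 / (1 + s\<^sup>2)) = s" by simp
    then show ?thesis unfolding F_def using far[of s] by simp
  qed
  have circle_K: "(t, s / (1 + s\<^sup>2), 1 / (1 + s\<^sup>2)) \<in> K" if "t \<in> {0..T}" for t s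
  proof -
    have nz: "1 + s\<^sup>2 \<noteq> 0" by (metis add_pos_nonneg less_irrefl zero_le_power2 zero_less_one)
    have "(s / (1 + s\<^sup>2))\<^sup>2 + (1 / (1 + s\<^sup>2))\<^sup>2 = (1 + s\<^sup>2) / (1 + s\<^sup>2)\<^sup>2"
      by (simp add: power_divide add_divide_distrib[symmetric] add.commute)
    also have "\<dots> = 1 / (1 + s\<^sup>2)" using nz by (simp add: power2_eq_square)
    finally show ?thesis using that by (simp add: K_def)
  qed
  have closed_K: "closed K"
  proof -
    have "K = {x. 0 \<le> fst x} \<inter> {x. fst x \<le> T} \<inter> {x. (fst (snd x))\<^sup>2 + (snd (snd x))\<^sup>2 = snd (snd x)}"
      unfolding K_def by auto
    moreover have "closed \<dots>"
      by (intro closed_Int closed_Collect_le closed_Collect_eq continuous_intros)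
    ultimately show ?thesis by simp
  qed
  have "K \<subseteq> {0..T} \<times> {-1..1} \<times> {-1..1}"
  proof (clarsimp simp: K_def)
    fix p q :: real assume pq: "p\<^sup>2 + q\<^sup>2 = q"
    have "q\<^sup>2 \<le> q" "p\<^sup>2 \<le> q" using pq zero_le_power2[of p] zero_le_power2[of q] by linarith+
    moreover from this have "0 \<le> q" using zero_le_power2[of q] by linarith
    ultimately have "q \<le> 1" by (metis linorder_not_le mult.right_neutral mult_strict_left_mono power2_eq_square
          zero_less_one order_less_trans order_le_less)
    with \<open>p\<^sup>2 \<le> q\<close> have "\<bar>p\<bar> \<le> 1" by (simp add: abs_square_le_1[symmetric])
    with \<open>0 \<le> q\<close> \<open>q \<le> 1\<close> show "- 1 \<le> p \<and> p \<le> 1 \<and> - 1 \<le> q \<and> q \<le> 1" by auto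
  qed
  moreover have "compact ({0..T} \<times> {-1..1::real} \<times> {-1..1::real})"
    by (intro compact_Times compact_Icc)
  ultimately have compact_K: "compact K"
    using closed_K by (metis compact_Int_closed inf.absorb_iff2)
  have F_cont: "continuous_on K F"
  proof -
    let ?A = "K \<inter> {x. \<delta> \<le> snd (snd x)}" and ?B = "K \<inter> {x. snd (snd x) \<le> \<delta>}"
    let ?g = "\<lambda>x. exp (- \<i> * of_real (fst x * (fst (snd x) / snd (snd x)))) * chi (fst (snd x) / snd (snd x))"
    have "continuous_on (?A \<union> ?B) (\<lambda>x. if \<delta> \<le> snd (snd x) then ?g x else 0)"
    proof (rule continuous_on_cases)
      show "closed ?A" "closed ?B"
        by (intro closed_Int closed_K closed_Collect_le continuous_intros)+
      have nz: "snd (snd x) \<noteq> 0" if "x \<in> ?A" for x using that \<delta> by auto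
      show "continuous_on ?A ?g"
        by (intro continuous_intros continuous_on_compose2[OF chi]) (use nz in auto)
      show "continuous_on ?B (\<lambda>x. 0 :: complex)" by (rule continuous_on_const)
      have "?g x = 0" if x: "x \<in> ?B" "\<delta> \<le> snd (snd x)" for x
      proof -
        obtain t p q where tpq: "x = (t, p, q)" by (metis prod.exhaust)
        have q: "q = \<delta>" "p\<^sup>2 + q\<^sup>2 = q" using x by (auto simp: tpq K_def)
        then have q0: "q \<noteq> 0" using \<delta> by simp
        have "1 + (p / q)\<^sup>2 = (p\<^sup>2 + q\<^sup>2) / q\<^sup>2" using q0 by (simp add: power_divide add_divide_distrib)
        also have "\<dots> = 1 / q" unfolding q(2) using q0 by (simp add: power2_eq_square)
        finally have "1 / (1 + (p / q)\<^sup>2) = q" by simp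
        then have "chi (p / q) = 0" using q(1) by (intro far) simp
        then show ?thesis by (simp add: tpq)
      qed
      then show "\<forall>x. x \<in> ?A \<and> \<not> \<delta> \<le> snd (snd x) \<or> x \<in> ?B \<and> \<delta> \<le> snd (snd x) \<longrightarrow> ?g x = 0"
        by blast
    qed
    moreover have "?A \<union> ?B = K" by auto
    moreover have "F = (\<lambda>x. if \<delta> \<le> snd (snd x) then ?g x else 0)"
      by (rule ext) (simp add: F_def split: prod.split)
    ultimately show ?thesis by simp
  qed
  have "e / 2 > 0" using e by simp
  \<comment> \<open>The approximation theorem concerns real functions, so the real and imaginary
    parts are treated separately with error \<open>e / 2\<close> each.\<close>
  obtain p1 where p1: "real_polynomial_function p1" "\<And>x. x \<in> K \<Longrightarrow> \<bar>Re (F x) - p1 x\<bar> < e / 2"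
    using Stone_Weierstrass_real_polynomial_function[OF compact_K continuous_on_Re[OF F_cont] \<open>e / 2 > 0\<close>]
    by metis
  obtain p2 where p2: "real_polynomial_function p2" "\<And>x. x \<in> K \<Longrightarrow> \<bar>Im (F x) - p2 x\<bar> < e / 2"
    using Stone_Weierstrass_real_polynomial_function[OF compact_K continuous_on_Im[OF F_cont] \<open>e / 2 > 0\<close>]
    by metis
  show thesis
  proof
    let ?G = "\<lambda>t s. of_real (p1 (t, s / (1 + s\<^sup>2), 1 / (1 + s\<^sup>2)))
      + \<i> * of_real (p2 (t, s / (1 + s\<^sup>2), 1 / (1 + s\<^sup>2)))"
    show "stable_family \<kappa> T ?G"
      by (intro stable_family_add stable_family_mult stable_family_const stable_family_polynomial[OF \<kappa>] p1 p2)
    fix t s :: real assume t: "t \<in> {0..T}"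
    let ?x = "(t, s / (1 + s\<^sup>2), 1 / (1 + s\<^sup>2)) :: real \<times> real \<times> real"
    have "cmod (F ?x - ?G t s) \<le> \<bar>Re (F ?x - ?G t s)\<bar> + \<bar>Im (F ?x - ?G t s)\<bar>"
      by (rule cmod_le)
    also have "\<dots> \<le> e / 2 + e / 2"
      using p1(2)[OF circle_K[OF t]] p2(2)[OF circle_K[OF t]]
      by (intro add_mono) (simp_all add: less_imp_le)
    finally show "cmod (exp (- \<i> * of_real (t * s)) * chi s - ?G t s) \<le> e"
      by (simp add: F_circle)
  qed
qed

section \<open>Density of finite first moments and the final estimate\<close>

lemma moment_le_dense:
  assumes e: "e > 0"
  obtains \<psi> c where "moment_le \<psi> c" "norm (\<phi> - \<psi>) \<le> e"
proof -
  obtain h where h: "square_integrable h" "\<phi> = abs_L2 h" by (rule L2_exhaust)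
  have [measurable]: "h \<in> borel_measurable borel" using h(1) by (rule square_integrable_measurable)
  \<comment> \<open>Cutting \<open>h\<close> off at distance \<open>n\<close> makes the first moment
    finite, and dominated convergence recovers \<open>h\<close>.\<close>
  define k where "k n x = indicat_real {-real n..real n} x *\<^sub>R h x" for n x
  have [measurable]: "k n \<in> borel_measurable borel" for n unfolding k_def by measurable
  have k_sq: "square_integrable (k n)" for n
    unfolding square_integrable_def
  proof
    show "integrable lborel (\<lambda>x. (cmod (k n x))\<^sup>2)"
      by (rule Bochner_Integration.integrable_bound[OF square_integrable_norm_sq[OF h(1)]])
        (auto simp: k_def indicator_def)
  qed measurable
  have xk_sq: "square_integrable (\<lambda>x. of_real x * k n x)" for n
    unfolding square_integrable_def
  proof
    have "integrable lborel (\<lambda>x. (real n)\<^sup>2 * (cmod (h x))\<^sup>2)"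
      using square_integrable_norm_sq[OF h(1)] by simp
    then show "integrable lborel (\<lambda>x. (cmod (of_real x * k n x))\<^sup>2)"
    proof (rule Bochner_Integration.integrable_bound)
      have "(cmod (of_real x * k n x))\<^sup>2 \<le> (real n)\<^sup>2 * (cmod (h x))\<^sup>2" for x
      proof (cases "x \<in> {-real n..real n}")
        case True
        then have "\<bar>x\<bar> \<le> real n" by auto
        then have "\<bar>x\<bar>\<^sup>2 \<le> (real n)\<^sup>2" by (intro power_mono) auto
        with True show ?thesis by (simp add: k_def norm_mult power_mult_distrib mult_right_mono)
      qed (simp add: k_def)
      then show "AE x in lborel. norm ((cmod (of_real x * k n x))\<^sup>2) \<le> norm ((real n)\<^sup>2 * (cmod (h x))\<^sup>2)"
        by (simp add: abs_mult)
    qed measurable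
  qed measurable
  have "(\<lambda>n. LINT x|lborel. (cmod (h x - k n x))\<^sup>2) \<longlonglongrightarrow> (LINT x|(lborel::real measure). 0)"
  proof (rule integral_dominated_convergence[where w="\<lambda>x. (cmod (h x))\<^sup>2"])
    show "AE x in lborel. (\<lambda>n. (cmod (h x - k n x))\<^sup>2) \<longlonglongrightarrow> 0"
    proof (rule AE_I2)
      fix x :: real
      obtain N where N: "\<bar>x\<bar> \<le> real N" using real_arch_simple by blast
      have "\<forall>\<^sub>F n in sequentially. 0 = (cmod (h x - k n x))\<^sup>2"
        by (rule eventually_sequentiallyI[of N]) (use N in \<open>auto simp: k_def indicator_def\<close>)
      then show "(\<lambda>n. (cmod (h x - k n x))\<^sup>2) \<longlonglongrightarrow> 0"
        by (rule Lim_transform_eventually[OF tendsto_const])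
    qed
    show "AE x in lborel. norm ((cmod (h x - k n x))\<^sup>2) \<le> (cmod (h x))\<^sup>2" for n
      by (auto simp: k_def indicator_def)
  qed (use square_integrable_norm_sq[OF h(1)] in auto)
  then have "(\<lambda>n. (norm (\<phi> - abs_L2 (k n)))\<^sup>2) \<longlonglongrightarrow> 0"
    by (simp add: h minus_abs_L2 k_sq norm_abs_L2 square_integrable_diff)
  then have "\<forall>\<^sub>F n in sequentially. (norm (\<phi> - abs_L2 (k n)))\<^sup>2 < e\<^sup>2"
    by (rule order_tendstoD(2)) (use e in auto)
  then obtain n where "(norm (\<phi> - abs_L2 (k n)))\<^sup>2 < e\<^sup>2"
    by (auto simp: eventually_sequentially)
  then have "norm (\<phi> - abs_L2 (k n)) \<le> e"
    using e by (intro less_imp_le) (simp add: power2_less_imp_less)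
  moreover have "moment_le (abs_L2 (k n))
      (max (norm (abs_L2 (k n))) (norm (abs_L2 (\<lambda>x. of_real x * k n x))))"
    unfolding moment_le_def using k_sq xk_sq by fastforce
  ultimately show thesis using that by blast
qed

theorem theorem1p3:
  fixes \<kappa> T \<epsilon> :: real and \<phi> :: L2 and chi :: "real \<Rightarrow> complex"
  assumes "\<kappa> > 0"
    and "continuous_on UNIV chi" and "compact (closure {x. chi x \<noteq> 0})"
    and "T > 0" and "\<epsilon> > 0"
  shows "\<exists>f\<^sub>0>0. \<forall>t f \<eta>. 0 \<le> t \<and> t \<le> T \<and> 0 < f \<and> f < f\<^sub>0 \<and> \<eta> > 0 \<longrightarrow>
    (\<forall>E E\<^sub>0. spectral_measure_of (stark_delta_hamiltonian \<kappa> \<eta> f) E \<and>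
             spectral_measure_of (delta_hamiltonian \<kappa> \<eta>) E\<^sub>0 \<longrightarrow>
       norm (spectral_integral E (\<lambda>s. exp (- \<i> * of_real (t * s))) (spectral_integral E chi \<phi>)
           - spectral_integral E\<^sub>0 (\<lambda>s. exp (- \<i> * of_real (t * s))) (spectral_integral E\<^sub>0 chi \<phi>)) < \<epsilon>)"
proof -
  have "bounded (closure {x. chi x \<noteq> 0})" using assms(3) by (rule compact_imp_bounded)
  then obtain M where M_bound: "\<forall>x\<in>closure {x. chi x \<noteq> 0}. norm x \<le> M"
    unfolding bounded_iff by blast
  \<comment> \<open>If \<open>chi\<close> is identically zero, its support is empty and
    \<open>M\<close> may be negative; the maximum with 0 covers this case.\<close>
  have M: "chi s = 0" if "\<bar>s\<bar> > max M 0" for s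
  proof (rule ccontr)
    assume "chi s \<noteq> 0"
    then have "s \<in> closure {x. chi x \<noteq> 0}" using closure_subset by fastforce
    then have "\<bar>s\<bar> \<le> M" using M_bound by auto
    then show False using that by simp
  qed
  have chi: "bounded_borel chi"
  proof -
    have "compact (chi ` {-max M 0..max M 0})"
      by (intro compact_continuous_image continuous_on_subset[OF assms(2)] compact_Icc) auto
    then have "bounded (chi ` {-max M 0..max M 0})" by (rule compact_imp_bounded)
    then obtain B where B: "\<And>s. s \<in> {-max M 0..max M 0} \<Longrightarrow> cmod (chi s) \<le> B"
      unfolding bounded_iff by blast
    have "cmod (chi s) \<le> max B 0" for s
    proof (cases "\<bar>s\<bar> > max M 0")
      case False
      then have "s \<in> {-max M 0..max M 0}" by auto
      then show ?thesis by (rule order_trans[OF B max.cobounded1])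
    qed (simp add: M)
    then show ?thesis
      by (intro bounded_borelI[where M="max B 0"] borel_measurable_continuous_onI assms(2))
  qed
  then obtain B where B: "B > 0" "\<And>s. cmod (chi s) \<le> B" using bounded_borel_bound by metis
  \<comment> \<open>Error budget: for each of the two operators, \<open>\<epsilon> / 8\<close> for
    replacing \<phi> by \<psi> and \<open>\<epsilon> / 8\<close> for replacing the function by
    \<open>G t\<close>; a last \<open>\<epsilon> / 8\<close> for comparing the operators. The total
    is \<open>5 * \<epsilon> / 8\<close>.\<close>
  have "\<epsilon> / (8 * B) > 0" using assms(5) B(1) by simp
  then obtain \<psi> c where \<psi>: "moment_le \<psi> c" and near: "norm (\<phi> - \<psi>) \<le> \<epsilon> / (8 * B)"
    by (rule moment_le_dense)
  have c: "0 \<le> c" "norm \<psi> \<le> c" using moment_le_nonneg[OF \<psi>] moment_le_norm[OF \<psi>] .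
  \<comment> \<open>The summand 1 here and in \<open>f0\<close> avoids division by zero when
    \<open>c\<close> or \<open>C * c\<close> vanishes.\<close>
  define e where "e = \<epsilon> / (8 * (1 + c))"
  have e: "e > 0" using assms(5) c by (simp add: e_def)
  obtain G where G: "stable_family \<kappa> T G"
    and G_near: "\<And>t s. t \<in> {0..T} \<Longrightarrow> cmod (exp (- \<i> * of_real (t * s)) * chi s - G t s) \<le> e"
    by (rule stable_family_dense[OF assms(1,2) _ max.cobounded2[of 0 M] e, where T=T]) (use M that in blast)+
  obtain C where C: "\<And>t. t \<in> {0..T} \<Longrightarrow> stable_bound \<kappa> C (G t)" using G unfolding stable_family_def by blast
  have C0: "0 \<le> C" using stable_boundD(3)[OF C[of 0]] assms(4) by simp
  \<comment> \<open>All of \<open>B\<close>, \<psi>, \<open>c\<close>, \<open>G\<close> and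
    \<open>C\<close> are chosen before \<open>t\<close>, \<open>f\<close> and \<eta> are fixed,
    which makes the threshold uniform in them.\<close>
  define f0 where "f0 = \<epsilon> / (8 * (1 + C * c))"
  have f0: "f0 > 0" unfolding f0_def using assms(5) C0 c(1) by (simp add: add_pos_nonneg)
  show ?thesis
  proof (intro exI[of _ f0] conjI f0 allI impI)
    fix t f \<eta> E E0
    assume "0 \<le> t \<and> t \<le> T \<and> 0 < f \<and> f < f0 \<and> \<eta> > 0"
      and "spectral_measure_of (stark_delta_hamiltonian \<kappa> \<eta> f) E \<and>
             spectral_measure_of (delta_hamiltonian \<kappa> \<eta>) E0"
    then have t: "t \<in> {0..T}" and f: "0 < f" "f < f0" and \<eta>: "\<eta> > 0"
      and E: "spectral_measure_of (stark_delta_hamiltonian \<kappa> \<eta> f) E"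
      and E0: "spectral_measure_of (delta_hamiltonian \<kappa> \<eta>) E0" by auto
    let ?exp = "\<lambda>s. exp (- \<i> * of_real (t * s))"
    \<comment> \<open>The exponential and \<open>chi\<close> are merged, since the approximation
      concerns their product; multiplicativity separates them again at the end.\<close>
    let ?g = "\<lambda>s. ?exp s * chi s"
    have unimodular: "cmod (?exp s) = 1" for s by simp
    have expb: "bounded_borel ?exp"
      by (rule bounded_borelI[where M=1])
        (use unimodular in \<open>auto intro!: borel_measurable_continuous_onI continuous_intros\<close>)
    have g: "bounded_borel ?g" by (rule bounded_borel_mult[OF expb chi])
    have g_le: "cmod (?g s) \<le> B" for s unfolding norm_mult unimodular using B(2) by simp
    note Gt = C[OF t]
    \<comment> \<open>Stated for an arbitrary \<open>F\<close> because it is applied to both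
      spectral measures.\<close>
    have approx: "norm (spectral_integral F ?g \<phi> - spectral_integral F (G t) \<psi>) \<le> \<epsilon> / 4" if "pvm F" for F
    proof -
      interpret F: pvm F by fact
      have "spectral_integral F ?g \<phi> - spectral_integral F (G t) \<psi>
          = spectral_integral F ?g (\<phi> - \<psi>) + spectral_integral F (\<lambda>s. ?g s - G t s) \<psi>"
        by (simp only: F.\<Phi>_diff[OF g stable_boundD(1)[OF Gt]] bounded_clinearD[OF F.bounded_clinear_\<Phi>[OF g]]) simp
      also have "norm \<dots> \<le> B * norm (\<phi> - \<psi>) + e * norm \<psi>"
        by (intro norm_triangle_mono F.norm_\<Phi>_le g g_le G_near[OF t] bounded_borel_diff stable_boundD(1)[OF Gt])
      also have "\<dots> \<le> B * (\<epsilon> / (8 * B)) + e * c"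
        using B(1) e c by (intro add_mono mult_left_mono near) auto
      also have "B * (\<epsilon> / (8 * B)) = \<epsilon> / 8" using B(1) by simp
      also have "e * c \<le> \<epsilon> / 8"
        unfolding e_def using c(1) assms(5) by (simp add: field_simps)
      finally show ?thesis by simp
    qed
    have "norm (spectral_integral E (G t) \<psi> - spectral_integral E0 (G t) \<psi>) \<le> f * (C * c)"
      by (rule stable_boundD(5)[OF Gt f(1) \<eta> E E0 \<psi>])
    also have "\<dots> \<le> f0 * (C * c)"
      using f C0 c(1) by (intro mult_right_mono) auto
    also have "\<dots> \<le> \<epsilon> / 8"
      unfolding f0_def using mult_nonneg_nonneg[OF C0 c(1)] assms(5) by (simp add: field_simps add_pos_nonneg)
    finally have mid: "norm (spectral_integral E (G t) \<psi> - spectral_integral E0 (G t) \<psi>) \<le> \<epsilon> / 8" .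
    note P = spectral_measure_of_pvm[OF E] spectral_measure_of_pvm[OF E0]
    have "norm (spectral_integral E ?g \<phi> - spectral_integral E0 ?g \<phi>) < \<epsilon>"
      using approx[OF P(1)] approx[OF P(2)] mid assms(5)
        norm_triangle_ineq4[of "spectral_integral E ?g \<phi> - spectral_integral E (G t) \<psi>"
          "spectral_integral E0 ?g \<phi> - spectral_integral E0 (G t) \<psi>"]
        norm_triangle_ineq[of "(spectral_integral E ?g \<phi> - spectral_integral E (G t) \<psi>)
          - (spectral_integral E0 ?g \<phi> - spectral_integral E0 (G t) \<psi>)"
          "spectral_integral E (G t) \<psi> - spectral_integral E0 (G t) \<psi>"]
      by (simp add: algebra_simps)
    then show "norm (spectral_integral E ?exp (spectral_integral E chi \<phi>)
        - spectral_integral E0 ?exp (spectral_integral E0 chi \<phi>)) < \<epsilon>"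
      by (simp only: pvm.\<Phi>_mult[OF P(1) expb chi] pvm.\<Phi>_mult[OF P(2) expb chi])
  qed
qed

end
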